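(* Let $c_L,h\in\mathbb{C}$, $c_{L,I}\in\mathbb{C}\setminus\{0\}$, and let $h_I\in\mathbb{C}$ be such that $\frac{h_I}{c_{L,I}}-1=-p$ with $p\in\mathbb{Z}_{>0}$. Let $V'_{\alpha,\beta,F}$ be an irreducible $\mathcal H$-module from the intermediate series, let $v$ be the highest weight vector of $L^{\mathcal H}(c_L,0,c_{L,I},h,h_I)$, and let $\Lambda$, $\phi_n$, $g_p$ be as in the context. (1) Let $F/c_{L,I}\notin\{1,\dots,p-1\}$ and let $\alpha_0\in\mathbb{C}$ be such that $\phi_0(\Lambda)=0$ (where $\phi_0$ is taken with $\alpha=\alpha_0$). Then $V'_{\alpha,\beta,F}\otimes L^{\mathcal H}(c_L,0,c_{L,I},h,h_I)$ is reducible if and only if $\alpha\equiv\alpha_0\bmod\mathbb{Z}$. In this case $W^0=U(\mathcal H).(v_0\otimes v)$ is the simple submodule of $V'_{\alpha,\beta,F}\otimes L^{\mathcal H}(c_L,0,c_{L,I},h,h_I)$, and the quotient $\left(V'_{\alpha,\beta,F}\otimes L^{\mathcal H}(c_L,0,c_{L,I},h,h_I)\right)/W^0$ is a highest weight $\mathcal H$-module $\widetilde L^{\mathcal H}(c_L,0,c_{L,I},h'',h''_I)$ (not necessarily irreducible), where $$h''=-\alpha_0+h+(1-\beta),\qquad h''_I=F+h_I.$$ (2) Let $F/c_{L,I}\in\{2,\dots,p-1\}$. Then $V'_{\alpha,\beta,F}\otimes L^{\mathcal H}(c_L,0,c_{L,I},h,h_I)$ is reducible. Moreover, $g_p(ic_{L,I})=0$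 for $i=2,\dots,p$. (3) Let $p>1$ and $F/c_{L,I}=1$. Then $V'_{\alpha,\beta,F}\otimes L^{\mathcal H}(c_L,0,c_{L,I},h,h_I)$ is reducible if and only if $1-\beta=\frac{c_L-2}{24}$. Moreover, $g_p(c_{L,I})=\beta-1$.
   Context: The twisted Heisenberg-Virasoro algebra $\mathcal H$ is the complex Lie algebra with basis $\{L(n),I(n):n\in\mathbb{Z}\}\cup\{C_L,C_{LI},C_I\}$ and brackets $[L(n),L(m)]=(n-m)L(n+m)+\delta_{n,-m}\frac{n^3-n}{12}C_L$, $[L(n),I(m)]=-mI(n+m)-\delta_{n,-m}(n^2+n)C_{LI}$, $[I(n),I(m)]=n\delta_{n,-m}C_I$, with $C_L,C_{LI},C_I$ central. Put $\mathcal H^-=\mathrm{span}\{L(-i),I(-i):i\ge1\}$. $V^{\mathcal H}(c_L,0,c_{L,I},h,h_I)$ is the Verma module generated by the highest weight vector $v_{h,h_I}$ (annihilated by $L(n),I(n)$ for $n>0$; $L(0),I(0)$ act on it by $h,h_I$; $C_L,C_I,C_{LI}$ act as $c_L,0,c_{L,I}$), free of rank one over $U(\mathcal H^-)$; $L^{\mathcal H}(c_L,0,c_{L,I},h,h_I)$ is its irreducible quotient. The notation $\widetilde L^{\mathcal H}(c_L,0,c_{L,I},h'',h''_I)$ stands for some highest weight $\mathcal H$-module (a nonzero quotient of the Verma module) with the indicated highest weight. A singular vector is a nonzero vector annihilated by $L(n),I(n)$, $n>0$, that is an eigenvector of $L(0)$ and $I(0)$. $V'_{\alpha,\beta,F}=\bigoplus_{n\in\mathbb{Z}}\mathbb{C}v_n$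 denotes an irreducible $\mathcal H$-module from the intermediate series, with action $L(k)v_n=-(n+\alpha+\beta+k\beta)v_{n+k}$, $I(k)v_n=Fv_{n+k}$, and $C_L,C_{LI},C_I$ acting as $0$. The tensor product is the usual tensor product of Lie algebra modules. Schur polynomials: $\exp\left(\sum_{n\ge1}\frac{x_n}{n}y^n\right)=\sum_{r\ge0}S_r(x_1,x_2,\dots)y^r$. When $\frac{h_I}{c_{L,I}}-1=-p\in-\mathbb{Z}_{>0}$, $\Lambda$ is the singular vector of conformal weight $p$ in $V^{\mathcal H}(c_L,0,c_{L,I},h,h_I)$, written as $\Lambda=\sum_{i=0}^{p-1}S_i\left(\frac{I(-1)}{c_{L,I}},\dots,\frac{I(-i)}{c_{L,I}}\right)L(i-p)v_{h,h_I}+x_pv_{h,h_I}$ with $x_p$ a polynomial in $I(-1),I(-2),\dots$ of conformal weight $p$. A vector $uv_{h,h_I}$ is identified with $u\in U(\mathcal H^-)$. For $n\in\mathbb{Z}$ the linear map $\phi_n:U(\mathcal H^-)\to\mathbb{C}$ (depending on $\alpha,\beta,F$) is defined inductively by $\phi_n(1)=1$, $\phi_n(I(-i)u)=-F\phi_n(u)$, $\phi_n(L(-i)u)=(\alpha+\beta+k+i+n-i\beta)\phi_n(u)$ for $i\ge1$ and $u\in U(\mathcal H^-)$ of weight $-k$ (where $L(-j),I(-j)$ have weight $-j$). $g_p\in\mathbb{C}[x]$ is the polynomial with $g_p(F)=\phi_n(x_p)$, so that $$\phi_n(\Lambda)=(-1)^{p-1}\left(\binom{F/c_{L,I}-1}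{p-1}(\alpha+n+\beta)+(1-\beta)\binom{F/c_{L,I}-2}{p-1}\right)+g_p(F).$$
   Formalization: In (1), α_0 is defined by φ_{-1}(Λ)=0 instead of φ_0(Λ)=0, and for α=α_0+k the simple submodule is U(H).(v_{-k}⊗v); in (2), g_p(i c_{L,I})=0 is stated for i=2,…,p-1 only; in (3), g_p(c_{L,I})=β-1 is stated only in the reducible case. As printed, these claims fail. *)

theory Defs
  imports
    Complex_Main
    "HOL-Library.Poly_Mapping"
    "HOL-Computational_Algebra.Computational_Algebra"
begin

section \<open>Complex vector spaces\<close>

class scaleC =
  fixes scaleC :: "complex \<Rightarrow> 'a \<Rightarrow> 'a"  (infixr "*\<^sub>C" 75)

class complex_vector = scaleC + ab_group_add +
  assumes scaleC_add_right: "a *\<^sub>C (x + y) = a *\<^sub>C x + a *\<^sub>C y"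
    and scaleC_add_left: "(a + b) *\<^sub>C x = a *\<^sub>C x + b *\<^sub>C x"
    and scaleC_scaleC: "a *\<^sub>C (b *\<^sub>C x) = (a * b) *\<^sub>C x"
    and scaleC_one: "1 *\<^sub>C x = x"

global_interpretation cvec: vector_space "scaleC :: complex \<Rightarrow> 'a \<Rightarrow> 'a::complex_vector"
  by unfold_locales (simp_all add: scaleC_add_right scaleC_add_left scaleC_scaleC scaleC_one)

abbreviation clinear :: "('a::complex_vector \<Rightarrow> 'b::complex_vector) \<Rightarrow> bool" where
  "clinear \<equiv> Vector_Spaces.linear scaleC scaleC"

lemma clinearI:
  assumes "\<And>x y. f (x + y) = f x + f y" "\<And>c x. f (c *\<^sub>C x) = c *\<^sub>C f x"
  shows "clinear f"
  by unfold_locales (use assms in auto)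

lemma clinear_add: "clinear f \<Longrightarrow> f (x + y) = f x + f y"
  and clinear_scale: "clinear f \<Longrightarrow> f (c *\<^sub>C x) = c *\<^sub>C f x"
  and clinear_diff: "clinear f \<Longrightarrow> f (x - y) = f x - f y"
  and clinear_zero: "clinear f \<Longrightarrow> f 0 = 0"
  and clinear_sum: "clinear f \<Longrightarrow> f (sum g A) = (\<Sum>a\<in>A. f (g a))"
proof -
  assume f: "clinear f"
  interpret f: Vector_Spaces.linear scaleC scaleC f by (rule f)
  show "f (x + y) = f x + f y" "f (c *\<^sub>C x) = c *\<^sub>C f x" "f (x - y) = f x - f y" "f 0 = 0"
    "f (sum g A) = (\<Sum>a\<in>A. f (g a))"
    by (rule f.add f.scale f.diff f.zero f.sum)+
qed

lemma clinear_vanishes_on_span: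
  assumes f: "clinear f" and S: "\<And>x. x \<in> S \<Longrightarrow> f x = 0" and x: "x \<in> cvec.span S"
  shows "f x = 0"
  using x
proof (induction rule: cvec.span_induct_alt)
  case base
  then show ?case by (rule clinear_zero[OF f])
next
  case (step c x y)
  then show ?case by (simp add: clinear_add[OF f] clinear_scale[OF f] S)
qed

instantiation complex :: complex_vector
begin
definition scaleC_complex :: "complex \<Rightarrow> complex \<Rightarrow> complex" where
  "scaleC_complex c x = c * x"
instance by standard (simp_all add: scaleC_complex_def algebra_simps)
end

instantiation poly_mapping :: (type, complex_vector) complex_vector
begin
definition scaleC_poly_mapping :: "complex \<Rightarrow> ('a \<Rightarrow>\<^sub>0 'b) \<Rightarrow> 'a \<Rightarrow>\<^sub>0 'b" where
  "scaleC_poly_mapping c f = Poly_Mapping.map (scaleC c) f"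

lemma lookup_scaleC: "Poly_Mapping.lookup (c *\<^sub>C f) k = c *\<^sub>C Poly_Mapping.lookup (f :: 'a \<Rightarrow>\<^sub>0 'b) k"
  by (simp add: scaleC_poly_mapping_def map.rep_eq when_def cvec.scale_zero_right)

instance
  by standard (rule poly_mapping_eqI,
    simp add: lookup_scaleC lookup_add scaleC_add_right scaleC_add_left scaleC_scaleC scaleC_one)+
end

lemma scaleC_single: "c *\<^sub>C Poly_Mapping.single k x = Poly_Mapping.single k (c *\<^sub>C x)"
  by (rule poly_mapping_eqI) (simp add: lookup_scaleC lookup_single when_def)

text \<open>The type \<^typ>\<open>'b \<Rightarrow>\<^sub>0 complex\<close> is the complex vector space with basis \<^typ>\<open>'b\<close>
  (a basis vector being \<^term>\<open>Poly_Mapping.single b 1\<close>); \<open>lin_ext f\<close> is the linear map sending each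
  basis vector \<open>b\<close> to \<open>f b\<close>.\<close>

definition lin_ext :: "('b \<Rightarrow> 'c) \<Rightarrow> ('b \<Rightarrow>\<^sub>0 complex) \<Rightarrow> 'c::complex_vector" where
  "lin_ext f u = (\<Sum>b\<in>Poly_Mapping.keys u. Poly_Mapping.lookup u b *\<^sub>C f b)"

lemma lin_ext_superset:
  assumes "finite A" "Poly_Mapping.keys u \<subseteq> A"
  shows "lin_ext f u = (\<Sum>b\<in>A. Poly_Mapping.lookup u b *\<^sub>C f b)"
  unfolding lin_ext_def using assms
  by (intro sum.mono_neutral_left) (auto simp: in_keys_iff)

lemma lin_ext_single [simp]: "lin_ext f (Poly_Mapping.single b c) = c *\<^sub>C f b"
  by (subst lin_ext_superset[of "{b}"]) auto

lemma clinear_lin_ext: "clinear (lin_ext f)"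
proof (rule clinearI)
  fix x y :: "'a \<Rightarrow>\<^sub>0 complex"
  have "Poly_Mapping.keys (x + y) \<subseteq> Poly_Mapping.keys x \<union> Poly_Mapping.keys y" by (rule keys_add)
  then show "lin_ext f (x + y) = lin_ext f x + lin_ext f y"
    by (subst (1 2 3) lin_ext_superset[of "Poly_Mapping.keys x \<union> Poly_Mapping.keys y"])
      (auto simp: lookup_add scaleC_add_left sum.distrib)
next
  fix c and x :: "'a \<Rightarrow>\<^sub>0 complex"
  have "Poly_Mapping.keys (c *\<^sub>C x) \<subseteq> Poly_Mapping.keys x" by (auto simp: in_keys_iff lookup_scaleC)
  then show "lin_ext f (c *\<^sub>C x) = c *\<^sub>C lin_ext f x"
    by (subst (1 2) lin_ext_superset[of "Poly_Mapping.keys x"])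
      (auto simp: lookup_scaleC cvec.scale_sum_right scaleC_complex_def)
qed

lemmas lin_ext_add = clinear_add[OF clinear_lin_ext]
  and lin_ext_scale = clinear_scale[OF clinear_lin_ext]
  and lin_ext_diff = clinear_diff[OF clinear_lin_ext]
  and lin_ext_zero = clinear_zero[OF clinear_lin_ext]

lemma lin_ext_minus: "lin_ext f (- u) = - lin_ext f u"
  using lin_ext_diff[of f 0 u] by (simp add: lin_ext_zero)

lemma poly_mapping_eq_sum:
  fixes u :: "'b \<Rightarrow>\<^sub>0 complex"
  shows "u = (\<Sum>b\<in>Poly_Mapping.keys u. Poly_Mapping.lookup u b *\<^sub>C Poly_Mapping.single b 1)"
  by (rule poly_mapping_eqI)
    (auto simp: lookup_sum lookup_scaleC lookup_single when_def scaleC_complex_def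
      in_keys_iff if_distrib sum.delta cong: if_cong)

lemma clinear_eq_lin_ext:
  assumes "clinear g"
  shows "g u = lin_ext (\<lambda>b. g (Poly_Mapping.single b 1)) u"
  by (subst poly_mapping_eq_sum)
    (simp add: lin_ext_def clinear_sum[OF assms] clinear_scale[OF assms])

section \<open>Tensor products of vector spaces\<close>

definition tensor_relations :: "(('a::complex_vector \<times> 'b::complex_vector) \<Rightarrow>\<^sub>0 complex) set" where
  "tensor_relations =
    {Poly_Mapping.single (a + a', b) 1 - Poly_Mapping.single (a, b) 1 - Poly_Mapping.single (a', b) 1 | a a' b. True} \<union>
    {Poly_Mapping.single (a, b + b') 1 - Poly_Mapping.single (a, b) 1 - Poly_Mapping.single (a, b') 1 | a b b'. True} \<union>
    {Poly_Mapping.single (c *\<^sub>C a, b) 1 - c *\<^sub>C Poly_Mapping.single (a, b) 1 | a b c. True} \<union>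
    {Poly_Mapping.single (a, c *\<^sub>C b) 1 - c *\<^sub>C Poly_Mapping.single (a, b) 1 | a b c. True}"

definition tensor_eq ::
  "(('a::complex_vector \<times> 'b::complex_vector) \<Rightarrow>\<^sub>0 complex) \<Rightarrow> (('a \<times> 'b) \<Rightarrow>\<^sub>0 complex) \<Rightarrow> bool" where
  "tensor_eq x y \<longleftrightarrow> x - y \<in> cvec.span tensor_relations"

lemma equivp_tensor_eq:
  "equivp (tensor_eq :: (('a::complex_vector \<times> 'b::complex_vector) \<Rightarrow>\<^sub>0 complex) \<Rightarrow> _)"
proof (rule equivpI)
  show "reflp (tensor_eq :: (('a \<times> 'b) \<Rightarrow>\<^sub>0 complex) \<Rightarrow> _)" by (auto intro!: reflpI simp: tensor_eq_def cvec.span_zero)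
  show "symp (tensor_eq :: (('a \<times> 'b) \<Rightarrow>\<^sub>0 complex) \<Rightarrow> _)"
    by (rule sympI) (metis tensor_eq_def cvec.span_neg minus_diff_eq)
  show "transp (tensor_eq :: (('a \<times> 'b) \<Rightarrow>\<^sub>0 complex) \<Rightarrow> _)"
  proof (rule transpI)
    fix x y z :: "('a \<times> 'b) \<Rightarrow>\<^sub>0 complex"
    assume "tensor_eq x y" "tensor_eq y z"
    then have "(x - y) + (y - z) \<in> cvec.span tensor_relations"
      unfolding tensor_eq_def by (rule cvec.span_add)
    then show "tensor_eq x z" by (simp add: tensor_eq_def)
  qed
qed

quotient_type (overloaded) ('a, 'b) tensor = "('a::complex_vector \<times> 'b::complex_vector) \<Rightarrow>\<^sub>0 complex"
  / tensor_eq
  by (rule equivp_tensor_eq)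

instantiation tensor :: (complex_vector, complex_vector) complex_vector
begin

lift_definition zero_tensor :: "('a, 'b) tensor" is 0 .

lift_definition plus_tensor :: "('a, 'b) tensor \<Rightarrow> ('a, 'b) tensor \<Rightarrow> ('a, 'b) tensor" is "(+)"
  unfolding tensor_eq_def by (metis add_diff_add cvec.span_add)

lift_definition minus_tensor :: "('a, 'b) tensor \<Rightarrow> ('a, 'b) tensor \<Rightarrow> ('a, 'b) tensor" is "(-)"
  unfolding tensor_eq_def
proof -
  fix x y z w :: "('a \<times> 'b) \<Rightarrow>\<^sub>0 complex"
  assume "x - y \<in> cvec.span tensor_relations" "z - w \<in> cvec.span tensor_relations"
  then have "(x - y) - (z - w) \<in> cvec.span tensor_relations" by (rule cvec.span_diff)
  then show "x - z - (y - w) \<in> cvec.span tensor_relations" by (simp add: algebra_simps)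
qed

lift_definition uminus_tensor :: "('a, 'b) tensor \<Rightarrow> ('a, 'b) tensor" is uminus
  unfolding tensor_eq_def by (metis cvec.span_neg minus_diff_eq minus_diff_minus)

lift_definition scaleC_tensor :: "complex \<Rightarrow> ('a, 'b) tensor \<Rightarrow> ('a, 'b) tensor" is scaleC
  unfolding tensor_eq_def by (metis cvec.scale_right_diff_distrib cvec.span_scale)

instance
proof
  show "x + y + z = x + (y + z)" "x + y = y + x" "0 + x = x" "- x + x = 0" "x - y = x + - y"
    "c *\<^sub>C (x + y) = c *\<^sub>C x + c *\<^sub>C y" "(c + d) *\<^sub>C x = c *\<^sub>C x + d *\<^sub>C x"
    "c *\<^sub>C (d *\<^sub>C x) = (c * d) *\<^sub>C x" "1 *\<^sub>C x = x" for x y z :: "('a, 'b) tensor" and c d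
    by (transfer, simp add: tensor_eq_def cvec.span_zero scaleC_add_right scaleC_add_left
      scaleC_scaleC scaleC_one add_ac)+
qed

end

lift_definition tens :: "'a::complex_vector \<Rightarrow> 'b::complex_vector \<Rightarrow> ('a, 'b) tensor" (infixr "\<otimes>" 75)
  is "\<lambda>a b. Poly_Mapping.single (a, b) 1" .

definition bilinear_map :: "('a::complex_vector \<Rightarrow> 'b::complex_vector \<Rightarrow> 'c::complex_vector) \<Rightarrow> bool" where
  "bilinear_map B \<longleftrightarrow> (\<forall>a. clinear (B a)) \<and> (\<forall>b. clinear (\<lambda>a. B a b))"

lemma bilinear_map_tens: "bilinear_map (tens :: 'a::complex_vector \<Rightarrow> 'b::complex_vector \<Rightarrow> _)"
proof -
  have "(a + a') \<otimes> b = a \<otimes> b + a' \<otimes> b" for a a' :: 'a and b :: 'b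
    by transfer (unfold tensor_eq_def, rule cvec.span_base,
      unfold diff_diff_eq[symmetric] tensor_relations_def, blast)
  moreover have "a \<otimes> (b + b') = a \<otimes> b + a \<otimes> b'" for a :: 'a and b b' :: 'b
    by transfer (unfold tensor_eq_def, rule cvec.span_base,
      unfold diff_diff_eq[symmetric] tensor_relations_def, blast)
  moreover have "(c *\<^sub>C a) \<otimes> b = c *\<^sub>C (a \<otimes> b)" for c and a :: 'a and b :: 'b
    by transfer (unfold tensor_eq_def, rule cvec.span_base, unfold tensor_relations_def, blast)
  moreover have "a \<otimes> (c *\<^sub>C b) = c *\<^sub>C (a \<otimes> b)" for c and a :: 'a and b :: 'b
    by transfer (unfold tensor_eq_def, rule cvec.span_base, unfold tensor_relations_def, blast)
  ultimately show ?thesis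
    unfolding bilinear_map_def by (auto intro!: clinearI)
qed

text \<open>The linear map on the tensor product induced by a bilinear map \<open>B\<close>; the choice of
  representative is immaterial for bilinear \<open>B\<close>, as the next two lemmas show.\<close>

definition tensor_lift ::
  "('a::complex_vector \<Rightarrow> 'b::complex_vector \<Rightarrow> 'c::complex_vector) \<Rightarrow> ('a, 'b) tensor \<Rightarrow> 'c" where
  "tensor_lift B t = lin_ext (\<lambda>(a, b). B a b) (rep_tensor t)"

lemma tensor_lift_abs:
  assumes B: "bilinear_map B"
  shows "tensor_lift B (abs_tensor x) = lin_ext (\<lambda>(a, b). B a b) x"
proof -
  let ?f = "lin_ext (\<lambda>(a, b). B a b)"
  have l: "clinear ?f" by (rule clinear_lin_ext)
  have B1: "clinear (B a)" and B2: "clinear (\<lambda>a. B a b)" for a b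
    using B by (auto simp: bilinear_map_def)
  have "tensor_eq (rep_tensor (abs_tensor x)) x"
    using Quotient3_tensor equivp_tensor_eq by (metis Quotient3_abs_rep Quotient3_rel_abs tensor.abs_eq_iff)
  then have "rep_tensor (abs_tensor x) - x \<in> cvec.span tensor_relations"
    by (simp add: tensor_eq_def)
  then have "?f (rep_tensor (abs_tensor x) - x) = 0"
    by (rule clinear_vanishes_on_span[OF l, rotated])
      (auto simp: tensor_relations_def clinear_diff[OF l] clinear_scale[OF l] scaleC_one
        clinear_add[OF B1] clinear_add[OF B2] clinear_scale[OF B1] clinear_scale[OF B2])
  then show ?thesis by (simp add: tensor_lift_def clinear_diff[OF l])
qed

lemma tensor_lift:
  assumes B: "bilinear_map B"
  shows "clinear (tensor_lift B)" "tensor_lift B (a \<otimes> b) = B a b"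
proof -
  note l = clinear_lin_ext[of "\<lambda>(a, b). B a b"]
  show "clinear (tensor_lift B)"
  proof (rule clinearI)
    fix x y :: "('a, 'b) tensor" and c
    obtain x' y' where [simp]: "x = abs_tensor x'" "y = abs_tensor y'"
      by (metis Quotient3_abs_rep Quotient3_tensor)
    show "tensor_lift B (x + y) = tensor_lift B x + tensor_lift B y"
      by (simp add: plus_tensor.abs_eq tensor_lift_abs[OF B] clinear_add[OF l])
    show "tensor_lift B (c *\<^sub>C x) = c *\<^sub>C tensor_lift B x"
      by (simp add: scaleC_tensor.abs_eq tensor_lift_abs[OF B] clinear_scale[OF l])
  qed
  show "tensor_lift B (a \<otimes> b) = B a b"
    by (simp add: tens.abs_eq tensor_lift_abs[OF B] scaleC_one)
qed

section \<open>The twisted Heisenberg-Virasoro algebra and its modules\<close>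

text \<open>The basis of \<open>\<H>\<close>. The Lie algebra itself is \<open>hv \<Rightarrow>\<^sub>0 complex\<close>, and \<open>bracket\<close> gives
  the Lie bracket of two basis elements.\<close>

datatype hv = L int | I int | CL | CLI | CI

fun bracket :: "hv \<Rightarrow> hv \<Rightarrow> (hv \<Rightarrow>\<^sub>0 complex)" where
  "bracket (L n) (L m) = Poly_Mapping.single (L (n + m)) (of_int (n - m))
     + (if n = - m then Poly_Mapping.single CL (of_int (n ^ 3 - n) / 12) else 0)"
| "bracket (L n) (I m) = Poly_Mapping.single (I (n + m)) (- of_int m)
     - (if n = - m then Poly_Mapping.single CLI (of_int (n ^ 2 + n)) else 0)"
| "bracket (I m) (L n) = - (Poly_Mapping.single (I (n + m)) (- of_int m)
     - (if n = - m then Poly_Mapping.single CLI (of_int (n ^ 2 + n)) else 0))"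
| "bracket (I n) (I m) = (if n = - m then Poly_Mapping.single CI (of_int n) else 0)"
| "bracket _ _ = 0"

text \<open>A module is given by the operators \<open>\<rho> x\<close> of the basis elements \<open>x\<close>; the element \<open>a\<close> of
  \<open>\<H>\<close> acts by \<open>v \<mapsto> lin_ext (\<lambda>x. \<rho> x v) a\<close>.\<close>

definition hv_module :: "(hv \<Rightarrow> 'v \<Rightarrow> 'v::complex_vector) \<Rightarrow> bool" where
  "hv_module \<rho> \<longleftrightarrow> (\<forall>x. clinear (\<rho> x)) \<and>
     (\<forall>x y v. \<rho> x (\<rho> y v) - \<rho> y (\<rho> x v) = lin_ext (\<lambda>z. \<rho> z v) (bracket x y))"

definition submodule :: "(hv \<Rightarrow> 'v \<Rightarrow> 'v::complex_vector) \<Rightarrow> 'v set \<Rightarrow> bool" where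
  "submodule \<rho> W \<longleftrightarrow> cvec.subspace W \<and> (\<forall>x. \<forall>w\<in>W. \<rho> x w \<in> W)"

definition irreducible_module :: "(hv \<Rightarrow> 'v \<Rightarrow> 'v::complex_vector) \<Rightarrow> bool" where
  "irreducible_module \<rho> \<longleftrightarrow> hv_module \<rho> \<and> (\<exists>v::'v. v \<noteq> 0) \<and>
     (\<forall>W. submodule \<rho> W \<longrightarrow> W = {0} \<or> W = UNIV)"

definition reducible_module :: "(hv \<Rightarrow> 'v \<Rightarrow> 'v::complex_vector) \<Rightarrow> bool" where
  "reducible_module \<rho> \<longleftrightarrow> hv_module \<rho> \<and> (\<exists>W. submodule \<rho> W \<and> W \<noteq> {0} \<and> W \<noteq> UNIV)"

definition simple_submodule :: "(hv \<Rightarrow> 'v \<Rightarrow> 'v::complex_vector) \<Rightarrow> 'v set \<Rightarrow> bool" where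
  "simple_submodule \<rho> S \<longleftrightarrow> submodule \<rho> S \<and> S \<noteq> {0} \<and>
     (\<forall>W. submodule \<rho> W \<and> W \<subseteq> S \<longrightarrow> W = {0} \<or> W = S)"

definition hv_hom ::
  "(hv \<Rightarrow> 'v \<Rightarrow> 'v::complex_vector) \<Rightarrow> (hv \<Rightarrow> 'w \<Rightarrow> 'w::complex_vector) \<Rightarrow> ('v \<Rightarrow> 'w) \<Rightarrow> bool" where
  "hv_hom \<rho> \<sigma> f \<longleftrightarrow> clinear f \<and> (\<forall>x v. f (\<rho> x v) = \<sigma> x (f v))"

text \<open>\<open>\<sigma>\<close>, together with the projection \<open>q\<close>, is a realisation of the quotient of \<open>\<rho>\<close> by \<open>W\<close>.\<close>

definition quotient_module ::
  "(hv \<Rightarrow> 'v \<Rightarrow> 'v::complex_vector) \<Rightarrow> 'v set \<Rightarrow> (hv \<Rightarrow> 'w \<Rightarrow> 'w::complex_vector) \<Rightarrow> ('v \<Rightarrow> 'w) \<Rightarrow> bool" where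
  "quotient_module \<rho> W \<sigma> q \<longleftrightarrow> hv_module \<sigma> \<and> hv_hom \<rho> \<sigma> q \<and> surj q \<and> {v. q v = 0} = W"

text \<open>Elements of the tensor algebra of \<open>\<H>\<close> are linear combinations of words in the basis; they
  represent the elements of \<open>U(\<H>)\<close>. Hence \<open>U_orbit \<rho> v\<close> is \<open>U(\<H>).v\<close>.\<close>

type_synonym hv_tensor_alg = "hv list \<Rightarrow>\<^sub>0 complex"

definition T_act :: "(hv \<Rightarrow> 'v \<Rightarrow> 'v::complex_vector) \<Rightarrow> hv_tensor_alg \<Rightarrow> 'v \<Rightarrow> 'v" where
  "T_act \<rho> u v = lin_ext (\<lambda>w. foldr \<rho> w v) u"

definition U_orbit :: "(hv \<Rightarrow> 'v \<Rightarrow> 'v::complex_vector) \<Rightarrow> 'v \<Rightarrow> 'v set" where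
  "U_orbit \<rho> v = range (\<lambda>u. T_act \<rho> u v)"

definition tensor_module ::
  "(hv \<Rightarrow> 'v \<Rightarrow> 'v::complex_vector) \<Rightarrow> (hv \<Rightarrow> 'w \<Rightarrow> 'w::complex_vector) \<Rightarrow> hv \<Rightarrow> ('v, 'w) tensor \<Rightarrow> ('v, 'w) tensor" where
  "tensor_module \<rho> \<sigma> x = tensor_lift (\<lambda>v w. \<rho> x v \<otimes> w + v \<otimes> \<sigma> x w)"

lemma tensor_module_tens:
  assumes "hv_module \<rho>" "hv_module \<sigma>"
  shows "clinear (tensor_module \<rho> \<sigma> x)"
    and "tensor_module \<rho> \<sigma> x (v \<otimes> w) = \<rho> x v \<otimes> w + v \<otimes> \<sigma> x w"
proof -
  have 1: "clinear (\<rho> x)" "clinear (\<sigma> x)" using assms by (auto simp: hv_module_def)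
  have 2: "clinear (tens v)" "clinear (\<lambda>v. v \<otimes> w)" for v :: 'a and w :: 'b
    using bilinear_map_tens by (auto simp: bilinear_map_def)
  have "bilinear_map (\<lambda>v w. \<rho> x v \<otimes> w + v \<otimes> \<sigma> x w)"
    unfolding bilinear_map_def
    by (auto intro!: clinearI simp: clinear_add[OF 1(1)] clinear_add[OF 1(2)]
      clinear_scale[OF 1(1)] clinear_scale[OF 1(2)] clinear_add[OF 2(1)] clinear_add[OF 2(2)]
      clinear_scale[OF 2(1)] clinear_scale[OF 2(2)] scaleC_add_right add_ac)
  from tensor_lift[OF this] show "clinear (tensor_module \<rho> \<sigma> x)"
    "tensor_module \<rho> \<sigma> x (v \<otimes> w) = \<rho> x v \<otimes> w + v \<otimes> \<sigma> x w"
    by (simp_all add: tensor_module_def)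
qed

section \<open>The intermediate series\<close>

text \<open>\<open>V'\<^bsub>\<alpha>,\<beta>,F\<^esub>\<close>, with \<open>v\<^sub>n\<close> the basis vector \<open>n\<close> of \<^typ>\<open>int \<Rightarrow>\<^sub>0 complex\<close>.\<close>

abbreviation ivec :: "int \<Rightarrow> (int \<Rightarrow>\<^sub>0 complex)" where
  "ivec n \<equiv> Poly_Mapping.single n 1"

fun interm_basis :: "complex \<Rightarrow> complex \<Rightarrow> complex \<Rightarrow> hv \<Rightarrow> int \<Rightarrow> (int \<Rightarrow>\<^sub>0 complex)" where
  "interm_basis \<alpha> \<beta> F (L k) n = (- (of_int n + \<alpha> + \<beta> + of_int k * \<beta>)) *\<^sub>C ivec (n + k)"
| "interm_basis \<alpha> \<beta> F (I k) n = F *\<^sub>C ivec (n + k)"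
| "interm_basis \<alpha> \<beta> F _ n = 0"

definition interm_series ::
  "complex \<Rightarrow> complex \<Rightarrow> complex \<Rightarrow> hv \<Rightarrow> (int \<Rightarrow>\<^sub>0 complex) \<Rightarrow> (int \<Rightarrow>\<^sub>0 complex)" where
  "interm_series \<alpha> \<beta> F x = lin_ext (interm_basis \<alpha> \<beta> F x)"

lemma hv_module_interm_series: "hv_module (interm_series \<alpha> \<beta> F)"
proof -
  let ?\<rho> = "interm_series \<alpha> \<beta> F"
  have l: "clinear (?\<rho> x)" for x by (simp add: interm_series_def clinear_lin_ext)
  have *: "?\<rho> x (?\<rho> y (ivec k)) - ?\<rho> y (?\<rho> x (ivec k)) = lin_ext (\<lambda>z. ?\<rho> z (ivec k)) (bracket x y)" for x y k
  proof -
    have [simp]: "?\<rho> z (Poly_Mapping.single n c) = c *\<^sub>C interm_basis \<alpha> \<beta> F z n" for z n c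
      by (simp add: interm_series_def)
    show ?thesis
      by (cases x; cases y; rule poly_mapping_eqI)
        (auto simp: lin_ext_add lin_ext_diff lin_ext_zero lin_ext_minus clinear_scale[OF l]
          scaleC_single scaleC_one scaleC_complex_def lookup_single lookup_minus lookup_add when_def
          clinear_zero[OF l] algebra_simps)
  qed
  have "?\<rho> x (?\<rho> y v) - ?\<rho> y (?\<rho> x v) = lin_ext (\<lambda>z. ?\<rho> z v) (bracket x y)" for x y v
  proof -
    have c1: "clinear (\<lambda>v. ?\<rho> x (?\<rho> y v) - ?\<rho> y (?\<rho> x v))"
      by (rule clinearI) (simp_all add: clinear_add[OF l] clinear_scale[OF l] cvec.scale_right_diff_distrib)
    have c2: "clinear (\<lambda>v. lin_ext (\<lambda>z. ?\<rho> z v) (bracket x y))"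
      unfolding lin_ext_def
      by (rule clinearI) (simp_all add: clinear_add[OF l] clinear_scale[OF l] scaleC_add_right
        sum.distrib cvec.scale_sum_right mult.commute)
    show ?thesis
      by (subst clinear_eq_lin_ext[OF c1], subst clinear_eq_lin_ext[OF c2]) (simp add: *)
  qed
  with l show ?thesis by (simp add: hv_module_def)
qed

section \<open>The enveloping algebra of the negative part\<close>

primrec neg :: "hv \<Rightarrow> bool" where
  "neg (L n) \<longleftrightarrow> n < 0"
| "neg (I n) \<longleftrightarrow> n < 0"
| "neg CL \<longleftrightarrow> False"
| "neg CLI \<longleftrightarrow> False"
| "neg CI \<longleftrightarrow> False"

definition T_minus :: "hv_tensor_alg set" where
  "T_minus = {u. \<forall>w\<in>Poly_Mapping.keys u. list_all neg w}"

text \<open>The two-sided ideal of the tensor algebra of \<open>\<H>\<^sup>-\<close> generated by all \<open>xy - yx - [x, y]\<close>.\<close>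

definition U_minus_ideal :: "hv_tensor_alg set" where
  "U_minus_ideal = cvec.span
    {Poly_Mapping.single (a @ [x, y] @ b) 1 - Poly_Mapping.single (a @ [y, x] @ b) 1
       - lin_ext (\<lambda>z. Poly_Mapping.single (a @ [z] @ b) 1) (bracket x y) | a b x y.
     list_all neg a \<and> list_all neg b \<and> neg x \<and> neg y}"

definition U_minus_eq :: "hv_tensor_alg \<Rightarrow> hv_tensor_alg \<Rightarrow> bool" where
  "U_minus_eq u u' \<longleftrightarrow> u \<in> T_minus \<and> u' \<in> T_minus \<and> u - u' \<in> U_minus_ideal"

lemma U_minus_ideal_closed:
  "0 \<in> U_minus_ideal"
  "u \<in> U_minus_ideal \<Longrightarrow> - u \<in> U_minus_ideal"
  "u \<in> U_minus_ideal \<Longrightarrow> u' \<in> U_minus_ideal \<Longrightarrow> u + u' \<in> U_minus_ideal"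
  unfolding U_minus_ideal_def by (rule cvec.span_zero cvec.span_neg cvec.span_add; assumption)+

lemma part_equivp_U_minus_eq: "part_equivp U_minus_eq"
proof (rule part_equivpI)
  show "\<exists>x. U_minus_eq x x"
    by (rule exI[of _ 0]) (simp add: U_minus_eq_def T_minus_def U_minus_ideal_closed)
  show "symp U_minus_eq"
  proof (rule sympI)
    fix x y
    assume "U_minus_eq x y"
    then show "U_minus_eq y x"
      using U_minus_ideal_closed(2)[of "x - y"] by (simp add: U_minus_eq_def)
  qed
  show "transp U_minus_eq"
  proof (rule transpI)
    fix x y z
    assume "U_minus_eq x y" "U_minus_eq y z"
    then show "U_minus_eq x z"
      using U_minus_ideal_closed(3)[of "x - y" "y - z"] by (simp add: U_minus_eq_def)
  qed
qed

quotient_type U_minus = hv_tensor_alg / partial: U_minus_eq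
  by (rule part_equivp_U_minus_eq)

definition U_minus_act :: "(hv \<Rightarrow> 'v \<Rightarrow> 'v::complex_vector) \<Rightarrow> U_minus \<Rightarrow> 'v \<Rightarrow> 'v" where
  "U_minus_act \<rho> u v = T_act \<rho> (rep_U_minus u) v"

section \<open>Highest weight modules\<close>

text \<open>The parameters are ordered \<open>(c\<^sub>L, c\<^sub>I, c\<^bsub>L,I\<^esub>, h, h\<^sub>I)\<close>.\<close>

definition highest_weight_module ::
  "(hv \<Rightarrow> 'v \<Rightarrow> 'v::complex_vector) \<Rightarrow> complex \<Rightarrow> complex \<Rightarrow> complex \<Rightarrow> complex \<Rightarrow> complex \<Rightarrow> 'v \<Rightarrow> bool" where
  "highest_weight_module \<rho> cL cI cLI h hI v \<longleftrightarrow> hv_module \<rho> \<and> v \<noteq> 0 \<and>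
     (\<forall>n>0. \<rho> (L n) v = 0 \<and> \<rho> (I n) v = 0) \<and> \<rho> (L 0) v = h *\<^sub>C v \<and> \<rho> (I 0) v = hI *\<^sub>C v \<and>
     (\<forall>x. \<rho> CL x = cL *\<^sub>C x \<and> \<rho> CI x = cI *\<^sub>C x \<and> \<rho> CLI x = cLI *\<^sub>C x) \<and>
     U_orbit \<rho> v = UNIV"

text \<open>A Verma module is a highest weight module that is free of rank one over \<open>U(\<H>\<^sup>-)\<close> on its
  highest weight vector.\<close>

definition verma_module ::
  "(hv \<Rightarrow> 'v \<Rightarrow> 'v::complex_vector) \<Rightarrow> complex \<Rightarrow> complex \<Rightarrow> complex \<Rightarrow> complex \<Rightarrow> complex \<Rightarrow> 'v \<Rightarrow> bool" where
  "verma_module \<rho> cL cI cLI h hI v \<longleftrightarrow>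
     highest_weight_module \<rho> cL cI cLI h hI v \<and> bij (\<lambda>u. U_minus_act \<rho> u v)"

definition singular_vector :: "(hv \<Rightarrow> 'v \<Rightarrow> 'v::complex_vector) \<Rightarrow> 'v \<Rightarrow> bool" where
  "singular_vector \<rho> v \<longleftrightarrow> v \<noteq> 0 \<and> (\<forall>n>0. \<rho> (L n) v = 0 \<and> \<rho> (I n) v = 0) \<and>
     (\<exists>a b. \<rho> (L 0) v = a *\<^sub>C v \<and> \<rho> (I 0) v = b *\<^sub>C v)"

section \<open>Schur polynomials and the singular vector\<close>

text \<open>Polynomials in countably many variables \<open>x\<^sub>0, x\<^sub>1, x\<^sub>2, \<dots>\<close>; a monomial is the finitely supported
  map of its exponents. The variable \<open>x\<^sub>0\<close> is never used.\<close>

type_synonym ipoly = "(nat \<Rightarrow>\<^sub>0 nat) \<Rightarrow>\<^sub>0 complex"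

text \<open>\<open>S\<^sub>r\<close> is the coefficient of \<open>y\<^sup>r\<close> in \<open>exp (\<Sum>n\<ge>1. x\<^sub>n y\<^sup>n / n)\<close>, the exponential series being
  composed with the series in the exponent.\<close>

definition schur :: "nat \<Rightarrow> ipoly" where
  "schur r = fps_nth
     (fps_compose
       (Abs_fps (\<lambda>k. Poly_Mapping.single 0 (1 / fact k)))
       (Abs_fps (\<lambda>n. if n = 0 then 0
                     else Poly_Mapping.single (Poly_Mapping.single n 1) (1 / of_nat n)))) r"

definition mono_degree :: "(nat \<Rightarrow>\<^sub>0 nat) \<Rightarrow> nat" where
  "mono_degree m = (\<Sum>j\<in>Poly_Mapping.keys m. Poly_Mapping.lookup m j)"

definition mono_weight :: "(nat \<Rightarrow>\<^sub>0 nat) \<Rightarrow> nat" where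
  "mono_weight m = (\<Sum>j\<in>Poly_Mapping.keys m. j * Poly_Mapping.lookup m j)"

definition weight_poly :: "nat \<Rightarrow> ipoly \<Rightarrow> bool" where
  "weight_poly p x \<longleftrightarrow> (\<forall>m\<in>Poly_Mapping.keys x. 0 \<notin> Poly_Mapping.keys m \<and> mono_weight m = p)"

definition I_word :: "(nat \<Rightarrow>\<^sub>0 nat) \<Rightarrow> hv list" where
  "I_word m = concat (map (\<lambda>j. replicate (Poly_Mapping.lookup m j) (I (- int j))) (sorted_list_of_set (Poly_Mapping.keys m)))"

text \<open>The substitution \<open>x\<^sub>j \<mapsto> I(-j) / c\<close>. The order of the factors in \<open>I_word\<close> is immaterial, as
  the \<open>I(-j)\<close> commute in \<open>U(\<H>\<^sup>-)\<close>.\<close>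

definition I_subst :: "complex \<Rightarrow> ipoly \<Rightarrow> hv_tensor_alg" where
  "I_subst c q = lin_ext (\<lambda>m. Poly_Mapping.single (I_word m) (1 / c ^ mono_degree m)) q"

definition T_mult :: "hv_tensor_alg \<Rightarrow> hv_tensor_alg \<Rightarrow> hv_tensor_alg" where
  "T_mult u u' = lin_ext (\<lambda>a. lin_ext (\<lambda>b. Poly_Mapping.single (a @ b) 1) u') u"

definition Lambda :: "complex \<Rightarrow> nat \<Rightarrow> ipoly \<Rightarrow> U_minus" where
  "Lambda c p x = abs_U_minus
     ((\<Sum>i<p. T_mult (I_subst c (schur i)) (Poly_Mapping.single [L (int i - int p)] 1)) + I_subst 1 x)"

definition I_poly :: "ipoly \<Rightarrow> U_minus" where
  "I_poly x = abs_U_minus (I_subst 1 x)"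

section \<open>The functionals \<open>\<phi>\<^sub>n\<close>\<close>

primrec hv_weight :: "hv \<Rightarrow> int" where
  "hv_weight (L n) = n"
| "hv_weight (I n) = n"
| "hv_weight CL = 0"
| "hv_weight CLI = 0"
| "hv_weight CI = 0"

definition word_weight :: "hv list \<Rightarrow> int" where
  "word_weight w = sum_list (map hv_weight w)"

text \<open>Here \<open>j = -i\<close> and \<open>word_weight u = -k\<close> in
  \<open>\<phi>\<^sub>n(L(-i) u) = (\<alpha> + \<beta> + k + i + n - i\<beta>) \<phi>\<^sub>n(u)\<close>. The functional is characterised by
  \<open>v\<^bsub>n+k\<^esub> \<otimes> u v \<equiv> \<phi>\<^sub>n(u) v\<^sub>n \<otimes> v\<close> modulo the submodule generated by the \<open>v\<^sub>m \<otimes> v\<close> with \<open>m > n\<close>;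
  thus the vanishing of \<open>\<phi>\<^sub>n(\<Lambda>)\<close> separates \<open>v\<^sub>n \<otimes> v\<close> from the submodule generated by
  \<open>v\<^bsub>n+1\<^esub> \<otimes> v\<close>.\<close>

fun phi_word :: "complex \<Rightarrow> complex \<Rightarrow> complex \<Rightarrow> int \<Rightarrow> hv list \<Rightarrow> complex" where
  "phi_word \<alpha> \<beta> F n [] = 1"
| "phi_word \<alpha> \<beta> F n (I j # u) = - F * phi_word \<alpha> \<beta> F n u"
| "phi_word \<alpha> \<beta> F n (L j # u) =
     (\<alpha> + \<beta> - of_int (word_weight u) - of_int j + of_int n + of_int j * \<beta>) * phi_word \<alpha> \<beta> F n u"
| "phi_word \<alpha> \<beta> F n (_ # u) = 0"

lemma phi_word_prefix:
  "\<exists>c. \<forall>b. word_weight b = k \<longrightarrow> phi_word \<alpha> \<beta> F n (a @ b) = c * phi_word \<alpha> \<beta> F n b"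
proof (induction a)
  case Nil
  show ?case by (rule exI[of _ 1]) simp
next
  case (Cons x a)
  then obtain c where c: "\<forall>b. word_weight b = k \<longrightarrow> phi_word \<alpha> \<beta> F n (a @ b) = c * phi_word \<alpha> \<beta> F n b"
    by blast
  have w: "word_weight (a @ b) = word_weight a + word_weight b" for b
    by (simp add: word_weight_def)
  show ?case
  proof (cases x)
    case (L j)
    show ?thesis
      by (rule exI[of _ "(\<alpha> + \<beta> - of_int (word_weight a + k) - of_int j + of_int n + of_int j * \<beta>) * c"])
        (use c L w in auto)
  next
    case (I j)
    show ?thesis by (rule exI[of _ "- F * c"]) (use c I in auto)
  qed (auto intro: exI[of _ 0])
qed

lemma phi_ideal:
  assumes "u \<in> U_minus_ideal"
  shows "lin_ext (phi_word \<alpha> \<beta> F n) u = 0"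
proof -
  let ?p = "phi_word \<alpha> \<beta> F n" and ?f = "lin_ext (phi_word \<alpha> \<beta> F n)"
  have l: "clinear ?f" by (rule clinear_lin_ext)
  have "?f (Poly_Mapping.single (a @ [x, y] @ b) 1 - Poly_Mapping.single (a @ [y, x] @ b) 1
       - lin_ext (\<lambda>z. Poly_Mapping.single (a @ [z] @ b) 1) (bracket x y)) = 0"
    if xy: "neg x" "neg y" for a b x y
  proof -
    obtain c where c: "word_weight d = hv_weight x + hv_weight y + word_weight b \<Longrightarrow> ?p (a @ d) = c * ?p d" for d
      using phi_word_prefix[of "hv_weight x + hv_weight y + word_weight b" \<alpha> \<beta> F n a] by blast
    have c1: "?p (a @ s # t # b) = c * ?p (s # t # b)"
      if "hv_weight s + hv_weight t = hv_weight x + hv_weight y" for s t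
      using c[of "s # t # b"] that by (simp add: word_weight_def)
    have c2: "?p (a @ z # b) = c * ?p (z # b)" if "hv_weight z = hv_weight x + hv_weight y" for z
      using c[of "z # b"] that by (simp add: word_weight_def)
    have e: "?f (Poly_Mapping.single (a @ [x, y] @ b) 1 - Poly_Mapping.single (a @ [y, x] @ b) 1
        - lin_ext (\<lambda>z. Poly_Mapping.single (a @ [z] @ b) 1) (bracket x y))
      = c * ?p (x # y # b) - c * ?p (y # x # b)
        - ?f (lin_ext (\<lambda>z. Poly_Mapping.single (a @ z # b) 1) (bracket x y))"
      by (simp add: lin_ext_diff scaleC_complex_def c1[of x y] c1[of y x])
    have b: "?f (lin_ext (\<lambda>z. Poly_Mapping.single (a @ z # b) 1) (bracket x y))
      = c * lin_ext (\<lambda>z. ?p (z # b)) (bracket x y)"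
      using xy by (cases x; cases y)
        (simp_all add: lin_ext_add lin_ext_diff lin_ext_zero lin_ext_minus lin_ext_scale
          scaleC_complex_def c2)
    have "?p (x # y # b) - ?p (y # x # b) = lin_ext (\<lambda>z. ?p (z # b)) (bracket x y)"
      using xy by (cases x; cases y)
        (simp_all add: lin_ext_add lin_ext_diff lin_ext_zero lin_ext_minus lin_ext_scale
          scaleC_complex_def word_weight_def algebra_simps)
    then show ?thesis
      unfolding e b by (simp only: right_diff_distrib[symmetric] diff_self)
  qed
  then have "?f w = 0" if "w \<in> {Poly_Mapping.single (a @ [x, y] @ b) 1 - Poly_Mapping.single (a @ [y, x] @ b) 1
       - lin_ext (\<lambda>z. Poly_Mapping.single (a @ [z] @ b) 1) (bracket x y) | a b x y.
     list_all neg a \<and> list_all neg b \<and> neg x \<and> neg y}" for w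
    using that by blast
  then show ?thesis
    by (rule clinear_vanishes_on_span[OF l _ assms[unfolded U_minus_ideal_def]])
qed

definition phi :: "complex \<Rightarrow> complex \<Rightarrow> complex \<Rightarrow> int \<Rightarrow> U_minus \<Rightarrow> complex" where
  "phi \<alpha> \<beta> F n u = lin_ext (phi_word \<alpha> \<beta> F n) (rep_U_minus u)"

lemma phi_abs:
  assumes "u \<in> T_minus"
  shows "phi \<alpha> \<beta> F n (abs_U_minus u) = lin_ext (phi_word \<alpha> \<beta> F n) u"
proof -
  have "U_minus_eq u u"
    using assms by (simp add: U_minus_eq_def U_minus_ideal_closed)
  then have "U_minus_eq (rep_U_minus (abs_U_minus u)) u"
    by (rule Quotient3_rep_abs[OF Quotient3_U_minus])
  then have "lin_ext (phi_word \<alpha> \<beta> F n) (rep_U_minus (abs_U_minus u) - u) = 0"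
    by (intro phi_ideal) (simp add: U_minus_eq_def)
  then show ?thesis by (simp add: phi_def lin_ext_diff)
qed

end

theory Submission
  imports Defs
begin

text \<open>
  Let \<open>P n\<close> be the submodule of \<open>V' \<otimes> L\<close> generated by the vectors \<open>v\<^sub>m \<otimes> v\<close> with \<open>m \<ge> n\<close>. For \<open>u\<close> of
  weight \<open>-k\<close>, \<open>v\<^bsub>n+k\<^esub> \<otimes> u v\<close> is congruent to \<open>\<phi>\<^sub>n(u) (v\<^sub>n \<otimes> v)\<close> modulo \<open>P (n + 1)\<close>. As \<open>\<Lambda>\<close> vanishes in
  \<open>L\<close>, this gives \<open>v\<^sub>n \<otimes> v \<in> P (n + 1)\<close> whenever \<open>\<phi>\<^sub>n(\<Lambda>) \<noteq> 0\<close>. If \<open>\<phi>\<^sub>n(\<Lambda>) = 0\<close>, then \<open>\<phi>\<^sub>n\<close> vanishes on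
  the submodule generated by \<open>\<Lambda>\<close>, which is the whole kernel of the projection from the Verma module to
  \<open>L\<close>; so \<open>\<phi>\<^sub>n\<close> descends to \<open>L\<close> and yields a functional on \<open>V' \<otimes> L\<close> that separates \<open>v\<^sub>n \<otimes> v\<close> from
  \<open>P (n + 1)\<close>. Every nonzero submodule of \<open>V' \<otimes> L\<close> contains \<open>v\<^sub>m \<otimes> v\<close> for all large \<open>m\<close>, hence \<open>V' \<otimes> L\<close>
  is reducible iff \<open>\<phi>\<^sub>n(\<Lambda>) = 0\<close> for some \<open>n\<close>.

  Now \<open>\<phi>\<^sub>n(\<Lambda>)\<close> is affine in \<open>\<alpha> + n\<close>, and its slope vanishes iff \<open>F / c\<^bsub>L,I\<^esub> \<in> {1, \<dots>, p - 1}\<close>. In that case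
  \<open>g\<^sub>p(F)\<close> is found by evaluating \<open>L(n) \<Lambda> = 0\<close>, \<open>1 \<le> n \<le> p\<close>, under \<open>\<phi>\<close>: this is a recursion of first
  order, which can be solved in closed form.
\<close>

section \<open>Modules over the twisted Heisenberg-Virasoro algebra\<close>

text \<open>The Verma module is given only as free over U(H^-), without a PBW basis, so a vector has
  no well-defined number of factors L. All degree arguments therefore run over spans of words,
  filtered by that number. On this filtration I(M) and L(-M) pair through the scalar M c (M - p),
  which degenerates for M = p alone, and \<Lambda> = L(-p) v + ... removes exactly the factor L(-p).
  This is why \<Lambda> generates the whole kernel.

  Since \<phi>_n sends every I(-j) to -F, Schur polynomials turn into the coefficients of (1 - y)^t
  with t = F / c; all binomials of the theorem come from this series.

  The equations L(n) \<Lambda> = 0 do not close up in \<open>g\<^sub>p(F)\<close> alone. The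
  unknowns that do are the values of x_p with each monomial weighted by the sum of its parts greater
  than n: they vanish for n = p and give p times \<open>g\<^sub>p(F)\<close> for n = 0.\<close>

abbreviation "single \<equiv> Poly_Mapping.single"
abbreviation "keys \<equiv> Poly_Mapping.keys"
abbreviation "lookup \<equiv> Poly_Mapping.lookup"

lemmas subspace_closed = cvec.subspace_add cvec.subspace_diff cvec.subspace_scale cvec.subspace_sum

lemma clinear_compose: "clinear f \<Longrightarrow> clinear g \<Longrightarrow> clinear (\<lambda>x. f (g x))"
  by (rule clinearI) (simp_all add: clinear_add clinear_scale)

lemma clinear_image_span:
  assumes f: "clinear f" and U: "cvec.subspace U" and A: "\<And>a. a \<in> A \<Longrightarrow> f a \<in> U" and x: "x \<in> cvec.span A"
  shows "f x \<in> U"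
  using x
proof (induction rule: cvec.span_induct_alt)
  case base
  then show ?case by (simp add: clinear_zero[OF f] cvec.subspace_0[OF U])
next
  case (step c x y)
  then show ?case
    by (simp add: clinear_add[OF f] clinear_scale[OF f] subspace_closed[OF U] A)
qed

lemma clinear_eq_on_span:
  assumes f: "clinear f" and g: "clinear g" and eq: "\<And>a. a \<in> A \<Longrightarrow> f a = g a" and x: "x \<in> cvec.span A"
  shows "f x = g x"
  using x
  by (induction rule: cvec.span_induct_alt)
    (simp_all add: clinear_zero[OF f] clinear_zero[OF g] clinear_add[OF f] clinear_add[OF g]
      clinear_scale[OF f] clinear_scale[OF g] eq)

lemma lin_ext_in_subspace:
  assumes U: "cvec.subspace U" and f: "\<And>z. z \<in> keys u \<Longrightarrow> f z \<in> U"
  shows "lin_ext f u \<in> U"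
  unfolding lin_ext_def by (intro subspace_closed[OF U] f)

lemma lin_ext_linear_family:
  assumes "\<And>z. clinear (f z)"
  shows "clinear (\<lambda>v. lin_ext (\<lambda>z. f z v) u)"
  unfolding lin_ext_def
  by (rule clinearI)
    (simp_all add: clinear_add[OF assms] clinear_scale[OF assms] scaleC_add_right
      sum.distrib cvec.scale_sum_right mult.commute)

lemma keys_bracket:
  assumes "z \<in> keys (bracket x y)"
  shows "hv_weight z = hv_weight x + hv_weight y"
proof -
  have d: "keys (a - b) \<subseteq> keys a \<union> keys b" for a b :: "hv \<Rightarrow>\<^sub>0 complex"
    by (auto simp: in_keys_iff lookup_minus)
  have m: "keys (- a) = keys a" for a :: "hv \<Rightarrow>\<^sub>0 complex"
    by (auto simp: in_keys_iff)
  show ?thesis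
    using assms
    by (cases x; cases y)
      (auto simp: m split: if_splits dest!: subsetD[OF keys_add] subsetD[OF d])
qed

lemma word_weight_simps [simp]:
  "word_weight [] = 0" "word_weight (x # w) = hv_weight x + word_weight w"
  "word_weight (a @ b) = word_weight a + word_weight b"
  by (simp_all add: word_weight_def)

lemma neg_weight: "neg x \<Longrightarrow> hv_weight x < 0"
  by (cases x) auto

lemma neg_word_weight: "list_all neg w \<Longrightarrow> word_weight w \<le> 0"
  by (induction w) (auto dest: neg_weight)

definition neg_span :: "(hv \<Rightarrow> 'v \<Rightarrow> 'v::complex_vector) \<Rightarrow> 'v set \<Rightarrow> 'v set" where
  "neg_span \<rho> A = cvec.span {foldr \<rho> w a | w a. list_all neg w \<and> a \<in> A}"

lemma subspace_neg_span: "cvec.subspace (neg_span \<rho> A)"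
  unfolding neg_span_def by (rule cvec.subspace_span)

lemma neg_span_base: "list_all neg w \<Longrightarrow> a \<in> A \<Longrightarrow> foldr \<rho> w a \<in> neg_span \<rho> A"
  unfolding neg_span_def by (rule cvec.span_base) blast

lemma submoduleD:
  assumes "submodule \<rho> S"
  shows "cvec.subspace S" "x \<in> S \<Longrightarrow> \<rho> a x \<in> S"
  using assms by (auto simp: submodule_def)

lemma foldr_in_submodule: "submodule \<rho> S \<Longrightarrow> x \<in> S \<Longrightarrow> foldr \<rho> w x \<in> S"
  by (induction w) (auto dest: submoduleD)

lemma neg_span_least:
  assumes "submodule \<rho> S" "A \<subseteq> S"
  shows "neg_span \<rho> A \<subseteq> S"
  unfolding neg_span_def
  by (rule cvec.span_minimal) (use assms in \<open>auto intro: foldr_in_submodule submoduleD(1)\<close>)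

section \<open>Words of operators and the submodules that they generate\<close>

locale hv_mod =
  fixes \<rho> :: "hv \<Rightarrow> 'v \<Rightarrow> 'v::complex_vector"
  assumes module: "hv_module \<rho>"
begin

lemma lin: "clinear (\<rho> x)"
  using module by (simp add: hv_module_def)

lemmas add = clinear_add[OF lin]
  and scale = clinear_scale[OF lin]
  and zero [simp] = clinear_zero[OF lin]
  and diff = clinear_diff[OF lin]
  and sum = clinear_sum[OF lin]

lemma commutator: "\<rho> x (\<rho> y v) = \<rho> y (\<rho> x v) + lin_ext (\<lambda>z. \<rho> z v) (bracket x y)"
  using module unfolding hv_module_def by (metis add.commute diff_add_cancel)

lemma comm_LL:
  "\<rho> (L n) (\<rho> (L m) v) = \<rho> (L m) (\<rho> (L n) v) + of_int (n - m) *\<^sub>C \<rho> (L (n + m)) v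
     + (if n = - m then (of_int (n ^ 3 - n) / 12) *\<^sub>C \<rho> CL v else 0)"
  by (subst commutator) (simp add: lin_ext_add lin_ext_zero add.assoc)

lemma comm_LI:
  "\<rho> (L n) (\<rho> (I m) v) = \<rho> (I m) (\<rho> (L n) v) - of_int m *\<^sub>C \<rho> (I (n + m)) v
     - (if n = - m then of_int (n ^ 2 + n) *\<^sub>C \<rho> CLI v else 0)"
  by (subst commutator) (simp add: lin_ext_diff lin_ext_zero)

lemma comm_II:
  "\<rho> (I n) (\<rho> (I m) v) = \<rho> (I m) (\<rho> (I n) v) + (if n = - m then of_int n *\<^sub>C \<rho> CI v else 0)"
  by (subst commutator) (simp add: lin_ext_zero)

lemma lin_foldr: "clinear (foldr \<rho> w)"
proof (induction w)
  case Nil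
  show ?case by (rule clinearI) auto
next
  case (Cons a w)
  then show ?case by (simp add: clinear_compose[OF lin] o_def)
qed

lemma lin_T_act_left: "clinear (\<lambda>u. T_act \<rho> u v)"
  unfolding T_act_def by (rule clinear_lin_ext)

lemma T_act_single [simp]: "T_act \<rho> (single w c) v = c *\<^sub>C foldr \<rho> w v"
  by (simp add: T_act_def)

lemma U_orbit_eq_span: "U_orbit \<rho> v = cvec.span (range (\<lambda>w. foldr \<rho> w v))"
proof
  show "U_orbit \<rho> v \<subseteq> cvec.span (range (\<lambda>w. foldr \<rho> w v))"
    by (auto simp: U_orbit_def T_act_def intro!: lin_ext_in_subspace[OF cvec.subspace_span] intro: cvec.span_base)
next
  have "cvec.subspace (U_orbit \<rho> v)"
    unfolding U_orbit_def cvec.subspace_def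
  proof (intro conjI ballI allI)
    show "0 \<in> range (\<lambda>u. T_act \<rho> u v)"
      by (rule image_eqI[of _ _ 0]) (simp_all add: T_act_def lin_ext_zero)
    show "x + y \<in> range (\<lambda>u. T_act \<rho> u v)"
      if "x \<in> range (\<lambda>u. T_act \<rho> u v)" "y \<in> range (\<lambda>u. T_act \<rho> u v)" for x y
      using that by (auto simp: clinear_add[OF lin_T_act_left, symmetric])
    show "c *\<^sub>C x \<in> range (\<lambda>u. T_act \<rho> u v)"
      if "x \<in> range (\<lambda>u. T_act \<rho> u v)" for c x
      using that by (auto simp: clinear_scale[OF lin_T_act_left, symmetric])
  qed
  moreover have "range (\<lambda>w. foldr \<rho> w v) \<subseteq> U_orbit \<rho> v"
    by (auto simp: U_orbit_def scaleC_one intro!: image_eqI[of _ _ "single w 1" for w])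
  ultimately show "cvec.span (range (\<lambda>w. foldr \<rho> w v)) \<subseteq> U_orbit \<rho> v"
    by (rule cvec.span_minimal[rotated])
qed

lemma submodule_U_orbit: "submodule \<rho> (U_orbit \<rho> v)"
  unfolding submodule_def U_orbit_eq_span
proof (intro conjI allI ballI cvec.subspace_span)
  fix x w assume "w \<in> cvec.span (range (\<lambda>w. foldr \<rho> w v))"
  then show "\<rho> x w \<in> cvec.span (range (\<lambda>w. foldr \<rho> w v))"
  proof (rule clinear_image_span[OF lin cvec.subspace_span, rotated])
    fix a assume "a \<in> range (\<lambda>w. foldr \<rho> w v)"
    then obtain w' where "a = foldr \<rho> w' v" by blast
    then have "\<rho> x a = foldr \<rho> (x # w') v" by simp
    then show "\<rho> x a \<in> cvec.span (range (\<lambda>w. foldr \<rho> w v))"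
      by (metis cvec.span_base rangeI)
  qed
qed

lemma U_orbit_self: "v \<in> U_orbit \<rho> v"
  unfolding U_orbit_eq_span by (rule cvec.span_base, rule range_eqI[of _ _ "[]"]) simp

lemma U_orbit_least: "submodule \<rho> S \<Longrightarrow> v \<in> S \<Longrightarrow> U_orbit \<rho> v \<subseteq> S"
  unfolding U_orbit_eq_span
  by (rule cvec.span_minimal) (auto intro: foldr_in_submodule dest: submoduleD(1))

lemma neg_span_neg:
  assumes "neg x" "y \<in> neg_span \<rho> A"
  shows "\<rho> x y \<in> neg_span \<rho> A"
proof (rule clinear_image_span[OF lin subspace_neg_span _ assms(2)[unfolded neg_span_def]])
  fix a assume "a \<in> {foldr \<rho> w a |w a. list_all neg w \<and> a \<in> A}"
  then obtain w b where "a = foldr \<rho> w b" "list_all neg w" "b \<in> A" by blast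
  then show "\<rho> x a \<in> neg_span \<rho> A"
    using neg_span_base[of "x # w" b A \<rho>] assms(1) by simp
qed

lemma span_subset_neg_span: "cvec.span A \<subseteq> neg_span \<rho> A"
  by (rule cvec.span_minimal[OF _ subspace_neg_span]) (use neg_span_base[of "[]"] in auto)

text \<open>Only the cheap half of the PBW theorem: generators of \<open>\<H>\<^sup>-\<close> can be moved to the left.\<close>

lemma submodule_neg_span:
  assumes A: "\<And>x a. \<not> neg x \<Longrightarrow> a \<in> A \<Longrightarrow> \<rho> x a \<in> cvec.span A"
  shows "submodule \<rho> (neg_span \<rho> A)"
proof -
  have *: "\<rho> x (foldr \<rho> w a) \<in> neg_span \<rho> A" if "list_all neg w" "a \<in> A" for x w a
    using that(1)
  proof (induction w arbitrary: x)
    case Nil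
    show ?case
    proof (cases "neg x")
      case True
      then show ?thesis using neg_span_base[of "[x]" a A \<rho>] that by simp
    next
      case False
      then show ?thesis using A that span_subset_neg_span by auto
    qed
  next
    case (Cons y w)
    have "lin_ext (\<lambda>z. \<rho> z (foldr \<rho> w a)) (bracket x y) \<in> neg_span \<rho> A"
      by (rule lin_ext_in_subspace[OF subspace_neg_span]) (use Cons in auto)
    moreover have "\<rho> y (\<rho> x (foldr \<rho> w a)) \<in> neg_span \<rho> A"
      by (rule neg_span_neg) (use Cons in auto)
    ultimately show ?case
      by (simp add: commutator[of x y] cvec.subspace_add[OF subspace_neg_span])
  qed
  show ?thesis
    unfolding submodule_def
  proof (intro conjI allI ballI subspace_neg_span)
    fix x y assume y: "y \<in> neg_span \<rho> A"
    show "\<rho> x y \<in> neg_span \<rho> A"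
      by (rule clinear_image_span[OF lin subspace_neg_span _ y[unfolded neg_span_def]]) (use * in auto)
  qed
qed

lemma submodule_neg_span_singular:
  assumes "\<And>n. n > 0 \<Longrightarrow> \<rho> (L n) x = 0" "\<And>n. n > 0 \<Longrightarrow> \<rho> (I n) x = 0"
    and "\<And>y. y \<in> {L 0, I 0, CL, CLI, CI} \<Longrightarrow> \<exists>a. \<rho> y x = a *\<^sub>C x"
  shows "submodule \<rho> (neg_span \<rho> {x})"
proof (rule submodule_neg_span)
  fix y a assume y: "\<not> neg y" and a: "a \<in> {x}"
  have "\<exists>b. \<rho> y x = b *\<^sub>C x"
  proof (cases "y \<in> {L 0, I 0, CL, CLI, CI}")
    case False
    then have "\<rho> y x = 0" using y assms(1,2) by (cases y) auto
    then show ?thesis by (intro exI[of _ 0]) simp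
  qed (use assms(3) in blast)
  then show "\<rho> y a \<in> cvec.span {x}" using a by (auto simp: cvec.span_singleton)
qed

lemma L0_foldr:
  assumes "\<rho> (L 0) y = a *\<^sub>C y"
  shows "\<rho> (L 0) (foldr \<rho> w y) = (a - of_int (word_weight w)) *\<^sub>C foldr \<rho> w y"
proof (induction w)
  case Nil
  then show ?case using assms by simp
next
  case (Cons x w)
  have "lin_ext (\<lambda>z. \<rho> z u) (bracket (L 0) x) = (- of_int (hv_weight x)) *\<^sub>C \<rho> x u" for u
    by (cases x) (auto simp: lin_ext_zero)
  then have "\<rho> (L 0) (\<rho> x (foldr \<rho> w y)) = \<rho> x (\<rho> (L 0) (foldr \<rho> w y)) + (- of_int (hv_weight x)) *\<^sub>C \<rho> x (foldr \<rho> w y)"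
    using commutator[of "L 0" x "foldr \<rho> w y"] by (simp add: fun_eq_iff)
  then show ?case
    by (simp only: Cons.IH scale foldr.simps comp_def word_weight_simps of_int_add
      cvec.scale_left_distrib[symmetric] diff_add_eq[symmetric])
      (simp add: algebra_simps)
qed

end

lemma hv_homD:
  assumes "hv_hom \<rho> \<sigma> q"
  shows "clinear q" "q (\<rho> x z) = \<sigma> x (q z)"
  using assms by (auto simp: hv_hom_def)

lemma hv_hom_foldr: "hv_hom \<rho> \<sigma> q \<Longrightarrow> q (foldr \<rho> w z) = foldr \<sigma> w (q z)"
  by (induction w) (auto simp: hv_homD)

lemma (in hv_mod) submodule_kernel:
  assumes q: "hv_hom \<rho> \<sigma> q"
  shows "submodule \<rho> {z. q z = 0}"
proof -
  note l = hv_homD(1)[OF q] and hom = hv_homD(2)[OF q]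
  have "\<sigma> a 0 = 0" for a using hom[of a 0] by (simp add: clinear_zero[OF l])
  then show ?thesis
    by (auto simp: submodule_def cvec.subspace_def clinear_zero[OF l] clinear_add[OF l] clinear_scale[OF l] hom)
qed

section \<open>Highest weight modules\<close>

text \<open>\<open>C\<^sub>I\<close> acts as \<open>0\<close>, so that all the operators \<open>I(n)\<close> commute.\<close>

locale hw_mod =
  fixes \<rho> :: "hv \<Rightarrow> 'v \<Rightarrow> 'v::complex_vector" and cL c h hI :: complex and v :: 'v
  assumes hw: "highest_weight_module \<rho> cL 0 c h hI v"
begin

sublocale hv_mod \<rho>
  by unfold_locales (use hw in \<open>simp add: highest_weight_module_def\<close>)

lemma v_nonzero: "v \<noteq> 0"
  and pos_v [simp]: "n > 0 \<Longrightarrow> \<rho> (L n) v = 0" "n > 0 \<Longrightarrow> \<rho> (I n) v = 0"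
  and L0_v [simp]: "\<rho> (L 0) v = h *\<^sub>C v"
  and I0_v: "\<rho> (I 0) v = hI *\<^sub>C v"
  and central [simp]: "\<rho> CL x = cL *\<^sub>C x" "\<rho> CLI x = c *\<^sub>C x" "\<rho> CI x = 0"
  and orbit_v: "U_orbit \<rho> v = UNIV"
  using hw by (auto simp: highest_weight_module_def)

lemma neg_span_v: "neg_span \<rho> {v} = UNIV"
proof -
  have "submodule \<rho> (neg_span \<rho> {v})"
    by (rule submodule_neg_span_singular) (auto simp: I0_v intro: exI[of _ 0])
  then have "U_orbit \<rho> v \<subseteq> neg_span \<rho> {v}"
    by (rule U_orbit_least) (use neg_span_base[of "[]" v] in auto)
  then show ?thesis by (auto simp: orbit_v)
qed

text \<open>The condition is on words, not on vectors. Different words may give the same vector, so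
  membership only asserts that some representation of the required shape exists.\<close>

definition word_span :: "(hv list \<Rightarrow> bool) \<Rightarrow> 'v set" where
  "word_span \<Phi> = cvec.span {foldr \<rho> w v | w. \<Phi> w}"

lemma subspace_word_span: "cvec.subspace (word_span \<Phi>)"
  unfolding word_span_def by (rule cvec.subspace_span)

lemma word_span_base: "\<Phi> w \<Longrightarrow> foldr \<rho> w v \<in> word_span \<Phi>"
  unfolding word_span_def by (rule cvec.span_base) blast

lemma word_span_minimal:
  "cvec.subspace U \<Longrightarrow> (\<And>w. \<Phi> w \<Longrightarrow> foldr \<rho> w v \<in> U) \<Longrightarrow> word_span \<Phi> \<subseteq> U"
  unfolding word_span_def by (rule cvec.span_minimal) auto

lemma word_span_mono: "(\<And>w. \<Phi> w \<Longrightarrow> \<Psi> w) \<Longrightarrow> word_span \<Phi> \<subseteq> word_span \<Psi>"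
  by (rule word_span_minimal[OF subspace_word_span]) (rule word_span_base)

lemma word_span_image:
  "x \<in> word_span \<Phi> \<Longrightarrow> clinear f \<Longrightarrow> cvec.subspace U \<Longrightarrow> (\<And>w. \<Phi> w \<Longrightarrow> f (foldr \<rho> w v) \<in> U) \<Longrightarrow> f x \<in> U"
  unfolding word_span_def by (rule clinear_image_span) auto

lemma word_span_eq:
  "x \<in> word_span \<Phi> \<Longrightarrow> clinear f \<Longrightarrow> clinear g \<Longrightarrow> (\<And>w. \<Phi> w \<Longrightarrow> f (foldr \<rho> w v) = g (foldr \<rho> w v)) \<Longrightarrow> f x = g x"
  unfolding word_span_def by (rule clinear_eq_on_span[of f g]) auto

lemma word_span_empty: "(\<And>w. \<not> \<Phi> w) \<Longrightarrow> word_span \<Phi> = {0}"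
  by (simp add: word_span_def)

text \<open>A vector of the span uses only finitely many words, so one bound serves all of them.
  This supplies the parameters over which later inductions run.\<close>

lemma word_span_Union:
  assumes "x \<in> word_span (\<lambda>w. \<exists>i::nat. \<Phi> i w)" and mono: "\<And>i j w. i \<le> j \<Longrightarrow> \<Phi> i w \<Longrightarrow> \<Phi> j w"
  shows "\<exists>i. x \<in> word_span (\<Phi> i)"
  using assms(1) unfolding word_span_def
proof (induction rule: cvec.span_induct_alt)
  case base
  then show ?case using cvec.span_zero by blast
next
  case (step a y z)
  then obtain w i j where "y = foldr \<rho> w v" "\<Phi> i w" "z \<in> word_span (\<Phi> j)" by (auto simp: word_span_def)
  then have "y \<in> word_span (\<Phi> (max i j))" "z \<in> word_span (\<Phi> (max i j))"
    using mono[of i "max i j" w] word_span_mono[of "\<Phi> j" "\<Phi> (max i j)"] mono[of j "max i j"]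
    by (auto intro: word_span_base)
  then have "a *\<^sub>C y + z \<in> word_span (\<Phi> (max i j))"
    by (intro subspace_closed[OF subspace_word_span])
  then show ?case unfolding word_span_def ..
qed

lemma span_words: "word_span (list_all neg) = UNIV"
  using neg_span_v by (simp add: neg_span_def word_span_def)

lemma in_word_span: "x \<in> word_span (list_all neg)"
  by (simp add: span_words)

lemma comm_I: "\<rho> (I n) (\<rho> (I m) x) = \<rho> (I m) (\<rho> (I n) x)"
  by (subst comm_II) simp

text \<open>I(0) commutes with everything: in [L(n), I(0)] the factors m = 0 and, at n = 0, n^2 + n
  vanish. Hence its eigenvalue on \<open>v\<close> spreads to the whole module.\<close>

lemma I0 [simp]: "\<rho> (I 0) x = hI *\<^sub>C x"
proof -
  have "\<rho> (I 0) (\<rho> y x) = \<rho> y (\<rho> (I 0) x)" for x y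
    by (subst commutator) (cases y; auto simp: lin_ext_zero lin_ext_minus lin_ext_diff)
  then have *: "\<rho> (I 0) (foldr \<rho> w v) = foldr \<rho> w (\<rho> (I 0) v)" for w
    by (induction w) auto
  show ?thesis
    by (rule word_span_eq[OF in_word_span lin, of "\<lambda>x. hI *\<^sub>C x"])
      (auto simp: * I0_v clinear_scale[OF lin_foldr] scaleC_add_right cvec.scale_left_commute intro!: clinearI)
qed

lemma L0_word: "\<rho> (L 0) (foldr \<rho> w v) = (h - of_int (word_weight w)) *\<^sub>C foldr \<rho> w v"
  by (rule L0_foldr) simp

definition graded :: "int \<Rightarrow> 'v set" where
  "graded d = word_span (\<lambda>w. list_all neg w \<and> word_weight w = - d)"

lemma subspace_graded: "cvec.subspace (graded d)"
  unfolding graded_def by (rule subspace_word_span)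

lemma graded_base: "list_all neg w \<Longrightarrow> word_weight w = - d \<Longrightarrow> foldr \<rho> w v \<in> graded d"
  unfolding graded_def by (rule word_span_base) simp

lemma graded_negative: "d < 0 \<Longrightarrow> graded d = {0}"
  unfolding graded_def using neg_word_weight by (intro word_span_empty) fastforce

lemma graded_0: "graded 0 = cvec.span {v}"
proof -
  have "list_all neg w \<and> word_weight w = 0 \<longleftrightarrow> w = []" for w
    by (cases w) (auto dest!: neg_weight neg_word_weight)
  then show ?thesis by (simp add: graded_def word_span_def)
qed

lemma action_graded:
  assumes "x \<in> graded d"
  shows "\<rho> y x \<in> graded (d - hv_weight y)"
proof -
  have negc: "\<rho> y x \<in> graded (d - hv_weight y)" if "neg y" "x \<in> graded d" for y x d
    using that graded_base[of "y # _"]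
    by (intro word_span_image[OF that(2)[unfolded graded_def] lin subspace_graded]) simp
  have *: "\<rho> y (foldr \<rho> w v) \<in> graded (- word_weight w - hv_weight y)" if "list_all neg w" for w
    using that
  proof (induction w arbitrary: y)
    case Nil
    have v: "v \<in> graded 0" by (simp add: graded_0 cvec.span_base)
    have z: "0 \<in> graded d" for d by (rule cvec.subspace_0[OF subspace_graded])
    note s = cvec.subspace_scale[OF subspace_graded v]
    show ?case
    proof (cases "neg y")
      case True
      then show ?thesis using negc[OF True v] by simp
    next
      case False
      show ?thesis
      proof (cases y)
        case (L n)
        then show ?thesis using False s z by (cases "n = 0") auto
      next
        case (I n)
        then show ?thesis using False s z by (cases "n = 0") auto
      qed (use s z in auto)
    qed
  next
    case (Cons x w)
    have "lin_ext (\<lambda>z. \<rho> z (foldr \<rho> w v)) (bracket y x) \<in> graded (- word_weight (x # w) - hv_weight y)"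
    proof (rule lin_ext_in_subspace[OF subspace_graded])
      fix z assume "z \<in> keys (bracket y x)"
      then have "- word_weight (x # w) - hv_weight y = - word_weight w - hv_weight z"
        using keys_bracket[of z y x] by simp
      then show "\<rho> z (foldr \<rho> w v) \<in> graded (- word_weight (x # w) - hv_weight y)"
        using Cons.IH[of z] Cons.prems by (simp del: word_weight_simps)
    qed
    moreover have "\<rho> x (\<rho> y (foldr \<rho> w v)) \<in> graded (- word_weight (x # w) - hv_weight y)"
    proof -
      have "\<rho> x (\<rho> y (foldr \<rho> w v)) \<in> graded (- word_weight w - hv_weight y - hv_weight x)"
        by (rule negc) (use Cons in auto)
      also have "- word_weight w - hv_weight y - hv_weight x = - word_weight (x # w) - hv_weight y" by simp
      finally show ?thesis .
    qed
    ultimately show ?case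
      by (simp add: commutator[of y x] cvec.subspace_add[OF subspace_graded])
  qed
  show ?thesis
    using *
    by (intro word_span_image[OF assms[unfolded graded_def] lin subspace_graded]) (metis minus_minus)
qed

lemma action_graded_zero: "x \<in> graded d \<Longrightarrow> hv_weight y > d \<Longrightarrow> \<rho> y x = 0"
  using action_graded[of x d y] graded_negative[of "d - hv_weight y"] by auto

lemma L0_graded: "x \<in> graded d \<Longrightarrow> \<rho> (L 0) x = (h + of_int d) *\<^sub>C x"
  unfolding graded_def
  by (erule word_span_eq[OF _ lin, where g = "\<lambda>x. (h + of_int d) *\<^sub>C x"])
    (auto simp: L0_word scaleC_add_right cvec.scale_left_commute intro!: clinearI)

definition depth_le :: "nat \<Rightarrow> 'v set" where
  "depth_le d = cvec.span (\<Union>e\<le>d. graded (int e))"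

lemma subspace_depth_le: "cvec.subspace (depth_le d)"
  unfolding depth_le_def by (rule cvec.subspace_span)

lemma graded_depth_le: "e \<le> d \<Longrightarrow> x \<in> graded (int e) \<Longrightarrow> x \<in> depth_le d"
  unfolding depth_le_def by (rule cvec.span_base) auto

lemma depth_le_mono: "d \<le> d' \<Longrightarrow> depth_le d \<subseteq> depth_le d'"
  unfolding depth_le_def by (intro cvec.span_mono UN_mono) auto

lemma depth_le_0: "depth_le 0 = cvec.span {v}"
  by (simp add: depth_le_def graded_0 cvec.span_span)

lemma ex_depth_le: "\<exists>d. x \<in> depth_le d"
proof -
  show ?thesis
    using in_word_span[of x] unfolding word_span_def
  proof (induction rule: cvec.span_induct_alt)
    case base
    then show ?case using cvec.subspace_0[OF subspace_depth_le] by blast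
  next
    case (step a x y)
    then obtain w d where w: "x = foldr \<rho> w v" "list_all neg w" "y \<in> depth_le d" by blast
    let ?e = "nat (- word_weight w)"
    have "x \<in> depth_le (max d ?e)"
      using w neg_word_weight[of w] by (intro graded_depth_le[of ?e]) (auto intro!: graded_base)
    moreover have "y \<in> depth_le (max d ?e)" using w depth_le_mono[of d "max d ?e"] by auto
    ultimately show ?case
      by (intro exI[of _ "max d ?e"] subspace_closed[OF subspace_depth_le])
  qed
qed

text \<open>Truncated subtraction is harmless here: for \<open>d = 0\<close> the image is 0.\<close>

lemma pos_depth_le:
  assumes x: "x \<in> depth_le d" and k: "hv_weight y > 0"
  shows "\<rho> y x \<in> depth_le (d - 1)"
  and "hv_weight y > int d \<Longrightarrow> \<rho> y x = 0"
proof -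
  have 1: "\<rho> y a \<in> depth_le (d - 1)" if a: "a \<in> graded (int e)" "e \<le> d" for a e
  proof (cases "hv_weight y > int e")
    case True
    then have "\<rho> y a = 0" using action_graded_zero a by blast
    then show ?thesis using cvec.subspace_0[OF subspace_depth_le] by simp
  next
    case False
    then have "\<rho> y a \<in> graded (int (nat (int e - hv_weight y)))" using action_graded[OF a(1), of y] by simp
    then show ?thesis using k a by (intro graded_depth_le[of "nat (int e - hv_weight y)"]) auto
  qed
  show "\<rho> y x \<in> depth_le (d - 1)"
    by (rule clinear_image_span[OF lin subspace_depth_le _ x[unfolded depth_le_def]]) (use 1 in auto)
  show "\<rho> y x = 0" if "hv_weight y > int d"
    by (rule clinear_vanishes_on_span[OF lin _ x[unfolded depth_le_def]])
      (use that in \<open>auto intro: action_graded_zero\<close>)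
qed

lemma eventually_killed: "\<exists>N. \<forall>n>int N. \<rho> (L n) x = 0 \<and> \<rho> (I n) x = 0"
proof -
  obtain d where "x \<in> depth_le d" using ex_depth_le by blast
  then show ?thesis using pos_depth_le(2)[of x d] by (intro exI[of _ d]) auto
qed

text \<open>The factor L(0) - h - (d + 1) kills the top layer and acts as a scalar on every layer
  below it.\<close>

lemma depth_le_top:
  assumes "x \<in> depth_le (Suc d)"
  shows "\<rho> (L 0) x - (h + of_nat (Suc d)) *\<^sub>C x \<in> depth_le d"
proof -
  let ?f = "\<lambda>x. \<rho> (L 0) x - (h + of_nat (Suc d)) *\<^sub>C x"
  have f: "clinear ?f"
    by (rule clinearI) (simp_all add: add scale scaleC_add_right cvec.scale_left_commute
      cvec.scale_right_diff_distrib)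
  show ?thesis
  proof (rule clinear_image_span[OF f subspace_depth_le _ assms[unfolded depth_le_def]])
    fix a assume "a \<in> (\<Union>e\<le>Suc d. graded (int e))"
    then obtain e where e: "e \<le> Suc d" "a \<in> graded (int e)" by auto
    show "?f a \<in> depth_le d"
    proof (cases "e = Suc d")
      case True
      then show ?thesis using L0_graded[OF e(2)] cvec.subspace_0[OF subspace_depth_le] by simp
    next
      case False
      then have "a \<in> depth_le d" using e graded_depth_le[of e d] by auto
      moreover have "?f a = (of_nat e - of_nat (Suc d)) *\<^sub>C a"
        using L0_graded[OF e(2)] by (simp add: cvec.scale_left_diff_distrib[symmetric] algebra_simps)
      ultimately show ?thesis using cvec.subspace_scale[OF subspace_depth_le] by simp
    qed
  qed
qed

text \<open>Eigenvectors of \<open>L(0)\<close> with eigenvalues \<open>h + 1, h + 2, \<dots>\<close> do not span an eigenvector with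
  eigenvalue \<open>h\<close>: finitely many of them are killed by a product of factors \<open>L(0) - h - e\<close>.\<close>

lemma eigenvalue_h_separated:
  assumes "x \<in> cvec.span {y. \<exists>e::nat. e > 0 \<and> \<rho> (L 0) y = (h + of_nat e) *\<^sub>C y}" (is "x \<in> cvec.span ?E")
    and x: "\<rho> (L 0) x = h *\<^sub>C x"
  shows "x = 0"
proof -
  define R where "R = rec_nat id (\<lambda>d r y. \<rho> (L 0) (r y) - (h + of_nat (Suc d)) *\<^sub>C r y)"
  have R: "R 0 y = y" "R (Suc d) y = \<rho> (L 0) (R d y) - (h + of_nat (Suc d)) *\<^sub>C R d y" for d y
    by (simp_all add: R_def)
  have R_lin: "R d (y + z) = R d y + R d z" "R d (a *\<^sub>C y) = a *\<^sub>C R d y" for d y z a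
    by (induction d) (simp_all add: R add scale scaleC_add_right cvec.scale_right_diff_distrib
      cvec.scale_left_commute)
  have R_eigen: "R d y = (\<Prod>i<d. e - of_nat (Suc i)) *\<^sub>C y" if "\<rho> (L 0) y = (h + e) *\<^sub>C y" for d y e
    by (induction d) (simp_all add: R that scale scaleC_scaleC scaleC_one algebra_simps
      cvec.scale_left_diff_distrib[symmetric])
  have R_mono: "R d' y = 0" if "R d y = 0" "d \<le> d'" for d d' y
    using that(2,1) by (induction rule: dec_induct) (simp_all add: R)
  have "\<exists>d. R d x = 0"
    using assms(1)
  proof (induction rule: cvec.span_induct_alt)
    case base
    show ?case by (rule exI[of _ 0]) (simp add: R)
  next
    case (step a y z)
    then obtain e d where e: "e > 0" "\<rho> (L 0) y = (h + of_nat e) *\<^sub>C y" and d: "R d z = 0" by blast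
    have "R e y = 0"
      using R_eigen[OF e(2), of e] e(1)
      by (auto simp: prod_zero_iff intro!: bexI[of _ "e - 1"])
    then have "R (max d e) y = 0" "R (max d e) z = 0"
      using R_mono[of e y "max d e"] R_mono[OF d, of "max d e"] by auto
    then show ?case by (intro exI[of _ "max d e"]) (simp add: R_lin)
  qed
  then obtain d where "R d x = 0" ..
  then have "(\<Prod>i<d. 0 - of_nat (Suc i) :: complex) *\<^sub>C x = 0"
    using R_eigen[of x 0 d] x by simp
  moreover have "(\<Prod>i<d. 0 - of_nat (Suc i) :: complex) \<noteq> 0"
    by (simp add: prod_zero_iff del: of_nat_Suc)
  ultimately show "x = 0" using cvec.scale_eq_0_iff by metis
qed

end

section \<open>Irreducible highest weight modules\<close>

locale irred_hw_mod = hw_mod +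
  assumes irreducible: "irreducible_module \<rho>"
begin

text \<open>Words in H^- applied to \<open>x\<close> have L(0)-eigenvalues h + e with e > 0. By
  irreducibility they span the module if \<open>x\<close> is nonzero, so they would have to produce
  \<open>v\<close>, whose eigenvalue is h.\<close>

lemma no_singular_vector:
  assumes "d > 0" and x: "\<rho> (L 0) x = (h + of_nat d) *\<^sub>C x"
    and pos: "\<And>n. n > 0 \<Longrightarrow> \<rho> (L n) x = 0" "\<And>n. n > 0 \<Longrightarrow> \<rho> (I n) x = 0"
  shows "x = 0"
proof (rule ccontr)
  assume nz: "x \<noteq> 0"
  have "submodule \<rho> (neg_span \<rho> {x})"
    by (rule submodule_neg_span_singular) (use pos in \<open>auto simp: x intro: exI[of _ 0]\<close>)
  moreover have "x \<in> neg_span \<rho> {x}" using neg_span_base[of "[]" x] by auto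
  ultimately have "neg_span \<rho> {x} = UNIV"
    using irreducible nz unfolding irreducible_module_def by blast
  then have "v \<in> neg_span \<rho> {x}" by simp
  moreover have "{foldr \<rho> w a |w a. list_all neg w \<and> a \<in> {x}}
      \<subseteq> {y. \<exists>e::nat. e > 0 \<and> \<rho> (L 0) y = (h + of_nat e) *\<^sub>C y}"
  proof clarsimp
    fix w assume w: "list_all neg w"
    have "of_nat (nat (int d - word_weight w)) = (of_nat d - of_int (word_weight w) :: complex)"
      using neg_word_weight[OF w] by (simp add: of_nat_nat)
    then show "\<exists>e>0. \<rho> (L 0) (foldr \<rho> w x) = (h + of_nat e) *\<^sub>C foldr \<rho> w x"
      using L0_foldr[OF x, of w] assms(1) neg_word_weight[OF w]
      by (intro exI[of _ "nat (int d - word_weight w)"]) (simp add: algebra_simps)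
  qed
  ultimately have "v \<in> cvec.span {y. \<exists>e::nat. e > 0 \<and> \<rho> (L 0) y = (h + of_nat e) *\<^sub>C y}"
    unfolding neg_span_def using cvec.span_mono by blast
  then show False using eigenvalue_h_separated[of v] v_nonzero by simp
qed

text \<open>\<open>E\<close> is only closed under raising operators and L(0), but this suffices.
  Take a nonzero element of least depth d in \<open>E\<close>. Positive operators and L(0) - h - d
  lower the depth for d > 0, so they kill the element, and it would be singular; hence d =
  0.\<close>

lemma highest_weight_vector_in:
  assumes E: "cvec.subspace E"
    and closed: "\<And>n x. n \<ge> 0 \<Longrightarrow> x \<in> E \<Longrightarrow> \<rho> (L n) x \<in> E" "\<And>n x. n > 0 \<Longrightarrow> x \<in> E \<Longrightarrow> \<rho> (I n) x \<in> E"
    and x: "x \<in> E" "x \<noteq> 0"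
  shows "v \<in> E"
proof -
  define P where "P d \<longleftrightarrow> (\<exists>x \<in> E \<inter> depth_le d. x \<noteq> 0)" for d
  have "\<exists>d. P d" using ex_depth_le[of x] x by (auto simp: P_def)
  then obtain d where d: "P d" and least: "\<And>e. e < d \<Longrightarrow> \<not> P e"
    using LeastI_ex[of P] not_less_Least[of _ P] by metis
  from d obtain y where y: "y \<in> E" "y \<in> depth_le d" "y \<noteq> 0" by (auto simp: P_def)
  have "d = 0"
  proof (rule ccontr)
    assume "d \<noteq> 0"
    then obtain e where e: "d = Suc e" by (cases d) auto
    have null: "z = 0" if "z \<in> E" "z \<in> depth_le e" for z
      using least[of e] that by (auto simp: e P_def)
    have "\<rho> (L 0) y - (h + of_nat d) *\<^sub>C y \<in> E"
      using closed(1)[of 0 y] y subspace_closed[OF E] by auto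
    then have "\<rho> (L 0) y = (h + of_nat d) *\<^sub>C y"
      using null[OF _ depth_le_top[of y e]] y unfolding e by simp
    moreover have "\<rho> (L n) y = 0" "\<rho> (I n) y = 0" if "n > 0" for n
      using null closed that y pos_depth_le(1)[OF y(2), of "L n"] pos_depth_le(1)[OF y(2), of "I n"]
      by (auto simp: e)
    ultimately show False using no_singular_vector[of d y] y e by auto
  qed
  then obtain a where "y = a *\<^sub>C v" using y by (auto simp: depth_le_0 cvec.span_singleton)
  then have "v = (1 / a) *\<^sub>C y" using y by (auto simp: scaleC_scaleC scaleC_one)
  then show ?thesis using y cvec.subspace_scale[OF E] by blast
qed

end

lemma hw_quotient:
  assumes V: "highest_weight_module V cL cI c h hI vh" and q: "hv_hom V M q" "surj q" and "hv_module M" "q vh \<noteq> 0"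
  shows "highest_weight_module M cL cI c h hI (q vh)"
proof -
  interpret V: hv_mod V by unfold_locales (use V in \<open>simp add: highest_weight_module_def\<close>)
  interpret M: hv_mod M by unfold_locales fact
  note l = hv_homD(1)[OF q(1)] and hom = hv_homD(2)[OF q(1), symmetric]
    and fold = hv_hom_foldr[OF q(1), symmetric]
  have "U_orbit M (q vh) = UNIV"
  proof -
    have "y \<in> U_orbit M (q vh)" for y
    proof -
      obtain x where x: "y = q x" using q(2) by (metis surjD)
      have "x \<in> cvec.span (range (\<lambda>w. foldr V w vh))"
        using V V.U_orbit_eq_span[of vh] by (auto simp: highest_weight_module_def)
      then have "q x \<in> cvec.span (range (\<lambda>w. foldr M w (q vh)))"
        by (rule clinear_image_span[OF l cvec.subspace_span, rotated])
          (auto simp: fold[symmetric] intro: cvec.span_base)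
      then show ?thesis by (simp add: x M.U_orbit_eq_span)
    qed
    then show ?thesis by auto
  qed
  moreover have "M CL y = cL *\<^sub>C y" "M CI y = cI *\<^sub>C y" "M CLI y = c *\<^sub>C y" for y
    using V surjD[OF q(2), of y] by (auto simp: highest_weight_module_def hom clinear_scale[OF l])
  ultimately show ?thesis
    using assms by (auto simp: highest_weight_module_def hom clinear_scale[OF l] clinear_zero[OF l])
qed

section \<open>The tensor product with the intermediate series\<close>

lemma clinear_tens: "clinear (tens a)" "clinear (\<lambda>a. a \<otimes> b)"
  using bilinear_map_tens by (auto simp: bilinear_map_def)

lemmas tens_add_right = clinear_add[OF clinear_tens(1)]
  and tens_scale_right = clinear_scale[OF clinear_tens(1)]
  and tens_zero_right = clinear_zero[OF clinear_tens(1)]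
  and tens_sum_right = clinear_sum[OF clinear_tens(1)]
  and tens_scale_left = clinear_scale[OF clinear_tens(2)]
  and tens_zero_left = clinear_zero[OF clinear_tens(2)]
  and tens_diff_left = clinear_diff[OF clinear_tens(2)]
  and tens_diff_right = clinear_diff[OF clinear_tens(1)]

lemma tensor_span: "cvec.span (range (\<lambda>(a, b). a \<otimes> b)) = UNIV"
proof -
  have "t \<in> cvec.span (range (\<lambda>(a, b). a \<otimes> b))" for t :: "('a::complex_vector, 'b::complex_vector) tensor"
  proof -
    obtain x where x: "t = abs_tensor x"
      by (metis Quotient3_abs_rep Quotient3_tensor)
    have l: "clinear (abs_tensor :: (('a \<times> 'b) \<Rightarrow>\<^sub>0 complex) \<Rightarrow> _)"
      by (rule clinearI) (simp_all add: plus_tensor.abs_eq scaleC_tensor.abs_eq)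
    have "abs_tensor x = lin_ext (\<lambda>b. abs_tensor (single b 1)) x"
      by (rule clinear_eq_lin_ext[OF l])
    also have "\<dots> \<in> cvec.span (range (\<lambda>(a, b). a \<otimes> b))"
    proof (rule lin_ext_in_subspace[OF cvec.subspace_span cvec.span_base])
      fix p :: "'a \<times> 'b"
      show "abs_tensor (single p 1) \<in> range (\<lambda>(a, b). a \<otimes> b)"
        by (rule range_eqI[of _ _ p]) (cases p, simp add: tens.abs_eq)
    qed
    finally show ?thesis by (simp add: x)
  qed
  then show ?thesis by auto
qed

lemma tensor_span_generators:
  assumes A: "cvec.span A = UNIV" and B: "cvec.span B = UNIV"
  shows "cvec.span {a \<otimes> b | a b. a \<in> A \<and> b \<in> B} = UNIV"
proof -
  let ?S = "cvec.span {a \<otimes> b | a b. a \<in> A \<and> b \<in> B}"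
  have 1: "a \<otimes> y \<in> ?S" if "a \<in> A" for a y
    by (rule clinear_image_span[OF clinear_tens(1) cvec.subspace_span, of B])
      (use that B in \<open>auto intro: cvec.span_base\<close>)
  have "x \<otimes> y \<in> ?S" for x y
    by (rule clinear_image_span[OF clinear_tens(2) cvec.subspace_span, of A]) (use 1 A in auto)
  then have "cvec.span (range (\<lambda>(a, b). a \<otimes> b)) \<subseteq> ?S"
    by (intro cvec.span_minimal[OF _ cvec.subspace_span]) auto
  then show ?thesis using tensor_span by auto
qed

lemma ivec_span: "cvec.span (range ivec) = UNIV"
proof -
  have "x \<in> cvec.span (range ivec)" for x
    by (subst poly_mapping_eq_sum) (intro cvec.span_sum cvec.span_scale cvec.span_base rangeI)
  then show ?thesis by auto
qed

lemma hv_module_tensor: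
  assumes "hv_module \<rho>" "hv_module \<sigma>"
  shows "hv_module (tensor_module \<rho> \<sigma>)"
proof -
  interpret R: hv_mod \<rho> by unfold_locales fact
  interpret S: hv_mod \<sigma> by unfold_locales fact
  note l = tensor_module_tens(1)[OF assms] and t = tensor_module_tens(2)[OF assms]
  let ?T = "tensor_module \<rho> \<sigma>"
  have "?T x (?T y u) - ?T y (?T x u) = lin_ext (\<lambda>z. ?T z u) (bracket x y)" for x y u
  proof (rule clinear_eq_on_span[of "\<lambda>u. ?T x (?T y u) - ?T y (?T x u)" "\<lambda>u. lin_ext (\<lambda>z. ?T z u) (bracket x y)"])
    show "clinear (\<lambda>u. ?T x (?T y u) - ?T y (?T x u))"
      by (rule clinearI) (simp_all add: clinear_add[OF l] clinear_scale[OF l] cvec.scale_right_diff_distrib)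
    show "clinear (\<lambda>u. lin_ext (\<lambda>z. ?T z u) (bracket x y))"
      by (rule lin_ext_linear_family[OF l])
    show "u \<in> cvec.span (range (\<lambda>(a, b). a \<otimes> b))" by (simp add: tensor_span)
    fix u :: "('a, 'b) tensor" assume "u \<in> range (\<lambda>(a, b). a \<otimes> b)"
    then obtain a b where u: "u = a \<otimes> b" by auto
    have "?T x (?T y u) - ?T y (?T x u) = (\<rho> x (\<rho> y a) - \<rho> y (\<rho> x a)) \<otimes> b + a \<otimes> (\<sigma> x (\<sigma> y b) - \<sigma> y (\<sigma> x b))"
      by (simp add: u t clinear_add[OF l] tens_diff_left tens_diff_right)
    also have "\<dots> = lin_ext (\<lambda>z. \<rho> z a) (bracket x y) \<otimes> b + a \<otimes> lin_ext (\<lambda>z. \<sigma> z b) (bracket x y)"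
      by (simp add: R.commutator[of x y] S.commutator[of x y])
    also have "\<dots> = lin_ext (\<lambda>z. ?T z u) (bracket x y)"
      by (simp add: u t lin_ext_def scaleC_add_right sum.distrib clinear_sum[OF clinear_tens(1)]
        clinear_sum[OF clinear_tens(2)] tens_scale_left tens_scale_right)
    finally show "?T x (?T y u) - ?T y (?T x u) = lin_ext (\<lambda>z. ?T z u) (bracket x y)" .
  qed
  with l show ?thesis by (simp add: hv_module_def)
qed

lemma interm_series_ivec [simp]: "interm_series \<alpha> \<beta> F x (single n a) = a *\<^sub>C interm_basis \<alpha> \<beta> F x n"
  by (simp add: interm_series_def)

lemma lookup_interm:
  "lookup (interm_series \<alpha> \<beta> F (L k) a) m = - (of_int (m - k) + \<alpha> + \<beta> + of_int k * \<beta>) * lookup a (m - k)"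
  "lookup (interm_series \<alpha> \<beta> F (I k) a) m = F * lookup a (m - k)"
  "c \<in> {CL, CLI, CI} \<Longrightarrow> interm_series \<alpha> \<beta> F c a = 0"
proof -
  have l: "clinear (\<lambda>a. lookup (interm_series \<alpha> \<beta> F x a) m)" for x
    by (rule clinearI) (simp_all add: interm_series_def lin_ext_add lin_ext_scale lookup_add lookup_scaleC)
  have l2: "clinear (\<lambda>a. c * lookup a k)" for c :: complex and k :: int
    by (rule clinearI) (simp_all add: lookup_add lookup_scaleC scaleC_complex_def algebra_simps)
  have a: "a \<in> cvec.span (range ivec)" by (simp add: ivec_span)
  show "lookup (interm_series \<alpha> \<beta> F (L k) a) m = - (of_int (m - k) + \<alpha> + \<beta> + of_int k * \<beta>) * lookup a (m - k)"
    by (rule clinear_eq_on_span[OF l l2 _ a])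
      (auto simp: lookup_scaleC scaleC_complex_def lookup_single when_def scaleC_one)
  show "lookup (interm_series \<alpha> \<beta> F (I k) a) m = F * lookup a (m - k)"
    by (rule clinear_eq_on_span[OF l l2 _ a])
      (auto simp: lookup_scaleC scaleC_complex_def lookup_single when_def scaleC_one)
  show "interm_series \<alpha> \<beta> F c a = 0" if "c \<in> {CL, CLI, CI}"
    using that by (auto simp: interm_series_def lin_ext_def)
qed

text \<open>If m + \<alpha> = 0, then v_m spans a trivial submodule for \<beta> = 0, and for \<beta>
  = 1 no operator reaches v_(m-1), so the other v_n span a proper submodule. These are the
  parameters at which later coefficients of L(k) could vanish for infinitely many k.\<close>

lemma irreducible_interm_series:
  assumes irr: "irreducible_module (interm_series \<alpha> \<beta> 0)" and "\<beta> = 0 \<or> \<beta> = 1"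
  shows "of_int m + \<alpha> \<noteq> 0"
proof
  assume 0: "of_int m + \<alpha> = 0"
  let ?V = "interm_series \<alpha> \<beta> 0"
  have irr': "W = {0} \<or> W = UNIV" if "submodule ?V W" for W
    using irr that by (auto simp: irreducible_module_def)
  interpret V: hv_mod ?V by unfold_locales (rule hv_module_interm_series)
  show False
  proof (cases "\<beta> = 0")
    case True
    let ?W = "cvec.span {ivec m}"
    have "submodule ?V ?W"
      unfolding submodule_def
    proof (intro conjI allI ballI cvec.subspace_span)
      fix x w assume "w \<in> ?W"
      then show "?V x w \<in> ?W"
        by (rule clinear_image_span[OF V.lin cvec.subspace_span, rotated])
          (cases x; use 0 True in \<open>simp add: cvec.span_zero scaleC_one\<close>)
    qed
    from irr'[OF this] show False
    proof
      assume "?W = {0}"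
      then have "ivec m = 0" using cvec.span_base[of "ivec m" "{ivec m}"] by auto
      then show False by (metis lookup_single_eq lookup_zero zero_neq_one)
    next
      assume "?W = UNIV"
      then obtain a where "ivec (m + 1) = a *\<^sub>C ivec m"
        by (auto simp: cvec.span_singleton)
      then have "lookup (ivec (m + 1)) (m + 1) = lookup (a *\<^sub>C ivec m) (m + 1)" by simp
      then show False by (simp add: lookup_scaleC lookup_single scaleC_complex_def)
    qed
  next
    case False
    then have b: "\<beta> = 1" using assms by simp
    let ?W = "{a. lookup a (m - 1) = (0::complex)}"
    have "submodule ?V ?W"
      unfolding submodule_def
    proof (intro conjI allI ballI)
      show "cvec.subspace ?W"
        by (auto simp: cvec.subspace_def lookup_add lookup_scaleC scaleC_complex_def)
      fix x w assume "w \<in> ?W"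
      then show "?V x w \<in> ?W"
        using 0 b by (cases x) (auto simp: lookup_interm)
    qed
    from irr'[OF this] show False
    proof
      assume "?W = {0}"
      moreover have "ivec m \<in> ?W" by (simp add: lookup_single)
      ultimately have "ivec m = 0" by blast
      then show False by (metis lookup_single_eq lookup_zero zero_neq_one)
    next
      assume "?W = UNIV"
      then have "ivec (m - 1) \<in> ?W" by blast
      then show False by simp
    qed
  qed
qed

section \<open>Coordinates of the tensor product along the intermediate series\<close>

locale tensor_hw = irred_hw_mod \<sigma> cL c h hI v
  for \<sigma> :: "hv \<Rightarrow> 'l \<Rightarrow> 'l::complex_vector" and cL c h hI v +
  fixes \<alpha> \<beta> F :: complex
  assumes irreducible_interm: "irreducible_module (interm_series \<alpha> \<beta> F)"
begin

abbreviation V where "V \<equiv> interm_series \<alpha> \<beta> F"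
definition T where "T = tensor_module V \<sigma>"

sublocale T: hv_mod T
  unfolding T_def by unfold_locales (intro hv_module_tensor hv_module_interm_series module)

lemma T_tens: "T x (a \<otimes> y) = V x a \<otimes> y + a \<otimes> \<sigma> x y"
  unfolding T_def by (intro tensor_module_tens hv_module_interm_series module)

lemma T_ivec:
  "T (L k) (ivec m \<otimes> y) = (- (of_int m + \<alpha> + \<beta> + of_int k * \<beta>)) *\<^sub>C (ivec (m + k) \<otimes> y) + ivec m \<otimes> \<sigma> (L k) y"
  "T (I k) (ivec m \<otimes> y) = F *\<^sub>C (ivec (m + k) \<otimes> y) + ivec m \<otimes> \<sigma> (I k) y"
  "x \<in> {CL, CLI, CI} \<Longrightarrow> T x (ivec m \<otimes> y) = ivec m \<otimes> \<sigma> x y"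
  by (auto simp: T_tens scaleC_one tens_scale_left tens_zero_left)

lemma T_span: "cvec.span {ivec m \<otimes> foldr \<sigma> w v | m w. list_all neg w} = UNIV"
proof -
  have "{ivec m \<otimes> foldr \<sigma> w v | m w. list_all neg w}
      = {a \<otimes> b | a b. a \<in> range ivec \<and> b \<in> {foldr \<sigma> w v |w. list_all neg w}}" by blast
  then show ?thesis using tensor_span_generators[OF ivec_span span_words[unfolded word_span_def]] by simp
qed

definition coord :: "int \<Rightarrow> (int \<Rightarrow>\<^sub>0 complex, 'l) tensor \<Rightarrow> 'l" where
  "coord m = tensor_lift (\<lambda>a y. lookup a m *\<^sub>C y)"

lemma coord: "clinear (coord m)" "coord m (a \<otimes> y) = lookup a m *\<^sub>C y"
proof -
  have "bilinear_map (\<lambda>(a :: int \<Rightarrow>\<^sub>0 complex) y. lookup a m *\<^sub>C y :: 'l)"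
    unfolding bilinear_map_def
    by (auto intro!: clinearI simp: lookup_add lookup_scaleC scaleC_complex_def scaleC_add_left
      scaleC_add_right scaleC_scaleC mult.commute)
  from tensor_lift[OF this] show "clinear (coord m)" "coord m (a \<otimes> y) = lookup a m *\<^sub>C y"
    by (auto simp: coord_def)
qed

lemma coord_ivec: "coord m (ivec n \<otimes> y) = (if m = n then y else 0)"
  by (simp add: coord lookup_single when_def scaleC_one)

lemmas coord_add = clinear_add[OF coord(1)]
  and coord_scale = clinear_scale[OF coord(1)]
  and coord_diff = clinear_diff[OF coord(1)]
  and coord_zero = clinear_zero[OF coord(1)]

lemma coord_T:
  "coord m (T (L k) t) = (- (of_int (m - k) + \<alpha> + \<beta> + of_int k * \<beta>)) *\<^sub>C coord (m - k) t + \<sigma> (L k) (coord m t)"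
  "coord m (T (I k) t) = F *\<^sub>C coord (m - k) t + \<sigma> (I k) (coord m t)"
proof -
  have l: "clinear (\<lambda>t. a *\<^sub>C coord m t + \<sigma> x (coord n t))" for a m n x
    by (rule clinearI) (simp_all add: coord_add coord_scale add scale scaleC_add_right cvec.scale_left_commute)
  have l2: "clinear (\<lambda>t. coord m (T x t))" for x
    by (rule clinear_compose[OF coord(1) T.lin])
  have t: "t \<in> cvec.span (range (\<lambda>(a, b). a \<otimes> b))" by (simp add: tensor_span)
  show "coord m (T (L k) t) = (- (of_int (m - k) + \<alpha> + \<beta> + of_int k * \<beta>)) *\<^sub>C coord (m - k) t + \<sigma> (L k) (coord m t)"
    by (rule clinear_eq_on_span[OF l2 l _ t]) (auto simp: T_tens coord coord_add lookup_interm scaleC_scaleC scale)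
  show "coord m (T (I k) t) = F *\<^sub>C coord (m - k) t + \<sigma> (I k) (coord m t)"
    by (rule clinear_eq_on_span[OF l2 l _ t]) (auto simp: T_tens coord coord_add lookup_interm scaleC_scaleC scale)
qed

lemma coord_expansion:
  "\<exists>A. finite A \<and> (\<forall>B. finite B \<and> A \<subseteq> B \<longrightarrow> t = (\<Sum>m\<in>B. ivec m \<otimes> coord m t))"
proof -
  have "t \<in> cvec.span {ivec m \<otimes> foldr \<sigma> w v | m w. list_all neg w}" by (simp add: T_span)
  then show ?thesis
  proof (induction rule: cvec.span_induct_alt)
    case base
    show ?case by (rule exI[of _ "{}"]) (simp add: coord_zero tens_zero_right)
  next
    case (step a x y)
    from step(1) obtain m y' where m: "x = ivec m \<otimes> y'" by auto
    from step(2) obtain A where A: "finite A"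
      "\<And>B. finite B \<Longrightarrow> A \<subseteq> B \<Longrightarrow> y = (\<Sum>m\<in>B. ivec m \<otimes> coord m y)" by metis
    show ?case
    proof (intro exI[of _ "insert m A"] conjI allI impI)
      show "finite (insert m A)" using A by simp
      fix B assume B: "finite B \<and> insert m A \<subseteq> B"
      have "(\<Sum>k\<in>B. ivec k \<otimes> coord k (a *\<^sub>C x + y)) = (\<Sum>k\<in>B. a *\<^sub>C (ivec k \<otimes> (if k = m then y' else 0))) + (\<Sum>k\<in>B. ivec k \<otimes> coord k y)"
        by (simp add: coord_add coord_scale tens_add_right tens_scale_right m coord_ivec sum.distrib)
      also have "(\<Sum>k\<in>B. ivec k \<otimes> coord k y) = y" using A(2)[of B] B by auto
      also have "(\<Sum>k\<in>B. a *\<^sub>C (ivec k \<otimes> (if k = m then y' else 0))) = (\<Sum>k\<in>B. if k = m then a *\<^sub>C x else 0)"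
        by (intro sum.cong) (auto simp: m tens_zero_right cvec.scale_zero_right)
      also have "\<dots> = a *\<^sub>C x" using B by simp
      finally show "a *\<^sub>C x + y = (\<Sum>k\<in>B. ivec k \<otimes> coord k (a *\<^sub>C x + y))" by simp
    qed
  qed
qed

definition supp :: "(int \<Rightarrow>\<^sub>0 complex, 'l) tensor \<Rightarrow> int set" where
  "supp t = {m. coord m t \<noteq> 0}"

lemma finite_supp: "finite (supp t)"
proof -
  obtain A where A: "finite A" "t = (\<Sum>m\<in>A. ivec m \<otimes> coord m t)" using coord_expansion by (metis order_refl)
  have "coord m t = 0" if "m \<notin> A" for m
  proof -
    have "coord m t = (\<Sum>k\<in>A. coord m (ivec k \<otimes> coord k t))"
      by (subst A(2)) (rule clinear_sum[OF coord(1)])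
    then show ?thesis using that by (auto simp: coord_ivec intro: sum.neutral)
  qed
  then have "supp t \<subseteq> A" by (auto simp: supp_def)
  then show ?thesis using A(1) finite_subset by blast
qed

lemma supp_expansion: "t = (\<Sum>m\<in>supp t. ivec m \<otimes> coord m t)"
proof -
  obtain A where A: "finite A" "\<And>B. finite B \<Longrightarrow> A \<subseteq> B \<Longrightarrow> t = (\<Sum>m\<in>B. ivec m \<otimes> coord m t)"
    using coord_expansion by metis
  have "t = (\<Sum>m\<in>A \<union> supp t. ivec m \<otimes> coord m t)" using A finite_supp by auto
  also have "\<dots> = (\<Sum>m\<in>supp t. ivec m \<otimes> coord m t)"
    by (rule sum.mono_neutral_right) (use A finite_supp in \<open>auto simp: supp_def tens_zero_right\<close>)
  finally show ?thesis .
qed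

lemma supp_empty: "supp t = {} \<longleftrightarrow> t = 0"
  using supp_expansion[of t] by (auto simp: supp_def coord_zero)

lemma ivec_tens_nonzero: "(y :: 'l) \<noteq> 0 \<Longrightarrow> ivec m \<otimes> y \<noteq> 0"
  using coord_ivec[of m m y] coord_zero[of m] by auto

end

text \<open>With s = m + \<alpha> + \<beta>, the number (s + k \<beta>) (s + k + (n - k) \<beta>) is
  the coefficient of L(n - k) L(k) on v_m. Two such functions of k are proportional only if s = s'.
  The cross difference is divisible by k - l, and the quotient is linear in kl and k + l. Four
  values of k force \<beta> (1 - \<beta>) = 0 and the constant \<open>D\<close> to vanish; for
  \<beta> = 0 and \<beta> = 1 this constant factors.\<close>

lemma quadratic_not_proportional:
  fixes s s' n \<beta> :: complex and K :: nat
  assumes ratio: "\<And>k l :: nat. k \<in> {K + 1..K + 4} \<Longrightarrow> l \<in> {K + 1..K + 4} \<Longrightarrow>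
      (s + of_nat k * \<beta>) * (s + of_nat k + (n - of_nat k) * \<beta>) * ((s' + of_nat l * \<beta>) * (s' + of_nat l + (n - of_nat l) * \<beta>))
    = (s + of_nat l * \<beta>) * (s + of_nat l + (n - of_nat l) * \<beta>) * ((s' + of_nat k * \<beta>) * (s' + of_nat k + (n - of_nat k) * \<beta>))"
    and nz: "\<beta> = 0 \<Longrightarrow> s \<noteq> 0 \<and> s' \<noteq> 0" "\<beta> = 1 \<Longrightarrow> s + n \<noteq> 0 \<and> s' + n \<noteq> 0"
  shows "s = s'"
proof (rule ccontr)
  assume ne: "s \<noteq> s'"
  define A where "A = \<beta> * (1 - \<beta>)"
  define \<gamma> where "\<gamma> = s + s' + n * \<beta>"
  define D where "D = (s + \<beta>^2 * n) * (s'^2 + s' * n * \<beta>) - (s^2 + s * n * \<beta>) * (s' + \<beta>^2 * n)"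
  have e: "A * (s' - s) * of_nat k * of_nat l + A * \<gamma> * (s' - s) * (of_nat k + of_nat l) + D = 0"
    if "k \<in> {K + 1..K + 4}" "l \<in> {K + 1..K + 4}" "k \<noteq> l" for k l :: nat
  proof -
    have "(of_nat k - of_nat l) * (A * (s' - s) * of_nat k * of_nat l + A * \<gamma> * (s' - s) * (of_nat k + of_nat l) + D) =
       (s + of_nat k * \<beta>) * (s + of_nat k + (n - of_nat k) * \<beta>) * ((s' + of_nat l * \<beta>) * (s' + of_nat l + (n - of_nat l) * \<beta>))
     - (s + of_nat l * \<beta>) * (s + of_nat l + (n - of_nat l) * \<beta>) * ((s' + of_nat k * \<beta>) * (s' + of_nat k + (n - of_nat k) * \<beta>))"
      unfolding A_def \<gamma>_def D_def by algebra
    then show ?thesis using ratio[OF that(1,2)] that(3) by simp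
  qed
  \<comment> \<open>Subtracting the relations for k = K + 2 and k = K + 1 eliminates
    \<open>D\<close>; two values of \<open>l\<close> then eliminate l + \<gamma>.\<close>
  have e1: "A * (s' - s) * (of_nat l + \<gamma>) = 0" if "l \<in> {K + 3, K + 4}" for l :: nat
  proof -
    have "A * (s' - s) * (of_nat l + \<gamma>) =
      (A * (s' - s) * of_nat (K + 2) * of_nat l + A * \<gamma> * (s' - s) * (of_nat (K + 2) + of_nat l) + D)
      - (A * (s' - s) * of_nat (K + 1) * of_nat l + A * \<gamma> * (s' - s) * (of_nat (K + 1) + of_nat l) + D)"
      by (simp add: algebra_simps)
    also have "\<dots> = 0 - 0"
      by (intro arg_cong2[of _ _ _ _ "(-)"] e) (use that in auto)
    finally show ?thesis by simp
  qed
  have "A * (s' - s) = A * (s' - s) * (of_nat (K + 4) + \<gamma>) - A * (s' - s) * (of_nat (K + 3) + \<gamma>)"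
    by (simp add: algebra_simps)
  also have "\<dots> = 0" by (simp only: e1 insertI1 insert_iff simp_thms diff_self)
  finally have A: "A = 0" using ne by simp
  have D: "D = 0" using e[of "K + 1" "K + 2"] A by simp
  from A consider "\<beta> = 0" | "\<beta> = 1" by (auto simp: A_def)
  then show False
  proof cases
    case 1
    then have "s * s' * (s' - s) = 0" using D by (simp add: D_def power2_eq_square algebra_simps)
    then show False using nz(1)[OF 1] ne by simp
  next
    case 2
    have "(s + n) * (s' + n) * (s' - s) = D" unfolding D_def 2 by (simp add: algebra_simps power2_eq_square)
    then show False using nz(2)[OF 2] ne D by simp
  qed
qed

section \<open>Pure tensors and tails in a nonzero submodule\<close>

context tensor_hw
begin

text \<open>An element \<open>x\<close> of minimal support in \<open>S\<close> is a pure tensor: operators \<open>I(n)\<close>, \<open>L(n)\<close> with large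
  \<open>n\<close> only see the first factors, so if there were two indices in the support, then all products of
  such operators of a fixed degree would act on them by proportional coefficients.\<close>

lemma pure_tensor_in_submodule:
  assumes S: "submodule T S" and "S \<noteq> {0}"
  obtains m y where "y \<noteq> 0" "ivec m \<otimes> y \<in> S"
proof -
  note subS = submoduleD(1)[OF S] and actS = submoduleD(2)[OF S]
  have "0 \<in> S" by (rule cvec.subspace_0[OF subS])
  with assms(2) have "\<exists>x. x \<in> S \<and> x \<noteq> 0" by blast
  then obtain x0 where "x0 \<in> S \<and> x0 \<noteq> 0" ..
  from ex_has_least_nat[of "\<lambda>x. x \<in> S \<and> x \<noteq> 0", OF this, of "\<lambda>x. card (supp x)"]
  obtain x where x: "x \<in> S" "x \<noteq> 0" and least: "\<And>y. y \<in> S \<Longrightarrow> y \<noteq> 0 \<Longrightarrow> card (supp x) \<le> card (supp y)"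
    by auto
  have "\<exists>N. \<forall>m. \<forall>n>int N. \<sigma> (L n) (coord m x) = 0 \<and> \<sigma> (I n) (coord m x) = 0"
  proof -
    have "\<exists>f. \<forall>m. \<forall>n>int (f m). \<sigma> (L n) (coord m x) = 0 \<and> \<sigma> (I n) (coord m x) = 0"
      by (intro choice allI eventually_killed)
    then obtain f where f: "\<And>m n. n > int (f m) \<Longrightarrow> \<sigma> (L n) (coord m x) = 0 \<and> \<sigma> (I n) (coord m x) = 0"
      by blast
    show ?thesis
    proof (intro exI[of _ "Max (f ` supp x)"] allI impI)
      fix m n assume n: "n > int (Max (f ` supp x))"
      show "\<sigma> (L n) (coord m x) = 0 \<and> \<sigma> (I n) (coord m x) = 0"
      proof (cases "m \<in> supp x")
        case True
        then have "f m \<le> Max (f ` supp x)" using finite_supp by simp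
        then show ?thesis using f n by simp
      qed (simp add: supp_def)
    qed
  qed
  then obtain N where N: "\<And>m n. n > int N \<Longrightarrow> \<sigma> (L n) (coord m x) = 0"
    "\<And>m n. n > int N \<Longrightarrow> \<sigma> (I n) (coord m x) = 0" by blast
  \<comment> \<open>The element \<open>y\<close> of \<open>S\<close> has the coordinates of
    \<open>x\<close>, moved up by \<open>n\<close> and scaled by \<open>a\<close>. This is what a
    product of large operators of total degree n does to \<open>x\<close>.\<close>
  define shifted where "shifted n a y \<longleftrightarrow> y \<in> S \<and> (\<forall>m. coord m y = a (m - n) *\<^sub>C coord (m - n) x)" for n a y
  have ratio: "a m1 * b m2 = b m1 * a m2"
    if y: "shifted n a y" "shifted n b z" and m: "m1 \<in> supp x" "m2 \<in> supp x" for n a b y z m1 m2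
  proof (rule ccontr)
    assume ne: "\<not> ?thesis"
    \<comment> \<open>The combination cancels the coordinate stemming from \<open>m1\<close>, so its
      support is smaller than that of \<open>x\<close>, while the coordinate stemming from
      \<open>m2\<close> survives.\<close>
    let ?u = "a m1 *\<^sub>C z - b m1 *\<^sub>C y"
    have c: "coord k ?u = (a m1 * b (k - n) - b m1 * a (k - n)) *\<^sub>C coord (k - n) x" for k
      using y by (simp add: shifted_def coord_diff coord_scale scaleC_scaleC cvec.scale_left_diff_distrib)
    have uS: "?u \<in> S"
      using y by (intro subspace_closed[OF subS]) (auto simp: shifted_def)
    have "coord (m2 + n) ?u \<noteq> 0"
      using ne m by (simp add: c supp_def)
    then have u0: "?u \<noteq> 0" using coord_zero by metis
    have "supp ?u \<subseteq> (\<lambda>m. m + n) ` (supp x - {m1})"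
    proof
      fix k assume "k \<in> supp ?u"
      then have "k - n \<in> supp x - {m1}" by (auto simp: supp_def c)
      then show "k \<in> (\<lambda>m. m + n) ` (supp x - {m1})" by (rule rev_image_eqI) simp
    qed
    then have "card (supp ?u) \<le> card (supp x - {m1})"
      using surj_card_le finite_supp by (metis finite_Diff)
    also have "\<dots> < card (supp x)" using m finite_supp by (intro psubset_card_mono) auto
    finally show False using least[OF uS u0] by simp
  qed
  have sh_L: "coord m (T (L k) x) = (- (of_int (m - k) + \<alpha> + \<beta> + of_int k * \<beta>)) *\<^sub>C coord (m - k) x"
    if "k > int N" for m k using N that by (simp add: coord_T)
  have "\<exists>m. supp x = {m}"
  proof (rule ccontr)
    assume "\<nexists>m. supp x = {m}"
    moreover have "supp x \<noteq> {}" using x supp_empty by simp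
    ultimately obtain m1 m2 where m: "m1 \<in> supp x" "m2 \<in> supp x" "m1 \<noteq> m2" by blast
    let ?s = "\<lambda>m. of_int m + \<alpha> + \<beta>"
    show False
    proof (cases "F = 0")
      case False
      \<comment> \<open>Degree 2k is reached by I(2k) and by I(k) L(k). The first has the
        coefficient F at every index; the second is affine in the index with slope -F.\<close>
      let ?k = "int N + 1"
      have "shifted (?k + ?k) (\<lambda>m. F) (T (I (?k + ?k)) x)"
        using actS x N by (auto simp: shifted_def coord_T)
      moreover have "shifted (?k + ?k) (\<lambda>m. - F * (?s m + of_int ?k * \<beta>)) (T (I ?k) (T (L ?k) x))"
        unfolding shifted_def
      proof (intro conjI allI)
        fix m
        have "\<sigma> (I ?k) (coord m (T (L ?k) x)) = 0" by (subst sh_L) (simp_all add: scale N)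
        then have "coord m (T (I ?k) (T (L ?k) x)) = F *\<^sub>C coord (m - ?k) (T (L ?k) x)"
          by (simp only: coord_T) simp
        also have "\<dots> = (- F * (?s (m - (?k + ?k)) + of_int ?k * \<beta>)) *\<^sub>C coord (m - (?k + ?k)) x"
          by (subst sh_L) (simp_all add: scaleC_scaleC algebra_simps)
        finally show "coord m (T (I ?k) (T (L ?k) x)) = (- F * (?s (m - (?k + ?k)) + of_int ?k * \<beta>)) *\<^sub>C coord (m - (?k + ?k)) x" .
      qed (use actS x in auto)
      ultimately have "F * (- F * (?s m2 + of_int ?k * \<beta>)) = - F * (?s m1 + of_int ?k * \<beta>) * F"
        using ratio m by blast
      then have "F * F * (of_int m1 - of_int m2) = 0" by (simp add: algebra_simps)
      then show False using False m by simp
    next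
      case True
      \<comment> \<open>The total degree is so large that both k and n - k exceed N for all four
        values of k.\<close>
      let ?n = "2 * int N + 10"
      have sh: "shifted ?n (\<lambda>m. (?s m + of_nat k * \<beta>) * (?s m + of_nat k + (of_int ?n - of_nat k) * \<beta>)) (T (L (?n - int k)) (T (L (int k)) x))"
        if "k \<in> {N + 1..N + 4}" for k
        unfolding shifted_def
      proof (intro conjI allI)
        fix m
        have k: "int k > int N" "?n - int k > int N" using that by auto
        have "\<sigma> (L (?n - int k)) (coord m (T (L (int k)) x)) = 0" using k by (subst sh_L) (simp_all add: scale N)
        then have "coord m (T (L (?n - int k)) (T (L (int k)) x)) =
            (- (of_int (m - (?n - int k)) + \<alpha> + \<beta> + of_int (?n - int k) * \<beta>)) *\<^sub>C coord (m - (?n - int k)) (T (L (int k)) x)"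
          by (simp only: coord_T) simp
        also have "\<dots> = ((?s (m - ?n) + of_nat k * \<beta>) * (?s (m - ?n) + of_nat k + (of_int ?n - of_nat k) * \<beta>)) *\<^sub>C coord (m - ?n) x"
        proof -
          have e: "m - (?n - int k) - int k = m - ?n" by simp
          show ?thesis
            unfolding sh_L[OF k(1)] e scaleC_scaleC
            by (rule arg_cong[of _ _ "\<lambda>a. a *\<^sub>C coord (m - ?n) x"]) (simp add: algebra_simps)
        qed
        finally show "coord m (T (L (?n - int k)) (T (L (int k)) x)) = \<dots>" .
      qed (use actS x in auto)
      have "?s m1 = ?s m2"
      proof (rule quadratic_not_proportional[where n = "of_int ?n" and K = N and \<beta> = \<beta>])
        fix k l assume "k \<in> {N + 1..N + 4}" "l \<in> {N + 1..N + 4}"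
        from ratio[OF sh[OF this(1)] sh[OF this(2)] m(1,2)]
        show "(?s m1 + of_nat k * \<beta>) * (?s m1 + of_nat k + (of_int ?n - of_nat k) * \<beta>) * ((?s m2 + of_nat l * \<beta>) * (?s m2 + of_nat l + (of_int ?n - of_nat l) * \<beta>))
          = (?s m1 + of_nat l * \<beta>) * (?s m1 + of_nat l + (of_int ?n - of_nat l) * \<beta>) * ((?s m2 + of_nat k * \<beta>) * (?s m2 + of_nat k + (of_int ?n - of_nat k) * \<beta>))" .
      next
        assume b: "\<beta> = 0"
        show "?s m1 \<noteq> 0 \<and> ?s m2 \<noteq> 0"
          using irreducible_interm_series[OF irreducible_interm[unfolded True]] b by auto
      next
        assume b: "\<beta> = 1"
        have "?s m + of_int ?n = of_int (m + ?n + 1) + \<alpha>" for m using b by (simp add: algebra_simps)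
        then show "?s m1 + of_int ?n \<noteq> 0 \<and> ?s m2 + of_int ?n \<noteq> 0"
          using irreducible_interm_series[OF irreducible_interm[unfolded True]] b by metis
      qed
      then show False using m by simp
    qed
  qed
  then obtain m where m: "supp x = {m}" ..
  have "x = ivec m \<otimes> coord m x" using supp_expansion[of x] by (simp add: m)
  moreover have "coord m x \<noteq> 0" using m by (auto simp: supp_def)
  ultimately show ?thesis using that x by metis
qed

text \<open>Large operators move a pure tensor v_m \<otimes> y to v_k \<otimes> y for all large k.
  The vectors z with v_k \<otimes> z in \<open>S\<close> for all k \<ge> M are closed under L(n), n
  \<ge> 0, and I(n), n > 0, because these only raise k in the first factor. They therefore include
  \<open>v\<close>.\<close>

lemma tail_in_submodule:
  assumes S: "submodule T S" and "S \<noteq> {0}"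
  shows "\<exists>M. \<forall>m\<ge>M. ivec m \<otimes> v \<in> S"
proof -
  note subS = submoduleD(1)[OF S] and actS = submoduleD(2)[OF S]
  obtain m y where y: "y \<noteq> 0" "ivec m \<otimes> y \<in> S" using pure_tensor_in_submodule[OF assms] by blast
  have unscale: "u \<in> S" if "a *\<^sub>C u \<in> S" "a \<noteq> 0" for a u
    using cvec.subspace_scale[OF subS that(1), of "1 / a"] that(2) by (simp add: scaleC_scaleC scaleC_one)
  obtain N where N: "\<And>n. n > int N \<Longrightarrow> \<sigma> (L n) y = 0" "\<And>n. n > int N \<Longrightarrow> \<sigma> (I n) y = 0"
    using eventually_killed[of y] by blast
  have "\<exists>M. \<forall>k\<ge>M. ivec k \<otimes> y \<in> S"
  proof (cases "F = 0")
    case False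
    have "ivec k \<otimes> y \<in> S" if "k \<ge> m + int N + 1" for k
    proof -
      have "T (I (k - m)) (ivec m \<otimes> y) = F *\<^sub>C (ivec k \<otimes> y)"
        using that N by (simp add: T_ivec tens_zero_right)
      then show ?thesis using actS[OF y(2)] unscale False by metis
    qed
    then show ?thesis by blast
  next
    case True
    \<comment> \<open>Beyond K the summand (k - m) \<beta> dominates and the coefficient of L(k - m)
      is nonzero. For \<beta> = 0 the bound says nothing, and irreducibility of the intermediate
      series takes over.\<close>
    obtain K :: nat where K: "real K > norm (of_int m + \<alpha> + \<beta>) / norm \<beta>" using reals_Archimedean2 by blast
    have "ivec k \<otimes> y \<in> S" if k: "k \<ge> m + int N + int K + 1" for k
    proof -
      have nz: "of_int m + \<alpha> + \<beta> + of_int (k - m) * \<beta> \<noteq> 0"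
      proof (cases "\<beta> = 0")
        case b: True
        then show ?thesis using irreducible_interm_series[OF irreducible_interm[unfolded True]] by simp
      next
        case b: False
        show ?thesis
        proof
          assume "of_int m + \<alpha> + \<beta> + of_int (k - m) * \<beta> = 0"
          then have "of_int m + \<alpha> + \<beta> = - (of_int (k - m) * \<beta>)" by (simp add: add_eq_0_iff2)
          then have "norm (of_int m + \<alpha> + \<beta>) = real_of_int (k - m) * norm \<beta>"
            using k by (simp only: norm_minus_cancel norm_mult norm_of_int)
          then have "norm (of_int m + \<alpha> + \<beta>) / norm \<beta> = real_of_int (k - m)" using b by simp
          moreover have "int K < k - m" using k by simp
          then have "real K < real_of_int (k - m)" by linarith
          ultimately show False using K by simp
        qed
      qed
      have "T (L (k - m)) (ivec m \<otimes> y) = (- (of_int m + \<alpha> + \<beta> + of_int (k - m) * \<beta>)) *\<^sub>C (ivec k \<otimes> y)"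
        using k N by (simp only: T_ivec) (simp add: tens_zero_right)
      then have "(- (of_int m + \<alpha> + \<beta> + of_int (k - m) * \<beta>)) *\<^sub>C (ivec k \<otimes> y) \<in> S"
        using actS[OF y(2)] by metis
      then show ?thesis by (rule unscale) (use nz in \<open>simp only: neg_equal_0_iff_equal not_False_eq_True\<close>)
    qed
    then show ?thesis by blast
  qed
  then obtain M where M: "\<And>k. k \<ge> M \<Longrightarrow> ivec k \<otimes> y \<in> S" by blast
  define E where "E = {z. \<forall>k\<ge>M. ivec k \<otimes> z \<in> S}"
  have "v \<in> E"
  proof (rule highest_weight_vector_in[of E y])
    show "cvec.subspace E"
      unfolding cvec.subspace_def E_def
      by (auto simp: tens_zero_right tens_add_right tens_scale_right intro: cvec.subspace_0[OF subS]
        subspace_closed[OF subS])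
    fix n z
    assume z: "z \<in> E"
    show "\<sigma> (L n) z \<in> E" if n: "n \<ge> 0"
      unfolding E_def
    proof (intro CollectI allI impI)
      fix k assume k: "k \<ge> M"
      have "ivec k \<otimes> z \<in> S" "ivec (k + n) \<otimes> z \<in> S" using z k n by (auto simp: E_def)
      then have "T (L n) (ivec k \<otimes> z) - (- (of_int k + \<alpha> + \<beta> + of_int n * \<beta>)) *\<^sub>C (ivec (k + n) \<otimes> z) \<in> S"
        by (intro subspace_closed[OF subS] actS)
      then show "ivec k \<otimes> \<sigma> (L n) z \<in> S" by (simp only: T_ivec add_diff_cancel_left')
    qed
    show "\<sigma> (I n) z \<in> E" if n: "n > 0"
      unfolding E_def
    proof (intro CollectI allI impI)
      fix k assume k: "k \<ge> M"
      have "ivec k \<otimes> z \<in> S" "ivec (k + n) \<otimes> z \<in> S" using z k n by (auto simp: E_def)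
      then have "T (I n) (ivec k \<otimes> z) - F *\<^sub>C (ivec (k + n) \<otimes> z) \<in> S"
        by (intro subspace_closed[OF subS] actS)
      then show "ivec k \<otimes> \<sigma> (I n) z \<in> S" by (simp only: T_ivec add_diff_cancel_left')
    qed
  qed (use M y in \<open>auto simp: E_def\<close>)
  then show ?thesis by (auto simp: E_def)
qed

end

section \<open>The submodules generated by the tails of \<open>(v\<^sub>n \<otimes> v)\<^sub>n\<close>\<close>

context tensor_hw
begin

definition P :: "int \<Rightarrow> (int \<Rightarrow>\<^sub>0 complex, 'l) tensor set" where
  "P n = neg_span T {ivec m \<otimes> v | m. m \<ge> n}"

lemma submodule_P: "submodule T (P n)"
  unfolding P_def
proof (rule T.submodule_neg_span)
  fix x a assume x: "\<not> neg x" and "a \<in> {ivec m \<otimes> v | m. m \<ge> n}"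
  then obtain m where m: "a = ivec m \<otimes> v" "m \<ge> n" by blast
  let ?S = "cvec.span {ivec m \<otimes> v | m. m \<ge> n}"
  have b: "ivec k \<otimes> v \<in> ?S" if "k \<ge> n" for k by (rule cvec.span_base) (use that in blast)
  note i = cvec.span_add cvec.span_scale b
  show "T x a \<in> ?S"
  proof (cases x)
    case (L k)
    then have "k \<ge> 0" using x by simp
    then have "ivec m \<otimes> \<sigma> (L k) v \<in> ?S"
      using b[of m] m by (cases "k = 0") (auto simp: tens_zero_right tens_scale_right cvec.span_zero cvec.span_scale)
    then show ?thesis
      unfolding L m T_ivec by (intro i) (use \<open>k \<ge> 0\<close> m in auto)
  next
    case (I k)
    then have "k \<ge> 0" using x by simp
    then have "ivec m \<otimes> \<sigma> (I k) v \<in> ?S"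
      using b[of m] m by (cases "k = 0") (auto simp: tens_zero_right tens_scale_right cvec.span_zero cvec.span_scale)
    then show ?thesis
      unfolding I m T_ivec by (intro i) (use \<open>k \<ge> 0\<close> m in auto)
  qed (use b[of m] m in \<open>auto simp: T_ivec tens_scale_right tens_zero_right cvec.span_zero cvec.span_scale\<close>)
qed

lemma P_base: "m \<ge> n \<Longrightarrow> ivec m \<otimes> v \<in> P n"
  unfolding P_def by (rule subsetD[OF T.span_subset_neg_span], rule cvec.span_base) blast

lemma P_least: "submodule T S \<Longrightarrow> (\<And>m. m \<ge> n \<Longrightarrow> ivec m \<otimes> v \<in> S) \<Longrightarrow> P n \<subseteq> S"
  unfolding P_def by (rule neg_span_least) auto

lemmas P_subspace = submoduleD(1)[OF submodule_P]
  and P_act = submoduleD(2)[OF submodule_P]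

text \<open>By the Leibniz rule an operator of the second factor is traded for one on the first,
  plus an element of the image of the operator. Peeling off a factor from H^- only increases m +
  weight of the word, so the bound n is kept.\<close>

lemma word_in_P:
  "list_all neg w \<Longrightarrow> m + word_weight w \<ge> n \<Longrightarrow> ivec m \<otimes> foldr \<sigma> w v \<in> P n"
proof (induction w arbitrary: m)
  case Nil
  then show ?case by (simp add: P_base)
next
  case (Cons x w)
  have w: "neg x" "list_all neg w" using Cons.prems by auto
  have wt: "hv_weight x < 0" using neg_weight[OF w(1)] .
  have 1: "ivec m \<otimes> foldr \<sigma> w v \<in> P n" "ivec (m + hv_weight x) \<otimes> foldr \<sigma> w v \<in> P n"
    using Cons w wt by auto
  show ?case
  proof (cases x)
    case (L j)
    have "T (L j) (ivec m \<otimes> foldr \<sigma> w v) - (- (of_int m + \<alpha> + \<beta> + of_int j * \<beta>)) *\<^sub>C (ivec (m + j) \<otimes> foldr \<sigma> w v) \<in> P n"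
      by (intro subspace_closed[OF P_subspace] P_act) (use 1 L in auto)
    then show ?thesis by (simp only: T_ivec add_diff_cancel_left') (simp add: L)
  next
    case (I j)
    have "T (I j) (ivec m \<otimes> foldr \<sigma> w v) - F *\<^sub>C (ivec (m + j) \<otimes> foldr \<sigma> w v) \<in> P n"
      by (intro subspace_closed[OF P_subspace] P_act) (use 1 I in auto)
    then show ?thesis by (simp only: T_ivec add_diff_cancel_left') (simp add: I)
  qed (use w in auto)
qed

lemma submodule_eq_UNIV:
  assumes S: "submodule T S" and all: "\<And>m. ivec m \<otimes> v \<in> S"
  shows "S = UNIV"
proof -
  have "P n \<subseteq> S" for n by (rule P_least[OF S all])
  then have "ivec m \<otimes> foldr \<sigma> w v \<in> S" if "list_all neg w" for m w
    using word_in_P[OF that order_refl] by blast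
  then have "cvec.span {ivec m \<otimes> foldr \<sigma> w v | m w. list_all neg w} \<subseteq> S"
    by (intro cvec.span_minimal submoduleD(1)[OF S]) auto
  then show ?thesis by (auto simp: T_span)
qed

text \<open>This is where the recursion for \<phi>_n comes from. For m = n - weight(x w), the vector
  v_m \<otimes> w v has total index above n and lies in \<open>P (n + 1)\<close>. So does its image
  under x, whence v_m \<otimes> x w v is congruent to minus (x v_m) \<otimes> w v.\<close>

lemma phi_congruence:
  "list_all neg w \<Longrightarrow> ivec (n - word_weight w) \<otimes> foldr \<sigma> w v - phi_word \<alpha> \<beta> F n w *\<^sub>C (ivec n \<otimes> v) \<in> P (n + 1)"
proof (induction w)
  case Nil
  then show ?case by (simp add: scaleC_one cvec.subspace_0[OF P_subspace])
next
  case (Cons x w)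
  have w: "neg x" "list_all neg w" using Cons.prems by auto
  let ?m = "n - word_weight (x # w)" and ?y = "foldr \<sigma> w v"
  note IH = Cons.IH[OF w(2)]
  have 1: "ivec ?m \<otimes> ?y \<in> P (n + 1)"
    by (rule word_in_P) (use w neg_weight[OF w(1)] in auto)
  have e: "?m + hv_weight x = n - word_weight w" by simp
  show ?case
  proof (cases x)
    case (L j)
    let ?a = "of_int ?m + \<alpha> + \<beta> + of_int j * \<beta>"
    have a: "?a * phi_word \<alpha> \<beta> F n w = phi_word \<alpha> \<beta> F n (x # w)"
      by (simp add: L algebra_simps)
    have "T (L j) (ivec ?m \<otimes> ?y) + ?a *\<^sub>C (ivec (n - word_weight w) \<otimes> ?y - phi_word \<alpha> \<beta> F n w *\<^sub>C (ivec n \<otimes> v)) \<in> P (n + 1)"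
      by (intro cvec.subspace_add[OF P_subspace] cvec.subspace_scale[OF P_subspace] P_act 1 IH)
    moreover have "T (L j) (ivec ?m \<otimes> ?y) = ivec ?m \<otimes> \<sigma> (L j) ?y - ?a *\<^sub>C (ivec (n - word_weight w) \<otimes> ?y)"
      unfolding T_ivec cvec.scale_minus_left using e by (simp add: L)
    ultimately show ?thesis
      unfolding cvec.scale_right_diff_distrib scaleC_scaleC a by (simp add: L)
  next
    case (I j)
    have "T (I j) (ivec ?m \<otimes> ?y) - F *\<^sub>C (ivec (n - word_weight w) \<otimes> ?y - phi_word \<alpha> \<beta> F n w *\<^sub>C (ivec n \<otimes> v)) \<in> P (n + 1)"
      by (intro cvec.subspace_diff[OF P_subspace] cvec.subspace_scale[OF P_subspace] P_act 1 IH)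
    moreover have "T (I j) (ivec ?m \<otimes> ?y) = ivec ?m \<otimes> \<sigma> (I j) ?y + F *\<^sub>C (ivec (n - word_weight w) \<otimes> ?y)"
      unfolding T_ivec using e by (simp add: I)
    ultimately show ?thesis
      unfolding cvec.scale_right_diff_distrib scaleC_scaleC by (simp add: I cvec.scale_minus_left)
  qed (use w in auto)
qed

lemma in_next_P:
  assumes u: "\<And>w. w \<in> keys u \<Longrightarrow> list_all neg w \<and> word_weight w = - d"
    and 0: "T_act \<sigma> u v = 0" and nz: "lin_ext (phi_word \<alpha> \<beta> F n) u \<noteq> 0"
  shows "ivec n \<otimes> v \<in> P (n + 1)"
proof -
  let ?l = "lookup u" and ?K = "keys u"
  have "(\<Sum>w\<in>?K. ?l w *\<^sub>C (ivec (n + d) \<otimes> foldr \<sigma> w v - phi_word \<alpha> \<beta> F n w *\<^sub>C (ivec n \<otimes> v))) \<in> P (n + 1)"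
  proof (intro cvec.subspace_sum[OF P_subspace] cvec.subspace_scale[OF P_subspace])
    fix w assume "w \<in> ?K"
    then show "ivec (n + d) \<otimes> foldr \<sigma> w v - phi_word \<alpha> \<beta> F n w *\<^sub>C (ivec n \<otimes> v) \<in> P (n + 1)"
      using phi_congruence[of w n] u[of w] by simp
  qed
  also have "(\<Sum>w\<in>?K. ?l w *\<^sub>C (ivec (n + d) \<otimes> foldr \<sigma> w v - phi_word \<alpha> \<beta> F n w *\<^sub>C (ivec n \<otimes> v)))
     = ivec (n + d) \<otimes> T_act \<sigma> u v - lin_ext (phi_word \<alpha> \<beta> F n) u *\<^sub>C (ivec n \<otimes> v)"
    by (simp add: T_act_def lin_ext_def tens_sum_right tens_scale_right cvec.scale_right_diff_distrib
      sum_subtractf scaleC_scaleC cvec.scale_sum_left scaleC_complex_def)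
  finally have "lin_ext (phi_word \<alpha> \<beta> F n) u *\<^sub>C (ivec n \<otimes> v) \<in> P (n + 1)"
    using cvec.subspace_neg[OF P_subspace] by (fastforce simp: 0 tens_zero_right)
  from cvec.subspace_scale[OF P_subspace this, of "1 / lin_ext (phi_word \<alpha> \<beta> F n) u"]
  show ?thesis using nz by (simp add: scaleC_scaleC scaleC_one)
qed

text \<open>The functional that is \<open>v\<^bsub>n+d\<^esub> \<otimes> y \<mapsto> f d y\<close> is annihilated by \<open>\<H>\<^sup>-\<close>.\<close>

lemma not_in_next_P:
  assumes f: "\<And>d. clinear (f d :: 'l \<Rightarrow> complex)"
    and fw: "\<And>d w. list_all neg w \<Longrightarrow> f d (foldr \<sigma> w v) = (if word_weight w = - d then phi_word \<alpha> \<beta> F n w else 0)"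
  shows "ivec n \<otimes> v \<notin> P (n + 1)"
proof -
  define \<Phi> where "\<Phi> = tensor_lift (\<lambda>a y. lin_ext (\<lambda>m. f (m - n) y) a)"
  have "bilinear_map (\<lambda>a y. lin_ext (\<lambda>m. f (m - n) y) a)"
    unfolding bilinear_map_def by (intro conjI allI clinear_lin_ext lin_ext_linear_family f)
  from tensor_lift[OF this] have l: "clinear \<Phi>" and t: "\<And>a y. \<Phi> (a \<otimes> y) = lin_ext (\<lambda>m. f (m - n) y) a"
    by (auto simp: \<Phi>_def)
  have t': "\<Phi> (ivec m \<otimes> y) = f (m - n) y" for m y by (simp add: t scaleC_one)
  have kill: "\<Phi> (T x u) = 0" if x: "neg x" for x u
  proof (rule clinear_vanishes_on_span[OF clinear_compose[OF l T.lin]])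
    show "u \<in> cvec.span {ivec m \<otimes> foldr \<sigma> w v | m w. list_all neg w}" by (simp add: T_span)
    fix u assume "u \<in> {ivec m \<otimes> foldr \<sigma> w v | m w. list_all neg w}"
    then obtain m w where u: "u = ivec m \<otimes> foldr \<sigma> w v" and w: "list_all neg w" by blast
    show "\<Phi> (T x u) = 0"
    proof (cases x)
      case (L j)
      have "\<Phi> (T x u) = - (of_int m + \<alpha> + \<beta> + of_int j * \<beta>) * f (m + j - n) (foldr \<sigma> w v) + f (m - n) (foldr \<sigma> (x # w) v)"
        unfolding u L T_ivec by (simp add: clinear_add[OF l] clinear_scale[OF l] t' scaleC_complex_def)
      also have "\<dots> = 0"
        using fw[OF w, of "m + j - n"] fw[of "x # w" "m - n"] w x by (auto simp: L algebra_simps)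
      finally show ?thesis .
    next
      case (I j)
      have "\<Phi> (T x u) = F * f (m + j - n) (foldr \<sigma> w v) + f (m - n) (foldr \<sigma> (x # w) v)"
        unfolding u I T_ivec by (simp add: clinear_add[OF l] clinear_scale[OF l] t' scaleC_complex_def)
      also have "\<dots> = 0"
        using fw[OF w, of "m + j - n"] fw[of "x # w" "m - n"] w x by (auto simp: I algebra_simps)
      finally show ?thesis .
    qed (use x in auto)
  qed
  have f0: "f d v = (if d = 0 then 1 else 0)" for d using fw[of "[]" d] by simp
  have "\<Phi> u = 0" if "u \<in> P (n + 1)" for u
  proof (rule clinear_vanishes_on_span[OF l _ that[unfolded P_def neg_span_def]])
    fix u assume "u \<in> {foldr T w a |w a. list_all neg w \<and> a \<in> {ivec m \<otimes> v |m. n + 1 \<le> m}}"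
    then obtain w m where u: "u = foldr T w (ivec m \<otimes> v)" "list_all neg w" "m \<ge> n + 1" by blast
    show "\<Phi> u = 0" using u by (cases w) (auto simp: kill t' f0)
  qed
  moreover have "\<Phi> (ivec n \<otimes> v) \<noteq> 0" by (simp add: t' f0)
  ultimately show ?thesis by blast
qed

lemma reducible_if:
  assumes "ivec n \<otimes> v \<notin> P (n + 1)"
  shows "reducible_module T"
  unfolding reducible_module_def
proof (intro conjI T.module exI[of _ "P (n + 1)"] submodule_P)
  show "P (n + 1) \<noteq> {0}" using P_base[of "n + 1" "n + 1"] ivec_tens_nonzero[OF v_nonzero, of "n + 1"] by auto
qed (use assms in auto)

text \<open>Descending induction from \<open>M\<close>: once all larger indices are in
  \<open>S\<close>, so is \<open>P (m + 1)\<close>, and with it v_m \<otimes> v.\<close>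

lemma downward:
  assumes S: "submodule T S" and tail: "\<And>m. m \<ge> M \<Longrightarrow> ivec m \<otimes> v \<in> S"
    and step: "\<And>m. n \<le> m \<Longrightarrow> m < M \<Longrightarrow> ivec m \<otimes> v \<in> P (m + 1)" and "m \<ge> n"
  shows "ivec m \<otimes> v \<in> S"
proof -
  have "\<forall>m\<ge>n. m \<ge> M - int j \<longrightarrow> ivec m \<otimes> v \<in> S" for j
  proof (induction j)
    case 0
    then show ?case using tail by simp
  next
    case (Suc j)
    show ?case
    proof (intro allI impI)
      fix m assume m: "n \<le> m" "M - int (Suc j) \<le> m"
      show "ivec m \<otimes> v \<in> S"
      proof (cases "m < M")
        case True
        have "P (m + 1) \<subseteq> S" by (rule P_least[OF S]) (use Suc m in auto)
        then show ?thesis using step m True by blast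
      qed (use tail in simp)
    qed
  qed
  from this[of "nat (M - m)"] show ?thesis using \<open>m \<ge> n\<close> by auto
qed

lemma reducible_iff: "reducible_module T \<longleftrightarrow> (\<exists>n. ivec n \<otimes> v \<notin> P (n + 1))"
proof
  assume "reducible_module T"
  then obtain S where S: "submodule T S" "S \<noteq> {0}" "S \<noteq> UNIV" by (auto simp: reducible_module_def)
  show "\<exists>n. ivec n \<otimes> v \<notin> P (n + 1)"
  proof (rule ccontr)
    assume "\<nexists>n. ivec n \<otimes> v \<notin> P (n + 1)"
    then have "ivec m \<otimes> v \<in> S" for m
      using tail_in_submodule[OF S(1,2)] downward[OF S(1), of _ m m] by blast
    then show False using submodule_eq_UNIV[OF S(1)] S(3) by blast
  qed
qed (use reducible_if in blast)

lemma P_minimal: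
  assumes step: "\<And>m. m \<ge> n \<Longrightarrow> ivec m \<otimes> v \<in> P (m + 1)" and S: "submodule T S" "S \<noteq> {0}"
  shows "P n \<subseteq> S"
  using tail_in_submodule[OF S] downward[OF S(1) _ step] by (intro P_least[OF S(1)]) blast

lemma U_orbit_eq_P:
  assumes step: "\<And>m. m \<ge> n \<Longrightarrow> ivec m \<otimes> v \<in> P (m + 1)"
  shows "U_orbit T (ivec n \<otimes> v) = P n"
proof
  show "U_orbit T (ivec n \<otimes> v) \<subseteq> P n"
    by (rule T.U_orbit_least[OF submodule_P]) (simp add: P_base)
  show "P n \<subseteq> U_orbit T (ivec n \<otimes> v)"
    by (rule P_minimal[OF step T.submodule_U_orbit])
      (use T.U_orbit_self[of "ivec n \<otimes> v"] ivec_tens_nonzero[OF v_nonzero, of n] in auto)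
qed

lemma simple_submodule_P:
  assumes step: "\<And>m. m \<ge> n \<Longrightarrow> ivec m \<otimes> v \<in> P (m + 1)"
  shows "simple_submodule T (P n)" "simple_submodule T S \<Longrightarrow> S = P n"
proof -
  have nz: "P n \<noteq> {0}" using P_base[of n n] ivec_tens_nonzero[OF v_nonzero, of n] by auto
  then show "simple_submodule T (P n)"
    using P_minimal[OF step] submodule_P by (auto simp: simple_submodule_def)
  assume S: "simple_submodule T S"
  then have "P n \<subseteq> S" using P_minimal[OF step] by (auto simp: simple_submodule_def)
  then show "S = P n" using S submodule_P nz unfolding simple_submodule_def by metis
qed

text \<open>Below the single obstruction n every v_m \<otimes> v is generated from above, so v_n
  \<otimes> v generates the quotient. Positive operators send v_n \<otimes> v to multiples of
  v_(n+k) \<otimes> v, which vanish there.\<close>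

lemma highest_weight_quotient:
  assumes notin: "ivec n \<otimes> v \<notin> P (n + 1)" and step: "\<And>m. m \<noteq> n \<Longrightarrow> ivec m \<otimes> v \<in> P (m + 1)"
    and Q: "quotient_module T (P (n + 1)) Q q"
  shows "highest_weight_module Q cL 0 c (- (of_int n + \<alpha> + \<beta>) + h) (F + hI) (q (ivec n \<otimes> v))"
proof -
  have ker: "q u = 0 \<longleftrightarrow> u \<in> P (n + 1)" for u
    using Q by (auto simp: quotient_module_def)
  have lq: "clinear q" and hom: "\<And>x u. Q x (q u) = q (T x u)" and surjq: "surj q" and modQ: "hv_module Q"
    using Q by (auto simp: quotient_module_def hv_hom_def)
  interpret Q: hv_mod Q by unfold_locales (rule modQ)
  let ?u = "ivec n \<otimes> v"
  have up: "ivec (n + k) \<otimes> v \<in> P (n + 1)" if "k > 0" for k using that by (intro P_base) simp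
  have "U_orbit Q (q ?u) = UNIV"
  proof -
    let ?S = "{u. q u \<in> U_orbit Q (q ?u)}"
    note sub = Q.submodule_U_orbit[of "q ?u"]
    have S: "submodule T ?S"
      unfolding submodule_def cvec.subspace_def
      by (auto simp: clinear_zero[OF lq] clinear_add[OF lq] clinear_scale[OF lq] hom[symmetric]
        intro: cvec.subspace_0[OF submoduleD(1)[OF sub]] subspace_closed[OF submoduleD(1)[OF sub]] submoduleD(2)[OF sub])
    have "q u \<in> U_orbit Q (q ?u)" if "u \<in> P (n + 1)" for u
      using ker[THEN iffD2, OF that] cvec.subspace_0[OF submoduleD(1)[OF sub]] by simp
    then have "P (n + 1) \<subseteq> ?S" by blast
    then have upper: "ivec m \<otimes> v \<in> ?S" if "m \<ge> n" for m
      using that P_base[of "n + 1" m] Q.U_orbit_self[of "q ?u"] by (cases "m = n") auto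
    have "ivec m \<otimes> v \<in> ?S" for m
      by (rule downward[OF S upper, where n = "min m n"]) (use step in auto)
    then have all: "?S = UNIV" by (intro submodule_eq_UNIV[OF S])
    have "y \<in> U_orbit Q (q ?u)" for y
    proof -
      obtain u where "y = q u" using surjq by (metis surjD)
      moreover have "u \<in> ?S" unfolding all by simp
      ultimately show ?thesis by simp
    qed
    then show ?thesis by auto
  qed
  moreover have "Q CL y = cL *\<^sub>C y" "Q CI y = 0" "Q CLI y = c *\<^sub>C y" for y
  proof -
    obtain u where u: "y = q u" using surjq by (metis surjD)
    have ms: "u \<in> cvec.span {ivec m \<otimes> foldr \<sigma> w v | m w. list_all neg w}" by (simp add: T_span)
    have scal: "clinear (\<lambda>u. a *\<^sub>C u :: (int \<Rightarrow>\<^sub>0 complex, 'l) tensor)" for a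
      by (rule clinearI) (simp_all add: scaleC_add_right cvec.scale_left_commute)
    have "T CL u = cL *\<^sub>C u" by (rule clinear_eq_on_span[OF T.lin scal _ ms]) (auto simp: T_ivec tens_scale_right)
    moreover have "T CLI u = c *\<^sub>C u" by (rule clinear_eq_on_span[OF T.lin scal _ ms]) (auto simp: T_ivec tens_scale_right)
    moreover have "T CI u = 0 *\<^sub>C u" by (rule clinear_eq_on_span[OF T.lin scal _ ms]) (auto simp: T_ivec tens_zero_right)
    ultimately show "Q CL y = cL *\<^sub>C y" "Q CI y = 0" "Q CLI y = c *\<^sub>C y"
      by (simp_all add: u hom clinear_scale[OF lq] clinear_zero[OF lq])
  qed
  moreover have "Q (L k) (q ?u) = 0 \<and> Q (I k) (q ?u) = 0" if "k > 0" for k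
    using up[OF that] that
    by (auto simp: hom ker T_ivec tens_zero_right intro!: cvec.subspace_scale[OF P_subspace]
      simp del: cvec.scale_minus_left minus_add_distrib)
  moreover have "Q (L 0) (q ?u) = (- (of_int n + \<alpha> + \<beta>) + h) *\<^sub>C q ?u"
    unfolding hom T_ivec clinear_scale[OF lq, symmetric]
    by (rule arg_cong[of _ _ q])
      (simp only: L0_v tens_scale_right scaleC_add_left add_0_right of_int_0 mult_zero_left)
  moreover have "Q (I 0) (q ?u) = (F + hI) *\<^sub>C q ?u"
    unfolding hom T_ivec by (simp add: clinear_add[OF lq] clinear_scale[OF lq] tens_scale_right scaleC_add_left)
  ultimately show ?thesis
    using modQ ker notin by (auto simp: highest_weight_module_def)
qed

end

section \<open>The maximal submodule of the Verma module\<close>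

primrec L_count :: "hv \<Rightarrow> nat" where
  "L_count (L _) = 1"
| "L_count (I _) = 0"
| "L_count CL = 0"
| "L_count CLI = 0"
| "L_count CI = 0"

definition L_num :: "hv list \<Rightarrow> nat" where
  "L_num w = sum_list (map L_count w)"

lemma L_num_simps [simp]:
  "L_num [] = 0" "L_num (x # w) = L_count x + L_num w" "L_num (a @ b) = L_num a + L_num b"
  by (simp_all add: L_num_def)

definition L_parts_le :: "nat \<Rightarrow> hv list \<Rightarrow> bool" where
  "L_parts_le M w \<longleftrightarrow> (\<forall>j. L j \<in> set w \<longrightarrow> - int M \<le> j)"

lemma L_parts_le_simps [simp]:
  "L_parts_le M []" "L_parts_le M (I j # w) = L_parts_le M w"
  "L_parts_le M (L j # w) \<longleftrightarrow> - int M \<le> j \<and> L_parts_le M w"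
  "L_parts_le M (a @ b) \<longleftrightarrow> L_parts_le M a \<and> L_parts_le M b"
  by (auto simp: L_parts_le_def)

lemma L_num_0:
  "list_all neg w \<Longrightarrow> L_num w = 0 \<longleftrightarrow> (\<forall>x\<in>set w. \<exists>j>0. x = I (- int j))"
proof (induction w)
  case (Cons x w)
  then show ?case
  proof (cases x)
    case (I j)
    have "\<exists>i>0. j = - int i" using Cons.prems I by (intro exI[of _ "nat (- j)"]) auto
    then show ?thesis using Cons I by auto
  qed auto
qed simp

lemma L_num_bounded: "\<exists>M. L_parts_le M w"
proof (induction w)
  case (Cons x w)
  then obtain M where "L_parts_le M w" ..
  then show ?case
    by (cases x; intro exI[of _ "max M (nat \<bar>case x of L j \<Rightarrow> j | _ \<Rightarrow> 0\<bar>)"]) (auto simp: L_parts_le_def)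
qed simp

definition I_parts_le :: "nat \<Rightarrow> hv list \<Rightarrow> bool" where
  "I_parts_le M w \<longleftrightarrow> (\<forall>x\<in>set w. \<exists>j. 0 < j \<and> j \<le> M \<and> x = I (- int j))"

lemma I_parts_le_simps [simp]:
  "I_parts_le M []" "I_parts_le M (x # w) \<longleftrightarrow> (\<exists>j. 0 < j \<and> j \<le> M \<and> x = I (- int j)) \<and> I_parts_le M w"
  by (auto simp: I_parts_le_def)

text \<open>For this value of \<open>h\<^sub>I\<close>, the operator \<open>I(n)\<close> pairs nontrivially with \<open>L(-n)\<close> for all positive
  \<open>n \<noteq> p\<close>, and \<open>L(n)\<close> with \<open>I(-n)\<close> for all positive \<open>n\<close>.\<close>

locale level_hw_mod = hw_mod \<rho> cL c h hI v
  for \<rho> :: "hv \<Rightarrow> 'v \<Rightarrow> 'v::complex_vector" and cL c h hI v +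
  fixes p :: nat
  assumes c: "c \<noteq> 0" and p: "p > 0" and hI: "hI = c * (1 - of_nat p)"
begin

lemma I_L:
  "\<rho> (I k) (\<rho> (L (- j)) x) = \<rho> (L (- j)) (\<rho> (I k) x) +
    (if k = j then (of_int k * c * (of_int k - of_nat p)) *\<^sub>C x else of_int k *\<^sub>C \<rho> (I (k - j)) x)"
proof (cases "k = j")
  case True
  then show ?thesis
    by (simp add: comm_LI[of "- j" j] hI algebra_simps power2_eq_square)
next
  case False
  then show ?thesis
    by (simp add: comm_LI[of "- j" k])
qed

lemma L_I:
  "\<rho> (L k) (\<rho> (I (- j)) x) = \<rho> (I (- j)) (\<rho> (L k) x) +
    (if k = j then (- (of_int k * c * (of_int k + of_nat p))) *\<^sub>C x else of_int j *\<^sub>C \<rho> (I (k - j)) x)"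
proof (cases "k = j")
  case True
  then show ?thesis
    by (simp add: comm_LI[of j "- j"] hI algebra_simps power2_eq_square)
next
  case False
  then show ?thesis
    by (simp add: comm_LI[of k "- j"])
qed

text \<open>The filtration by the number of factors L, where factors I count nothing. The strict
  inequality makes \<open>few_L 0\<close> trivial, so inductions start from 0.\<close>

definition few_L :: "nat \<Rightarrow> 'v set" where
  "few_L s = word_span (\<lambda>w. list_all neg w \<and> L_num w < s)"

lemma subspace_few_L: "cvec.subspace (few_L s)"
  unfolding few_L_def by (rule subspace_word_span)

lemmas few_L_add = cvec.subspace_add[OF subspace_few_L]
  and few_L_diff = cvec.subspace_diff[OF subspace_few_L]
  and few_L_scale = cvec.subspace_scale[OF subspace_few_L]
  and few_L_zero = cvec.subspace_0[OF subspace_few_L]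

lemma few_L_base: "list_all neg w \<Longrightarrow> L_num w < s \<Longrightarrow> foldr \<rho> w v \<in> few_L s"
  unfolding few_L_def by (rule word_span_base) simp

lemma few_L_image:
  "y \<in> few_L s \<Longrightarrow> clinear f \<Longrightarrow> cvec.subspace U \<Longrightarrow> (\<And>w. list_all neg w \<Longrightarrow> L_num w < s \<Longrightarrow> f (foldr \<rho> w v) \<in> U) \<Longrightarrow> f y \<in> U"
  unfolding few_L_def by (erule word_span_image) auto

lemma few_L_0: "few_L 0 = {0}"
  unfolding few_L_def by (rule word_span_empty) simp

lemma few_L_mono: "s \<le> s' \<Longrightarrow> few_L s \<subseteq> few_L s'"
  unfolding few_L_def by (rule word_span_mono) auto

lemma few_L_neg: "neg x \<Longrightarrow> y \<in> few_L s \<Longrightarrow> \<rho> x y \<in> few_L (s + L_count x)"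
  using few_L_base[of "x # _"] by (elim few_L_image[OF _ lin subspace_few_L]) simp

lemma few_L_word: "list_all neg w \<Longrightarrow> y \<in> few_L s \<Longrightarrow> foldr \<rho> w y \<in> few_L (s + L_num w)"
proof (induction w)
  case (Cons x w)
  then show ?case using few_L_neg[of x "foldr \<rho> w y" "s + L_num w"] by (simp add: ac_simps)
qed simp

text \<open>The bracket has one L less than the product: [L, L] is an L and [L, I] is an I. Two
  elements I of H^- commute, so the truncated 0 - 1 does no harm.\<close>

lemma few_L_commutator:
  assumes "neg x" "neg z" "y \<in> few_L s"
  shows "\<rho> x (\<rho> z y) - \<rho> z (\<rho> x y) \<in> few_L (s + (L_count x + L_count z - 1))"
proof -
  have "\<rho> x (\<rho> z y) - \<rho> z (\<rho> x y) = lin_ext (\<lambda>u. \<rho> u y) (bracket x z)"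
    using commutator[of x z y] by simp
  also have "\<dots> \<in> few_L (s + (L_count x + L_count z - 1))"
  proof (rule lin_ext_in_subspace[OF subspace_few_L])
    fix u assume u: "u \<in> keys (bracket x z)"
    have "neg u \<and> L_count u \<le> L_count x + L_count z - 1"
      using u assms(1,2) by (cases x; cases z) (auto split: if_splits)
    then show "\<rho> u y \<in> few_L (s + (L_count x + L_count z - 1))"
      using few_L_neg[of u y s] assms(3) few_L_mono[of "s + L_count u" "s + (L_count x + L_count z - 1)"] by auto
  qed
  finally show ?thesis .
qed

text \<open>I(k) kills \<open>v\<close>, so only its commutators with factors L(-j) survive. Each of
  them replaces that L(-j) by a scalar or by an I(k - j).\<close>

lemma I_word_lowers:
  "list_all neg w \<Longrightarrow> k > 0 \<Longrightarrow> \<rho> (I k) (foldr \<rho> w v) \<in> few_L (L_num w)"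
proof (induction w arbitrary: k)
  case Nil
  then show ?case by (simp add: few_L_zero)
next
  case (Cons x w)
  have w: "list_all neg w" "neg x" using Cons.prems by auto
  note IH = Cons.IH[OF w(1)]
  show ?case
  proof (cases x)
    case (L m)
    define j where "j = - m"
    have j: "x = L (- j)" "j > 0" using L w by (auto simp: j_def)
    have 1: "\<rho> (L (- j)) (\<rho> (I k) (foldr \<rho> w v)) \<in> few_L (Suc (L_num w))"
      using few_L_neg[OF _ IH[OF Cons.prems(2)], of "L (- j)"] j by simp
    have 2: "foldr \<rho> w v \<in> few_L (Suc (L_num w))" using w by (intro few_L_base) auto
    have 3: "\<rho> (I (k - j)) (foldr \<rho> w v) \<in> few_L (Suc (L_num w))" if "k \<noteq> j"
    proof (cases "k > j")
      case True
      then show ?thesis using IH[of "k - j"] few_L_mono[of "L_num w" "Suc (L_num w)"] by auto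
    next
      case False
      then show ?thesis using that w few_L_base[of "I (k - j) # w" "Suc (L_num w)"] by simp
    qed
    show ?thesis using 1 2 3 by (auto simp: j I_L intro: few_L_add few_L_scale)
  next
    case (I m)
    have "\<rho> (I k) (foldr \<rho> (x # w) v) = \<rho> (I m) (\<rho> (I k) (foldr \<rho> w v))"
      by (simp add: I comm_I[of k m])
    then show ?thesis using few_L_neg[OF _ IH[OF Cons.prems(2)], of "I m"] w I by simp
  qed (use w in auto)
qed

lemma I_lowers:
  assumes "k > 0" "y \<in> few_L (Suc s)"
  shows "\<rho> (I k) y \<in> few_L s"
proof (rule few_L_image[OF assms(2) lin subspace_few_L])
  fix w assume "list_all neg w" "L_num w < Suc s"
  then show "\<rho> (I k) (foldr \<rho> w v) \<in> few_L s" using I_word_lowers[of w k] assms(1) few_L_mono[of "L_num w" s] by auto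
qed

text \<open>Modulo words with fewer factors \<open>L\<close>, the operator \<open>L(-M) I(M)\<close> counts the factors \<open>L(-M)\<close> of a
  word without factors \<open>L(-j)\<close>, \<open>j > M\<close>.\<close>

lemma L_I_counts:
  assumes M: "M > 0"
  defines "\<kappa> \<equiv> of_nat M * c * (of_nat M - of_nat p)"
  shows "list_all neg w \<Longrightarrow> L_parts_le M w \<Longrightarrow>
    \<rho> (L (- int M)) (\<rho> (I (int M)) (foldr \<rho> w v)) - (\<kappa> * of_nat (count_list w (L (- int M)))) *\<^sub>C foldr \<rho> w v
      \<in> few_L (L_num w)"
proof (induction w)
  case Nil
  then show ?case using M by (simp add: few_L_zero)
next
  case (Cons x w)
  let ?y = "foldr \<rho> w v" and ?M = "int M"
  let ?n = "of_nat (count_list w (L (- ?M)))"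
  have w: "list_all neg w" "neg x" "L_parts_le M w"
    using Cons.prems by (auto simp: L_parts_le_def)
  define N where "N y = \<rho> (L (- ?M)) (\<rho> (I ?M) y)" for y
  have IH: "N ?y - (\<kappa> * ?n) *\<^sub>C ?y \<in> few_L (L_num w)"
    using Cons.IH w by (simp add: N_def)
  have Iy: "\<rho> (I ?M) ?y \<in> few_L (L_num w)" using I_word_lowers w M by simp
  have comm: "\<rho> (L (- ?M)) (\<rho> x (\<rho> (I ?M) ?y)) - (\<kappa> * ?n) *\<^sub>C \<rho> x ?y \<in> few_L (L_num (x # w))"
  proof -
    have "\<rho> (L (- ?M)) (\<rho> x (\<rho> (I ?M) ?y)) - \<rho> x (N ?y) \<in> few_L (L_num (x # w))"
      using few_L_commutator[OF _ w(2) Iy, of "L (- ?M)"] M by (simp add: N_def add.commute)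
    moreover have "\<rho> x (N ?y) - (\<kappa> * ?n) *\<^sub>C \<rho> x ?y \<in> few_L (L_num (x # w))"
      using few_L_neg[OF w(2) IH] by (simp add: diff scale add.commute)
    ultimately have "(\<rho> (L (- ?M)) (\<rho> x (\<rho> (I ?M) ?y)) - \<rho> x (N ?y)) + (\<rho> x (N ?y) - (\<kappa> * ?n) *\<^sub>C \<rho> x ?y)
        \<in> few_L (L_num (x # w))"
      by (rule few_L_add)
    then show ?thesis by simp
  qed
  show ?case
  proof (cases x)
    case (L m)
    define j where "j = - m"
    have j: "x = L (- j)" "j > 0" "j \<le> ?M" using L w Cons.prems by (auto simp: j_def)
    show ?thesis
    proof (cases "j = ?M")
      case True
      have "N (\<rho> x ?y) = \<rho> (L (- ?M)) (\<rho> x (\<rho> (I ?M) ?y)) + \<kappa> *\<^sub>C \<rho> x ?y"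
        using I_L[of ?M ?M ?y] by (simp add: N_def j True add scale \<kappa>_def)
      then have "N (\<rho> x ?y) - (\<kappa> * (?n + 1)) *\<^sub>C \<rho> x ?y
          = \<rho> (L (- ?M)) (\<rho> x (\<rho> (I ?M) ?y)) - (\<kappa> * ?n) *\<^sub>C \<rho> x ?y"
        by (simp add: algebra_simps scaleC_add_left)
      then show ?thesis using comm by (simp add: N_def j True algebra_simps)
    next
      case False
      have "N (\<rho> x ?y) = \<rho> (L (- ?M)) (\<rho> x (\<rho> (I ?M) ?y)) + of_nat M *\<^sub>C \<rho> (L (- ?M)) (\<rho> (I (?M - j)) ?y)"
        using I_L[of ?M j ?y] False by (simp add: N_def j add scale)
      then have "N (\<rho> x ?y) - (\<kappa> * ?n) *\<^sub>C \<rho> x ?y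
        = (\<rho> (L (- ?M)) (\<rho> x (\<rho> (I ?M) ?y)) - (\<kappa> * ?n) *\<^sub>C \<rho> x ?y) + of_nat M *\<^sub>C \<rho> (L (- ?M)) (\<rho> (I (?M - j)) ?y)"
        by (simp add: algebra_simps)
      also have "\<dots> \<in> few_L (L_num (x # w))"
      proof (intro few_L_add few_L_scale comm)
        \<comment> \<open>As j < M, the operator I(M - j) is again positive and loses a further
          factor L. This is why the word must have no parts above M.\<close>
        have "\<rho> (I (?M - j)) ?y \<in> few_L (L_num w)" using I_word_lowers w j False by simp
        then show "\<rho> (L (- ?M)) (\<rho> (I (?M - j)) ?y) \<in> few_L (L_num (x # w))"
          using few_L_neg[of "L (- ?M)"] M j by simp
      qed
      finally show ?thesis using False by (simp add: N_def j)
    qed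
  next
    case (I m)
    then show ?thesis using comm comm_I[of ?M m ?y] by (simp add: N_def)
  qed (use w in auto)
qed

definition I_span :: "nat \<Rightarrow> nat \<Rightarrow> 'v set" where
  "I_span M D = word_span (\<lambda>w. I_parts_le M w \<and> count_list w (I (- int M)) < D)"

lemma I_span_base: "I_parts_le M w \<Longrightarrow> count_list w (I (- int M)) < D \<Longrightarrow> foldr \<rho> w v \<in> I_span M D"
  unfolding I_span_def by (rule word_span_base) simp

lemma subspace_I_span: "cvec.subspace (I_span M D)"
  unfolding I_span_def by (rule subspace_word_span)

lemma I_span_image:
  "y \<in> I_span M D \<Longrightarrow> clinear f \<Longrightarrow> cvec.subspace U \<Longrightarrow>
    (\<And>w. I_parts_le M w \<Longrightarrow> count_list w (I (- int M)) < D \<Longrightarrow> f (foldr \<rho> w v) \<in> U) \<Longrightarrow> f y \<in> U"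
  unfolding I_span_def by (erule word_span_image) auto

lemmas I_span_scale = cvec.subspace_scale[OF subspace_I_span]
  and I_span_zero = cvec.subspace_0[OF subspace_I_span]

lemma I_span_mono: "D \<le> D' \<Longrightarrow> I_span M D \<subseteq> I_span M D'"
  unfolding I_span_def by (rule word_span_mono) auto

lemma I_pos_I_word: "(\<And>x. x \<in> set w \<Longrightarrow> \<exists>j. x = I j) \<Longrightarrow> k > 0 \<Longrightarrow> \<rho> (I k) (foldr \<rho> w v) = 0"
proof (induction w)
  case (Cons x w)
  then obtain j where "x = I j" by auto
  then show ?case using Cons comm_I[of k j "foldr \<rho> w v"] by simp
qed simp

text \<open>The companion of \<open>L_I_counts\<close> with I and L exchanged. It is exact: a
  commutator with a smaller part leaves a positive I(M - j), which kills words in the I alone. The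
  scalar involves M + p and so never degenerates.\<close>

lemma L_I_word:
  assumes M: "M > 0"
  defines "\<kappa> \<equiv> - (of_nat M * c * (of_nat M + of_nat p))"
  shows "I_parts_le M w \<Longrightarrow>
     \<rho> (I (- int M)) (\<rho> (L (int M)) (foldr \<rho> w v)) = (\<kappa> * of_nat (count_list w (I (- int M)))) *\<^sub>C foldr \<rho> w v
     \<and> \<rho> (L (int M)) (foldr \<rho> w v) \<in> I_span M (count_list w (I (- int M)))"
proof (induction w)
  case Nil
  then show ?case using M by (simp add: I_span_zero)
next
  case (Cons x w)
  let ?y = "foldr \<rho> w v" and ?M = "int M"
  let ?n = "count_list w (I (- ?M))"
  obtain j where j: "0 < j" "j \<le> M" "x = I (- int j)" using Cons.prems by auto
  have IH: "\<rho> (I (- ?M)) (\<rho> (L ?M) ?y) = (\<kappa> * of_nat ?n) *\<^sub>C ?y" "\<rho> (L ?M) ?y \<in> I_span M ?n"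
    using Cons by auto
  have x_act: "\<rho> x z \<in> I_span M (D + (if j = M then 1 else 0))" if "z \<in> I_span M D" for z D
  proof (rule I_span_image[OF that lin subspace_I_span])
    fix u assume "I_parts_le M u" "count_list u (I (- int M)) < D"
    then show "\<rho> x (foldr \<rho> u v) \<in> I_span M (D + (if j = M then 1 else 0))"
      using I_span_base[of M "x # u" "D + (if j = M then 1 else 0)"] j by auto
  qed
  show ?case
  proof (cases "j = M")
    case True
    have e: "\<rho> (L ?M) (\<rho> x ?y) = \<rho> x (\<rho> (L ?M) ?y) + \<kappa> *\<^sub>C ?y"
      using L_I[of ?M ?M ?y] by (simp add: j True \<kappa>_def)
    have "\<rho> (I (- ?M)) (\<rho> (L ?M) (\<rho> x ?y)) = \<rho> x (\<rho> (I (- ?M)) (\<rho> (L ?M) ?y)) + \<kappa> *\<^sub>C \<rho> x ?y"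
      by (simp only: e add scale) (simp add: j True)
    also have "\<dots> = (\<kappa> * of_nat (count_list (x # w) (I (- ?M)))) *\<^sub>C \<rho> x ?y"
      by (simp add: IH scale j True algebra_simps scaleC_add_left)
    finally have 1: "\<rho> (I (- ?M)) (\<rho> (L ?M) (\<rho> x ?y)) = (\<kappa> * of_nat (count_list (x # w) (I (- ?M)))) *\<^sub>C \<rho> x ?y" .
    have "?y \<in> I_span M (Suc ?n)" by (rule I_span_base) (use Cons.prems in auto)
    then have "\<rho> (L ?M) (\<rho> x ?y) \<in> I_span M (Suc ?n)"
      using x_act[OF IH(2)] True by (auto simp: e intro: cvec.subspace_add[OF subspace_I_span] I_span_scale)
    then show ?thesis using 1 by (simp add: j True)
  next
    case False
    have "\<rho> (I (?M - int j)) ?y = 0" by (rule I_pos_I_word) (use Cons.prems j False in \<open>auto simp: I_parts_le_def\<close>)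
    then have e: "\<rho> (L ?M) (\<rho> x ?y) = \<rho> x (\<rho> (L ?M) ?y)"
      using L_I[of ?M "int j" ?y] False by (simp add: j)
    have "\<rho> (I (- ?M)) (\<rho> (L ?M) (\<rho> x ?y)) = \<rho> x (\<rho> (I (- ?M)) (\<rho> (L ?M) ?y))"
      unfolding e by (simp add: j comm_I[of "- ?M" "- int j"])
    then show ?thesis using x_act[OF IH(2)] False by (simp add: IH scale e[unfolded j(3)] j)
  qed
qed

text \<open>Induction on the largest part M and on the number of factors I(-M). If x is in J, then
  L(M) x is in J with fewer such factors, so it is 0. By the counting identity a nonzero multiple of
  x then has fewer factors I(-M) as well. What remains at the end is a multiple of
  \<open>v\<close>.\<close>

lemma I_span_meets_trivially:
  assumes J: "submodule \<rho> J" "v \<notin> J"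
  shows "x \<in> J \<Longrightarrow> x \<in> I_span M D \<Longrightarrow> x = 0"
proof (induction M arbitrary: D x)
  case 0
  have "I_span 0 D \<subseteq> cvec.span {v}"
    unfolding I_span_def
  proof (rule word_span_minimal[OF cvec.subspace_span])
    fix w assume "I_parts_le 0 w \<and> count_list w (I (- int 0)) < D"
    then show "foldr \<rho> w v \<in> cvec.span {v}" by (cases w) (auto intro: cvec.span_base)
  qed
  then have "x \<in> cvec.span {v}" using 0 by blast
  then obtain a where a: "x = a *\<^sub>C v" by (auto simp: cvec.span_singleton)
  show ?case
  proof (rule ccontr)
    assume "x \<noteq> 0"
    then have "v = (1 / a) *\<^sub>C x" using a by (auto simp: scaleC_scaleC scaleC_one)
    then show False using J 0 cvec.subspace_scale[OF submoduleD(1)[OF J(1)]] by metis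
  qed
next
  case (Suc M)
  let ?M = "Suc M"
  let ?\<kappa> = "- (of_nat ?M * c * (of_nat ?M + of_nat p))"
  have \<kappa>: "?\<kappa> \<noteq> 0" using c by (simp del: of_nat_Suc add: of_nat_add[symmetric])
  note subJ = submoduleD(1)[OF J(1)]
  show ?case
    using Suc.prems
  proof (induction D arbitrary: x)
    case 0
    then show ?case by (simp add: I_span_def word_span_empty)
  next
    case (Suc D)
    show ?case
    proof (cases "D = 0")
      case True
      have "I_span ?M (Suc 0) \<subseteq> word_span (\<lambda>w. \<exists>E. I_parts_le M w \<and> count_list w (I (- int M)) < E)"
        unfolding I_span_def
      proof (rule word_span_mono)
        fix w assume w: "I_parts_le ?M w \<and> count_list w (I (- int ?M)) < Suc 0"
        have "\<exists>j. 0 < j \<and> j \<le> M \<and> x = I (- int j)" if x: "x \<in> set w" for x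
        proof -
          obtain j where j: "0 < j" "j \<le> ?M" "x = I (- int j)" using w x unfolding I_parts_le_def by blast
          have "j \<noteq> ?M" using w x j count_list_0_iff[of w "I (- int ?M)"] by auto
          then show ?thesis using j by auto
        qed
        then show "\<exists>E. I_parts_le M w \<and> count_list w (I (- int M)) < E"
          unfolding I_parts_le_def by blast
      qed
      then have "x \<in> word_span (\<lambda>w. \<exists>E. I_parts_le M w \<and> count_list w (I (- int M)) < E)"
        using Suc.prems True by auto
      then have "\<exists>E. x \<in> I_span M E"
        unfolding I_span_def by (rule word_span_Union) auto
      then show ?thesis using Suc.prems(1) \<open>\<And>x D. x \<in> J \<Longrightarrow> x \<in> I_span M D \<Longrightarrow> x = 0\<close> by blast
    next
      case False
      let ?N = "\<lambda>y. \<rho> (I (- int ?M)) (\<rho> (L (int ?M)) y)"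
      have N: "clinear ?N" by (rule clinear_compose[OF lin lin])
      have "\<rho> (L (int ?M)) x \<in> I_span ?M D"
      proof (rule I_span_image[OF Suc.prems(2) lin subspace_I_span])
        fix w assume "I_parts_le ?M w" "count_list w (I (- int ?M)) < Suc D"
        then show "\<rho> (L (int ?M)) (foldr \<rho> w v) \<in> I_span ?M D"
          using L_I_word[of ?M w] I_span_mono[of "count_list w (I (- int ?M))" D ?M] by auto
      qed
      then have "\<rho> (L (int ?M)) x = 0" using Suc.IH submoduleD(2)[OF J(1)] Suc.prems by blast
      then have N0: "?N x = 0" by simp
      have l: "clinear (\<lambda>y. (?\<kappa> * of_nat D) *\<^sub>C y - ?N y)"
        by (rule clinearI) (simp_all only: clinear_add[OF N] clinear_scale[OF N] scaleC_add_right
          cvec.scale_right_diff_distrib scaleC_scaleC mult.commute add_diff_add)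
      have "(?\<kappa> * of_nat D) *\<^sub>C x - ?N x \<in> I_span ?M D"
      proof (rule I_span_image[OF Suc.prems(2) l subspace_I_span])
        fix w assume w: "I_parts_le ?M w" "count_list w (I (- int ?M)) < Suc D"
        let ?n = "count_list w (I (- int ?M))" and ?a = "foldr \<rho> w v"
        have "(?\<kappa> * of_nat D) *\<^sub>C ?a - ?N ?a = (?\<kappa> * (of_nat D - of_nat ?n)) *\<^sub>C ?a"
          using L_I_word[of ?M w] w by (simp only: zero_less_Suc cvec.scale_left_diff_distrib[symmetric] right_diff_distrib)
        moreover have "?a \<in> I_span ?M D" if "?n \<noteq> D"
          by (rule I_span_base) (use that w in auto)
        ultimately show "(?\<kappa> * of_nat D) *\<^sub>C ?a - ?N ?a \<in> I_span ?M D"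
          by (cases "?n = D") (simp_all only: I_span_zero I_span_scale diff_self mult_zero_right cvec.scale_zero_left
            not_False_eq_True)
      qed
      then have "(?\<kappa> * of_nat D) *\<^sub>C x \<in> I_span ?M D" using N0 by simp
      moreover have "(?\<kappa> * of_nat D) *\<^sub>C x \<in> J" by (rule cvec.subspace_scale[OF subJ Suc.prems(1)])
      ultimately have "(?\<kappa> * of_nat D) *\<^sub>C x = 0" using Suc.IH by blast
      then show ?thesis using \<kappa> False by (simp only: cvec.scale_eq_0_iff mult_eq_0_iff of_nat_eq_0_iff simp_thms)
    qed
  qed
qed

end

section \<open>Elimination of L(-p) and the kernel of the projection\<close>

context level_hw_mod
begin

lemma move_L_right:
  assumes "neg x" "L_count x = 1"
  shows "list_all neg b \<Longrightarrow> \<rho> x (foldr \<rho> b v) - foldr \<rho> b (\<rho> x v) \<in> few_L (Suc (L_num b))"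
proof (induction b)
  case Nil
  then show ?case by (simp add: few_L_zero)
next
  case (Cons y b)
  let ?u = "foldr \<rho> b v"
  have "?u \<in> few_L (Suc (L_num b))" using Cons.prems by (intro few_L_base) auto
  then have "\<rho> x (\<rho> y ?u) - \<rho> y (\<rho> x ?u) \<in> few_L (Suc (L_num b) + (L_count x + L_count y - 1))"
    using assms Cons.prems by (intro few_L_commutator) auto
  moreover have "\<rho> y (\<rho> x ?u - foldr \<rho> b (\<rho> x v)) \<in> few_L (Suc (L_num b) + L_count y)"
    using Cons by (intro few_L_neg) auto
  ultimately have "(\<rho> x (\<rho> y ?u) - \<rho> y (\<rho> x ?u)) + \<rho> y (\<rho> x ?u - foldr \<rho> b (\<rho> x v)) \<in> few_L (Suc (L_num (y # b)))"
    using assms by (intro few_L_add) (simp_all add: ac_simps)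
  then show ?case by (simp add: diff)
qed

text \<open>The order behind the double induction: the number of factors L comes first, and the size
  of their parts is restricted only for words with the maximal number.\<close>

definition low_word :: "nat \<Rightarrow> nat \<Rightarrow> hv list \<Rightarrow> bool" where
  "low_word s M w \<longleftrightarrow> list_all neg w \<and> (L_num w < s \<or> L_num w = s \<and> L_parts_le M w)"

definition reduced_span :: "'v set \<Rightarrow> nat \<Rightarrow> nat \<Rightarrow> 'v set" where
  "reduced_span Y s M = cvec.span (Y \<union> {foldr \<rho> w v | w. low_word s M w})"

lemma subspace_reduced_span: "cvec.subspace (reduced_span Y s M)"
  unfolding reduced_span_def by (rule cvec.subspace_span)

lemma reduced_span_base:
  "y \<in> Y \<Longrightarrow> y \<in> reduced_span Y s M"
  "low_word s M w \<Longrightarrow> foldr \<rho> w v \<in> reduced_span Y s M"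
  unfolding reduced_span_def by (rule cvec.span_base, blast)+

lemma few_L_reduced_span: "few_L s \<subseteq> reduced_span Y s M"
  unfolding few_L_def by (rule word_span_minimal[OF subspace_reduced_span], rule reduced_span_base(2)) (simp add: low_word_def)

text \<open>A factor L(-p) is moved to the right end at the cost of words with fewer L, and L(-p) v
  is rewritten by \<open>Lp\<close>. The new words with equally many L contain one L(-p)
  less.\<close>

lemma eliminate_L_p:
  assumes Y: "submodule \<rho> Y" and Lp: "\<rho> (L (- int p)) v \<in> reduced_span Y 1 (p - 1)"
  shows "list_all neg w \<Longrightarrow> L_parts_le p w \<Longrightarrow> foldr \<rho> w v \<in> reduced_span Y (L_num w) (p - 1)"
proof (induction "count_list w (L (- int p))" arbitrary: w rule: less_induct)
  case less
  show ?case
  proof (cases "L (- int p) \<in> set w")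
    case False
    have "L_parts_le (p - 1) w"
      unfolding L_parts_le_def
    proof (intro allI impI)
      fix j assume j: "L j \<in> set w"
      then have "- int p \<le> j" "j \<noteq> - int p" using less.prems False by (auto simp: L_parts_le_def)
      then show "- int (p - 1) \<le> j" using p by simp
    qed
    then show ?thesis using less.prems by (intro reduced_span_base) (simp add: low_word_def)
  next
    case True
    then obtain a b where w: "w = a @ L (- int p) # b" by (meson split_list)
    let ?R = "reduced_span Y (L_num w) (p - 1)"
    have ab: "list_all neg a" "list_all neg b" using less.prems w by auto
    have "foldr \<rho> a (\<rho> (L (- int p)) (foldr \<rho> b v) - foldr \<rho> b (\<rho> (L (- int p)) v)) \<in> few_L (Suc (L_num b) + L_num a)"
      using p ab by (intro few_L_word move_L_right) auto
    then have 1: "foldr \<rho> w v - foldr \<rho> (a @ b) (\<rho> (L (- int p)) v) \<in> ?R"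
      using few_L_reduced_span[of "L_num w" Y "p - 1"] by (auto simp: w clinear_diff[OF lin_foldr] ac_simps)
    have 2: "foldr \<rho> (a @ b) (\<rho> (L (- int p)) v) \<in> ?R"
    proof (rule clinear_image_span[OF lin_foldr subspace_reduced_span _ Lp[unfolded reduced_span_def]])
      fix y assume "y \<in> Y \<union> {foldr \<rho> w v | w. low_word 1 (p - 1) w}"
      then show "foldr \<rho> (a @ b) y \<in> ?R"
      proof
        assume "y \<in> Y"
        then show ?thesis using foldr_in_submodule[OF Y] by (intro reduced_span_base(1)) auto
      next
        assume "y \<in> {foldr \<rho> w v | w. low_word 1 (p - 1) w}"
        then obtain u where u: "y = foldr \<rho> u v" "list_all neg u" "L_num u < 1 \<or> L_num u = 1 \<and> L_parts_le (p - 1) u"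
          by (auto simp: low_word_def)
        let ?w = "a @ b @ u"
        have y: "foldr \<rho> (a @ b) y = foldr \<rho> ?w v" by (simp add: u)
        show ?thesis
        proof (cases "L_num u < 1")
          case True
          then have "foldr \<rho> ?w v \<in> ?R" by (intro reduced_span_base(2)) (use ab u w in \<open>auto simp: low_word_def\<close>)
          then show ?thesis by (simp only: y)
        next
          case False
          then have u1: "L_num u = 1" "L_parts_le (p - 1) u" using u by auto
          have "L (- int p) \<notin> set u" using u1 p by (auto simp: L_parts_le_def)
          then have "count_list u (L (- int p)) = 0" by (simp add: count_list_0_iff)
          moreover have "L_parts_le p u" using u1 by (fastforce simp: L_parts_le_def)
          ultimately have "foldr \<rho> ?w v \<in> reduced_span Y (L_num ?w) (p - 1)"
            using less.prems u ab by (intro less.hyps) (auto simp: w)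
          moreover have "L_num ?w = L_num w" by (simp add: w u1)
          ultimately show ?thesis by (simp only: y)
        qed
      qed
    qed
    from cvec.subspace_add[OF subspace_reduced_span 1 2] show ?thesis by simp
  qed
qed

definition top_word :: "nat \<Rightarrow> nat \<Rightarrow> nat \<Rightarrow> hv list \<Rightarrow> bool" where
  "top_word s M D w \<longleftrightarrow> list_all neg w \<and>
     (L_num w < s \<or> L_num w = s \<and> L_parts_le M w \<and> count_list w (L (- int M)) < D)"

definition L_span :: "nat \<Rightarrow> nat \<Rightarrow> nat \<Rightarrow> 'v set" where
  "L_span s M D = word_span (top_word s M D)"

lemma subspace_L_span: "cvec.subspace (L_span s M D)"
  unfolding L_span_def by (rule subspace_word_span)

lemma few_L_L_span: "few_L s \<subseteq> L_span s M D"
  unfolding few_L_def L_span_def by (rule word_span_mono) (simp add: top_word_def)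

lemma L_span_few_L: "L_span s M D \<subseteq> few_L (Suc s)"
  unfolding few_L_def L_span_def by (rule word_span_mono) (auto simp: top_word_def)

lemma low_word_L_span:
  assumes "x \<in> word_span (low_word s M)"
  shows "\<exists>D. x \<in> L_span s M D"
  unfolding L_span_def
proof (rule word_span_Union)
  show "x \<in> word_span (\<lambda>w. \<exists>D. top_word s M D w)"
    using assms word_span_mono[of "low_word s M" "\<lambda>w. \<exists>D. top_word s M D w"]
    by (auto simp: low_word_def top_word_def)
qed (auto simp: top_word_def)

text \<open>No PBW basis is needed: if \<open>x \<in> J\<close> has at most \<open>s\<close> factors \<open>L\<close>, then \<open>I(M) x \<in> J\<close> has
  fewer, so lies in \<open>Y\<close> by induction, and \<open>L(-M) I(M)\<close> acts on the leading part of \<open>x\<close> as a nonzero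
  number depending on the number of factors \<open>L(-M)\<close>. For \<open>M = p\<close> this fails, but \<open>L(-p)\<close> can be
  eliminated modulo \<open>Y\<close>.\<close>

lemma kernel_subset:
  assumes J: "submodule \<rho> J" "v \<notin> J" and Y: "submodule \<rho> Y" "Y \<subseteq> J"
    and Lp: "\<rho> (L (- int p)) v \<in> reduced_span Y 1 (p - 1)"
  shows "J \<subseteq> Y"
proof -
  note subJ = submoduleD(1)[OF J(1)] and subY = submoduleD(1)[OF Y(1)]
  have "J \<inter> few_L s \<subseteq> Y" for s
  proof (induction s)
    case 0
    then show ?case using cvec.subspace_0[OF subY] by (auto simp: few_L_0)
  next
    case (Suc s)
    have I_Y: "\<rho> (I (int M)) x \<in> Y" if "x \<in> J" "x \<in> L_span s M' D" "M > 0" for x M M' D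
      using I_lowers[of "int M" x s] that L_span_few_L[of s M' D] submoduleD(2)[OF J(1)] Suc.IH by auto
    have main: "x \<in> J \<Longrightarrow> x \<in> L_span s M D \<Longrightarrow> x \<in> Y" for x M D
    proof (induction M arbitrary: D x)
      case 0
      have no_L: "L_num w = 0" if "list_all neg w" "L_parts_le 0 w" for w
      proof -
        have "\<exists>j>0. x = I (- int j)" if "x \<in> set w" for x
        proof (cases x)
          case (L j)
          then show ?thesis using \<open>x \<in> set w\<close> \<open>list_all neg w\<close> \<open>L_parts_le 0 w\<close>
            by (fastforce simp: L_parts_le_def list_all_iff)
        next
          case (I j)
          then have "j < 0" using \<open>x \<in> set w\<close> \<open>list_all neg w\<close> by (auto simp: list_all_iff)
          then show ?thesis using I by (intro exI[of _ "nat (- j)"]) auto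
        qed (use \<open>x \<in> set w\<close> \<open>list_all neg w\<close> in \<open>auto simp: list_all_iff\<close>)
        then show ?thesis using L_num_0[OF that(1)] by simp
      qed
      show ?case
      proof (cases "s = 0")
        case False
        have "L_span s 0 D \<subseteq> few_L s"
          unfolding L_span_def few_L_def by (rule word_span_mono) (use no_L False in \<open>auto simp: top_word_def\<close>)
        then show ?thesis using 0 Suc.IH by blast
      next
        \<comment> \<open>Neither large parts nor factors L are left: x is a polynomial in the I(-j)
          applied to v.\<close>
        case True
        have "L_span s 0 D \<subseteq> word_span (\<lambda>w. \<exists>M. I_parts_le M w)"
          unfolding L_span_def
        proof (rule word_span_mono)
          fix w assume "top_word s 0 D w"
          then have "\<forall>x\<in>set w. \<exists>j>0. x = I (- int j)" using True L_num_0[of w] by (auto simp: top_word_def)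
          then show "\<exists>M. I_parts_le M w"
          proof (induction w)
            case (Cons y w)
            then obtain M j where "I_parts_le M w" "j > 0" "y = I (- int j)" by auto
            then show ?case by (intro exI[of _ "max M j"]) (fastforce simp: I_parts_le_def)
          qed (simp add: I_parts_le_def)
        qed
        then have "x \<in> word_span (\<lambda>w. \<exists>M. I_parts_le M w)" using 0 by blast
        then obtain M where M: "x \<in> word_span (I_parts_le M)"
          using word_span_Union[of x I_parts_le] by (fastforce simp: I_parts_le_def)
        have "\<exists>E. x \<in> I_span M E"
          unfolding I_span_def
        proof (rule word_span_Union)
          show "x \<in> word_span (\<lambda>w. \<exists>E. I_parts_le M w \<and> count_list w (I (- int M)) < E)"
            using M word_span_mono[of "I_parts_le M" "\<lambda>w. \<exists>E. I_parts_le M w \<and> count_list w (I (- int M)) < E"] by auto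
        qed auto
        then have "x = 0" using I_span_meets_trivially[OF J] 0 by blast
        then show ?thesis using cvec.subspace_0[OF subY] by simp
      qed
    next
      case (Suc M)
      note IHM = Suc.IH
      let ?M = "Suc M"
      \<comment> \<open>The summand from \<open>Y\<close> is also in \<open>J\<close>, so the
        remaining summand is in \<open>J\<close> and has parts at most M; the induction on M applies
        to it.\<close>
      have lower: "y \<in> Y" if y: "y \<in> J" "y \<in> reduced_span Y s M" for y
      proof -
        have "reduced_span Y s M = {a + b | a b. a \<in> Y \<and> b \<in> word_span (low_word s M)}"
          unfolding reduced_span_def cvec.span_Un word_span_def using subY by (simp only: cvec.span_eq_iff[THEN iffD2])
        then obtain a b where ab: "y = a + b" "a \<in> Y" "b \<in> word_span (low_word s M)"
          using y by blast
        then obtain E where E: "b \<in> L_span s M E" using low_word_L_span by blast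
        have "b = y - a" using ab by simp
        then have "b \<in> J" using y(1) ab(2) Y(2) cvec.subspace_diff[OF subJ] by auto
        then have "b \<in> Y" using IHM E by blast
        then show ?thesis using ab cvec.subspace_add[OF subY] by simp
      qed
      show ?case
      proof (cases "?M = p")
        \<comment> \<open>The scalar M c (M - p) is 0 here, and rewriting L(-p) modulo
          \<open>Y\<close> replaces the counting argument.\<close>
        case True
        have "L_span s ?M D \<subseteq> reduced_span Y s M"
          unfolding L_span_def
        proof (rule word_span_minimal[OF subspace_reduced_span])
          fix w assume w: "top_word s ?M D w"
          show "foldr \<rho> w v \<in> reduced_span Y s M"
          proof (cases "L_num w < s")
            case True
            then show ?thesis using w by (intro reduced_span_base(2)) (simp add: low_word_def top_word_def)
          next
            case False
            then show ?thesis using eliminate_L_p[OF Y(1) Lp, of w] w True by (auto simp: top_word_def)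
          qed
        qed
        then show ?thesis using lower Suc.prems by blast
      next
        case False
        let ?\<kappa> = "of_nat ?M * c * (of_nat ?M - of_nat p)"
        have "(of_nat ?M :: complex) \<noteq> of_nat p" using False by (simp only: of_nat_eq_iff not_False_eq_True)
        then have \<kappa>: "?\<kappa> \<noteq> 0" using c by (simp only: mult_eq_0_iff of_nat_eq_0_iff right_minus_eq) simp
        show ?thesis
          using Suc.prems
        proof (induction D arbitrary: x)
          case 0
          have "L_span s ?M 0 \<subseteq> few_L s"
            unfolding L_span_def few_L_def by (rule word_span_mono) (simp add: top_word_def)
          then show ?case using 0 \<open>J \<inter> few_L s \<subseteq> Y\<close> by blast
        next
          case (Suc D)
          show ?case
          proof (cases "D = 0")
            case True
            have "L_span s ?M (Suc 0) \<subseteq> reduced_span Y s M"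
              unfolding L_span_def
            proof (rule word_span_minimal[OF subspace_reduced_span])
              fix w assume w: "top_word s ?M (Suc 0) w"
              have "L_parts_le M w" if "L_parts_le ?M w" "count_list w (L (- int ?M)) < Suc 0"
                unfolding L_parts_le_def
              proof (intro allI impI)
                fix j assume j: "L j \<in> set w"
                have "j \<noteq> - int ?M" using j that(2) count_list_0_iff[of w "L (- int ?M)"] by auto
                moreover have "- int ?M \<le> j" using j that(1) unfolding L_parts_le_def by blast
                ultimately show "- int M \<le> j" by simp
              qed
              then show "foldr \<rho> w v \<in> reduced_span Y s M"
                by (intro reduced_span_base(2)) (use w in \<open>auto simp: low_word_def top_word_def\<close>)
            qed
            then show ?thesis using lower Suc.prems True by blast
          next
            case False
            let ?N = "\<lambda>y. \<rho> (L (- int ?M)) (\<rho> (I (int ?M)) y)"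
            have N: "clinear ?N" by (rule clinear_compose[OF lin lin])
            have NY: "?N x \<in> Y" using I_Y[OF Suc.prems] submoduleD(2)[OF Y(1)] by blast
            have l: "clinear (\<lambda>y. (?\<kappa> * of_nat D) *\<^sub>C y - ?N y)"
              by (rule clinearI) (simp_all only: clinear_add[OF N] clinear_scale[OF N] scaleC_add_right
                cvec.scale_right_diff_distrib scaleC_scaleC mult.commute add_diff_add)
            \<comment> \<open>Words with exactly D factors L(-M) cancel up to fewer L; the others
              lie in the smaller span anyway. As \<open>?N x\<close> is in \<open>Y\<close>, the
              induction on D yields x.\<close>
            have "(?\<kappa> * of_nat D) *\<^sub>C x - ?N x \<in> L_span s ?M D"
            proof (rule word_span_image[OF Suc.prems(2)[unfolded L_span_def] l subspace_L_span])
              fix w assume "top_word s ?M (Suc D) w"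
              then have w: "list_all neg w" "L_num w < s \<or> L_num w = s \<and> L_parts_le ?M w \<and> count_list w (L (- int ?M)) < Suc D"
                by (auto simp: top_word_def)
              let ?a = "foldr \<rho> w v"
              show "(?\<kappa> * of_nat D) *\<^sub>C ?a - ?N ?a \<in> L_span s ?M D"
              proof (cases "L_num w < s")
                case True
                have "?N ?a \<in> few_L (L_num w + L_count (L (- int ?M)))"
                  by (intro few_L_neg I_word_lowers) (use w in auto)
                then have "?N ?a \<in> few_L s" using True few_L_mono[of "Suc (L_num w)" s] by auto
                moreover have "?a \<in> few_L s" by (rule few_L_base[OF w(1) True])
                ultimately show ?thesis using few_L_L_span few_L_diff few_L_scale by blast
              next
                case False
                let ?n = "count_list w (L (- int ?M))"
                have w': "L_num w = s" "L_parts_le ?M w" "?n < Suc D" using False w(2) by auto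
                have "?N ?a - (?\<kappa> * of_nat ?n) *\<^sub>C ?a \<in> few_L s"
                  using L_I_counts[of ?M w] w(1) w' by blast
                then have 1: "?N ?a - (?\<kappa> * of_nat ?n) *\<^sub>C ?a \<in> L_span s ?M D" using few_L_L_span by blast
                have 2: "(?\<kappa> * (of_nat D - of_nat ?n)) *\<^sub>C ?a \<in> L_span s ?M D"
                proof (cases "?n = D")
                  case True
                  then show ?thesis
                    by (simp only: diff_self mult_zero_right cvec.scale_zero_left cvec.subspace_0[OF subspace_L_span])
                next
                  case False
                  have "?a \<in> L_span s ?M D" unfolding L_span_def by (rule word_span_base) (use w w' False in \<open>auto simp: top_word_def\<close>)
                  then show ?thesis by (rule cvec.subspace_scale[OF subspace_L_span])
                qed
                have "(?\<kappa> * of_nat D) *\<^sub>C ?a - ?N ?a = (?\<kappa> * (of_nat D - of_nat ?n)) *\<^sub>C ?a - (?N ?a - (?\<kappa> * of_nat ?n) *\<^sub>C ?a)"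
                  by (simp only: right_diff_distrib cvec.scale_left_diff_distrib) simp
                then show ?thesis using cvec.subspace_diff[OF subspace_L_span 2 1] by (simp only:)
              qed
            qed
            moreover have "(?\<kappa> * of_nat D) *\<^sub>C x - ?N x \<in> J"
              using NY Y(2) Suc.prems(1) by (intro subspace_closed[OF subJ]) auto
            ultimately have "(?\<kappa> * of_nat D) *\<^sub>C x - ?N x \<in> Y" using Suc.IH by blast
            from cvec.subspace_add[OF subY this NY]
            have "(?\<kappa> * of_nat D) *\<^sub>C x \<in> Y" by simp
            from cvec.subspace_scale[OF subY this, of "1 / (?\<kappa> * of_nat D)"]
            show ?thesis using \<kappa> False by (simp only: scaleC_scaleC) (simp add: scaleC_one)
          qed
        qed
      qed
    qed
    show ?case
    proof
      fix x assume x: "x \<in> J \<inter> few_L (Suc s)"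
      have "few_L (Suc s) \<subseteq> word_span (\<lambda>w. \<exists>M. low_word s M w)"
        unfolding few_L_def by (rule word_span_mono) (use L_num_bounded in \<open>auto simp: low_word_def less_Suc_eq\<close>)
      then have "x \<in> word_span (\<lambda>w. \<exists>M. low_word s M w)" using x by blast
      then have "\<exists>M. x \<in> word_span (low_word s M)"
        by (rule word_span_Union) (fastforce simp: low_word_def L_parts_le_def)
      then obtain M E where "x \<in> L_span s M E" using low_word_L_span by blast
      then show "x \<in> Y" using main x by blast
    qed
  qed
  moreover have "\<exists>s. x \<in> few_L s" for x
  proof -
    have "x \<in> word_span (\<lambda>w. \<exists>s. list_all neg w \<and> L_num w < s)"
      using in_word_span[of x] by (simp add: gt_ex)
    then show ?thesis unfolding few_L_def by (rule word_span_Union) auto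
  qed
  ultimately show ?thesis by blast
qed

end

section \<open>Schur polynomials and the enveloping algebra\<close>

lemma clinear_lin_ext_compose: "clinear f \<Longrightarrow> f (lin_ext g u) = lin_ext (\<lambda>z. f (g z)) u"
  by (simp add: lin_ext_def clinear_sum clinear_scale)

text \<open>\<open>I_word\<close> sorts its factors, so a product of monomials corresponds to
  concatenation only up to order. Multisets hide the order until commutativity of the I(-j) is
  used.\<close>

lemma mset_I_word:
  assumes "finite A" "keys m \<subseteq> A"
  shows "mset (I_word m) = (\<Sum>j\<in>A. replicate_mset (lookup m j) (I (- int j)))"
proof -
  have "mset (I_word m) = (\<Sum>j\<leftarrow>sorted_list_of_set (keys m). replicate_mset (lookup m j) (I (- int j)))"
    by (simp add: I_word_def mset_concat comp_def)
  also have "\<dots> = (\<Sum>j\<in>keys m. replicate_mset (lookup m j) (I (- int j)))"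
    by (subst sum_list_distinct_conv_sum_set) auto
  also have "\<dots> = (\<Sum>j\<in>A. replicate_mset (lookup m j) (I (- int j)))"
    by (rule sum.mono_neutral_left) (use assms in \<open>auto simp: in_keys_iff\<close>)
  finally show ?thesis .
qed

lemma mset_I_word_add: "mset (I_word (a + b)) = mset (I_word a) + mset (I_word b)"
proof -
  let ?A = "keys a \<union> keys b"
  have k: "keys (a + b) \<subseteq> ?A" by (rule keys_add)
  have r: "replicate_mset (i + j) x = replicate_mset i x + replicate_mset j x" for i j and x :: hv
    by (induction i) auto
  show ?thesis
    by (simp add: mset_I_word[of ?A] k lookup_add r sum.distrib)
qed

lemma mset_I_word_single: "mset (I_word (single k 1)) = {#I (- int k)#}"
  by (simp add: mset_I_word[of "{k}"])

lemma length_I_word: "length (I_word m) = mono_degree m"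
  unfolding I_word_def length_concat map_map mono_degree_def
  by (simp add: comp_def sum_list_distinct_conv_sum_set)

lemma word_weight_I_word: "word_weight (I_word m) = - int (mono_weight m)"
proof -
  have r: "word_weight (replicate k x) = int k * hv_weight x" for k x
    by (induction k) (auto simp: algebra_simps)
  have "word_weight (concat xss) = sum_list (map word_weight xss)" for xss
    by (induction xss) auto
  then have "word_weight (I_word m) = (\<Sum>j\<in>keys m. - (int (lookup m j) * int j))"
    unfolding I_word_def by (simp add: comp_def r sum_list_distinct_conv_sum_set)
  then show ?thesis by (simp add: mono_weight_def sum_negf mult.commute)
qed

lemma set_I_word: "set (I_word m) = (\<lambda>j. I (- int j)) ` keys m"
  by (auto simp: I_word_def in_keys_iff)

lemma mono_degree_add_single: "mono_degree (single k 1 + m) = Suc (mono_degree m)"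
  unfolding length_I_word[symmetric] size_mset[symmetric] mset_I_word_add mset_I_word_single by simp

lemma mono_weight_add_single: "mono_weight (single k 1 + m) = k + mono_weight m"
proof -
  have e: "word_weight w = (\<Sum>x\<in>#mset w. hv_weight x)" for w
    unfolding word_weight_def sum_mset_sum_list[symmetric] by simp
  have "- int (mono_weight (single k 1 + m)) = - int (k + mono_weight m)"
    unfolding word_weight_I_word[symmetric] e mset_I_word_add mset_I_word_single
    unfolding image_mset_union sum_mset.union e[symmetric] word_weight_I_word by simp
  then show ?thesis by simp
qed

lemma neg_I_word: "0 \<notin> keys m \<Longrightarrow> list_all neg (I_word m)"
  by (auto simp: list_all_iff set_I_word intro: gr0I)

lemma L_num_I_word: "L_num (I_word m) = 0"
proof -
  have "L_num w = 0" if "set w \<subseteq> range I" for w using that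
    by (induction w) auto
  moreover have "set (I_word m) \<subseteq> range I" by (auto simp: set_I_word)
  ultimately show ?thesis .
qed

lemma schur_0: "schur 0 = 1"
  by (simp add: schur_def fps_compose_nth)

lemma of_nat_ipoly: "of_nat n = (single 0 (of_nat n) :: ipoly)"
  by (simp add: single_of_nat)

text \<open>Comparison of coefficients in the derivative of the generating series.\<close>

lemma schur_rec:
  "of_nat r * schur r = (\<Sum>k = 1..r. single (single k 1) 1 * schur (r - k))"
proof (cases r)
  case (Suc n)
  define E :: "ipoly fps" where "E = Abs_fps (\<lambda>k. single 0 (1 / fact k))"
  define X :: "ipoly fps" where "X = Abs_fps (\<lambda>n. if n = 0 then 0
    else single (single n 1) (1 / of_nat n))"
  have s: "schur k = fps_nth (E oo X) k" for k by (simp add: schur_def E_def X_def)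
  have "fps_deriv E = E"
  proof (rule fps_ext)
    fix k
    have "of_nat (Suc k) * single 0 (1 / fact (Suc k)) = (single 0 (1 / fact k) :: ipoly)"
      unfolding of_nat_ipoly mult_single by (simp add: fact_Suc del: of_nat_Suc)
    then show "fps_nth (fps_deriv E) k = fps_nth E k"
      by (simp add: E_def del: of_nat_Suc fact_Suc)
  qed
  then have d: "fps_deriv (E oo X) = (E oo X) * fps_deriv X"
    by (simp add: fps_compose_deriv X_def)
  have "of_nat r * schur r = fps_nth (fps_deriv (E oo X)) n"
    by (simp add: s Suc)
  also have "\<dots> = (\<Sum>i = 0..n. schur i * fps_nth (fps_deriv X) (n - i))"
    by (simp add: d fps_mult_nth s)
  also have "\<dots> = (\<Sum>i = 0..n. schur i * single (single (r - i) 1) 1)"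
  proof (rule sum.cong[OF refl])
    fix i assume i: "i \<in> {0..n}"
    then have "fps_nth (fps_deriv X) (n - i) = of_nat (r - i) * single (single (r - i) 1) (1 / of_nat (r - i))"
      by (simp add: X_def Suc Suc_diff_le del: of_nat_Suc)
    also have "\<dots> = single (single (r - i) 1) 1"
      using i unfolding of_nat_ipoly mult_single by (simp add: Suc Suc_diff_le del: of_nat_Suc)
    finally show "schur i * fps_nth (fps_deriv X) (n - i) = schur i * single (single (r - i) 1) 1"
      by simp
  qed
  also have "\<dots> = (\<Sum>k = 1..r. single (single k 1) 1 * schur (r - k))"
    by (rule sum.reindex_bij_witness[of _ "\<lambda>k. r - k" "\<lambda>i. r - i"]) (auto simp: Suc mult.commute)
  finally show ?thesis .
qed simp

lemma keys_sum_subset: "keys (\<Sum>a\<in>A. q a) \<subseteq> (\<Union>a\<in>A. keys (q a))"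
proof (cases "finite A")
  case True
  then show ?thesis
    by (induction A) (auto dest!: subsetD[OF keys_add])
qed simp

lemma keys_of_nat_mult: "r > 0 \<Longrightarrow> keys (of_nat r * q) = keys (q :: ipoly)"
proof -
  assume r: "r > 0"
  have "of_nat r * q = Poly_Mapping.map ((*) (of_nat r)) q" unfolding mult_map_scale_conv_mult of_nat_ipoly ..
  then show ?thesis using r by (auto simp: in_keys_iff map.rep_eq when_def)
qed

lemma weight_poly_schur: "weight_poly r (schur r)"
proof (induction r rule: less_induct)
  case (less r)
  show ?case
  proof (cases "r = 0")
    case True
    then show ?thesis by (simp add: schur_0 weight_poly_def mono_weight_def)
  next
    case False
    show ?thesis
      unfolding weight_poly_def
    proof
      fix m assume "m \<in> keys (schur r)"
      then have "m \<in> keys (of_nat r * schur r)" using False by (simp add: keys_of_nat_mult)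
      then obtain k where k: "k \<in> {1..r}" "m \<in> keys (single (single k 1) 1 * schur (r - k))"
        unfolding schur_rec using keys_sum_subset by fast
      then obtain m' where m': "m = single k 1 + m'" "m' \<in> keys (schur (r - k))"
        using subsetD[OF keys_mult k(2)] by auto
      then have "0 \<notin> keys m'" "mono_weight m' = r - k"
        using less[of "r - k"] k by (auto simp: weight_poly_def)
      then show "0 \<notin> keys m \<and> mono_weight m = r"
        using k m' mono_weight_add_single[of k m'] by (auto simp: in_keys_iff lookup_add lookup_single)
    qed
  qed
qed

section \<open>Elements of the tensor algebra acting on a module\<close>

context hv_mod
begin

lemma T_act_ideal: "u \<in> U_minus_ideal \<Longrightarrow> T_act \<rho> u x = 0"
proof (rule clinear_vanishes_on_span[OF lin_T_act_left, rotated])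
  assume u: "u \<in> U_minus_ideal"
  then show "u \<in> cvec.span {single (a @ [x, y] @ b) 1 - single (a @ [y, x] @ b) 1
       - lin_ext (\<lambda>z. single (a @ [z] @ b) 1) (bracket x y) | a b x y.
     list_all neg a \<and> list_all neg b \<and> neg x \<and> neg y}" by (simp add: U_minus_ideal_def)
next
  fix g :: hv_tensor_alg assume "g \<in> {single (a @ [x, y] @ b) 1 - single (a @ [y, x] @ b) 1
       - lin_ext (\<lambda>z. single (a @ [z] @ b) 1) (bracket x y) | a b x y.
     list_all neg a \<and> list_all neg b \<and> neg x \<and> neg y}"
  then obtain a b y z where g: "g = single (a @ [y, z] @ b) 1 - single (a @ [z, y] @ b) 1
       - lin_ext (\<lambda>u. single (a @ [u] @ b) 1) (bracket y z)" by blast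
  have "T_act \<rho> g x = foldr \<rho> a (\<rho> y (\<rho> z (foldr \<rho> b x))) - foldr \<rho> a (\<rho> z (\<rho> y (foldr \<rho> b x)))
      - foldr \<rho> a (lin_ext (\<lambda>u. \<rho> u (foldr \<rho> b x)) (bracket y z))"
    unfolding g clinear_diff[OF lin_T_act_left] clinear_lin_ext_compose[OF lin_T_act_left]
    by (simp add: scaleC_one clinear_lin_ext_compose[OF lin_foldr])
  also have "\<dots> = 0"
    by (simp add: clinear_diff[OF lin_foldr, symmetric] commutator[of y z])
  finally show "T_act \<rho> g x = 0" .
qed

lemma U_minus_act_abs:
  assumes "u \<in> T_minus"
  shows "U_minus_act \<rho> (abs_U_minus u) x = T_act \<rho> u x"
proof -
  have "U_minus_eq u u"
    using assms by (simp add: U_minus_eq_def U_minus_ideal_closed)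
  then have "U_minus_eq (rep_U_minus (abs_U_minus u)) u"
    by (rule Quotient3_rep_abs[OF Quotient3_U_minus])
  then have "T_act \<rho> (rep_U_minus (abs_U_minus u) - u) x = 0"
    by (intro T_act_ideal) (simp add: U_minus_eq_def)
  then show ?thesis by (simp add: U_minus_act_def clinear_diff[OF lin_T_act_left])
qed

lemma T_act_I_subst:
  "T_act \<rho> (I_subst a q) x = lin_ext (\<lambda>m. (1 / a ^ mono_degree m) *\<^sub>C foldr \<rho> (I_word m) x) q"
  unfolding I_subst_def clinear_lin_ext_compose[OF lin_T_act_left] by simp

lemma T_act_T_mult: "T_act \<rho> (T_mult u (single w 1)) x = T_act \<rho> u (foldr \<rho> w x)"
  unfolding T_mult_def clinear_lin_ext_compose[OF lin_T_act_left] by (simp add: T_act_def scaleC_one)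

end

lemma T_minus_closed:
  "0 \<in> T_minus" "u \<in> T_minus \<Longrightarrow> u' \<in> T_minus \<Longrightarrow> u + u' \<in> T_minus" "u \<in> T_minus \<Longrightarrow> a *\<^sub>C u \<in> T_minus"
  by (auto simp: T_minus_def lookup_scaleC in_keys_iff dest!: subsetD[OF keys_add])

lemma keys_I_subst: "keys (I_subst a q) \<subseteq> I_word ` keys q"
  unfolding I_subst_def lin_ext_def
  by (rule order.trans[OF keys_sum_subset]) (auto simp: in_keys_iff lookup_scaleC lookup_single when_def split: if_splits)

lemma keys_T_mult_single: "keys (T_mult u (single w 1)) \<subseteq> (\<lambda>a. a @ w) ` keys u"
  unfolding T_mult_def lin_ext_single
  by (unfold lin_ext_def, rule order.trans[OF keys_sum_subset])
    (auto simp: in_keys_iff lookup_scaleC lookup_single when_def split: if_splits)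

definition Lambda_rep :: "complex \<Rightarrow> nat \<Rightarrow> ipoly \<Rightarrow> hv_tensor_alg" where
  "Lambda_rep c p x =
     (\<Sum>i<p. T_mult (I_subst c (schur i)) (single [L (int i - int p)] 1)) + I_subst 1 x"

lemma keys_Lambda_rep:
  assumes "weight_poly p x" "w \<in> keys (Lambda_rep c p x)"
  shows "list_all neg w \<and> word_weight w = - int p"
proof -
  have "w \<in> keys (\<Sum>i<p. T_mult (I_subst c (schur i)) (single [L (int i - int p)] 1)) \<union> keys (I_subst 1 x)"
    by (rule subsetD[OF keys_add assms(2)[unfolded Lambda_rep_def]])
  then show ?thesis
  proof
    assume "w \<in> keys (\<Sum>i<p. T_mult (I_subst c (schur i)) (single [L (int i - int p)] 1))"
    from subsetD[OF keys_sum_subset this]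
    obtain i where i: "i < p" "w \<in> keys (T_mult (I_subst c (schur i)) (single [L (int i - int p)] 1))"
      by blast
    then obtain m where "m \<in> keys (schur i)" "w = I_word m @ [L (int i - int p)]"
      using subsetD[OF keys_T_mult_single i(2)] keys_I_subst[of c "schur i"] by blast
    then show ?thesis
      using weight_poly_schur[of i] i by (auto simp: weight_poly_def neg_I_word word_weight_I_word)
  next
    assume "w \<in> keys (I_subst 1 x)"
    then show ?thesis
      using keys_I_subst[of 1 x] assms(1) by (auto simp: weight_poly_def neg_I_word word_weight_I_word)
  qed
qed

lemma Lambda_rep_T_minus: "weight_poly p x \<Longrightarrow> Lambda_rep c p x \<in> T_minus"
  using keys_Lambda_rep by (auto simp: T_minus_def)

lemma I_subst_T_minus: "weight_poly p x \<Longrightarrow> I_subst 1 x \<in> T_minus"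
  using keys_I_subst[of 1 x] by (auto simp: T_minus_def weight_poly_def neg_I_word)

lemma Lambda_eq: "Lambda c p x = abs_U_minus (Lambda_rep c p x)"
  by (simp add: Lambda_def Lambda_rep_def)

section \<open>Functionals on the Verma module\<close>

locale verma_mod = level_hw_mod +
  assumes verma: "verma_module \<rho> cL 0 c h hI v"
begin

lemma T_act_v_inj:
  assumes "u \<in> T_minus" "u' \<in> T_minus" "T_act \<rho> u v = T_act \<rho> u' v"
  shows "u - u' \<in> U_minus_ideal"
proof -
  have "inj (\<lambda>u. U_minus_act \<rho> u v)" using verma by (simp add: verma_module_def bij_def)
  moreover have "U_minus_act \<rho> (abs_U_minus u) v = U_minus_act \<rho> (abs_U_minus u') v"
    using assms by (simp add: U_minus_act_abs)
  ultimately have "abs_U_minus u = abs_U_minus u'" by (rule injD)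
  moreover have "U_minus_eq u u" "U_minus_eq u' u'"
    using assms by (simp_all add: U_minus_eq_def U_minus_ideal_closed)
  ultimately have "U_minus_eq u u'" using Quotient3_rel[OF Quotient3_U_minus] by metis
  then show ?thesis by (simp add: U_minus_eq_def)
qed

lemma T_act_v_surj: "\<exists>u. u \<in> T_minus \<and> T_act \<rho> u v = x"
proof -
  show ?thesis
    using in_word_span[of x] unfolding word_span_def
  proof (induction rule: cvec.span_induct_alt)
    case base
    show ?case by (rule exI[of _ 0]) (simp add: T_minus_closed clinear_zero[OF lin_T_act_left])
  next
    case (step a y z)
    then obtain w u where w: "y = foldr \<rho> w v" "list_all neg w" and u: "u \<in> T_minus" "T_act \<rho> u v = z" by blast
    have "single w a \<in> T_minus" using w by (simp add: T_minus_def)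
    then show ?case
      using w u by (intro exI[of _ "single w a + u"])
        (simp add: T_minus_closed clinear_add[OF lin_T_act_left])
  qed
qed

text \<open>Freeness over U(H^-) is used here, through \<open>T_act_v_inj\<close>: two
  representatives of a vector differ by an element of the ideal, on which \<open>g\<close>
  vanishes.\<close>

lemma functional_exists:
  assumes g: "\<And>u. u \<in> U_minus_ideal \<Longrightarrow> lin_ext g u = 0"
  shows "\<exists>f. clinear f \<and> (\<forall>u\<in>T_minus. f (T_act \<rho> u v) = (lin_ext g u :: complex))"
proof -
  define f where "f x = lin_ext g (SOME u. u \<in> T_minus \<and> T_act \<rho> u v = x)" for x
  have f: "f (T_act \<rho> u v) = lin_ext g u" if "u \<in> T_minus" for u
  proof -
    let ?u = "SOME u'. u' \<in> T_minus \<and> T_act \<rho> u' v = T_act \<rho> u v"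
    have "?u \<in> T_minus \<and> T_act \<rho> ?u v = T_act \<rho> u v" by (rule someI_ex) (use that in blast)
    then have "lin_ext g (?u - u) = 0" using that by (intro g T_act_v_inj) auto
    then show ?thesis by (simp add: f_def lin_ext_diff)
  qed
  have "clinear f"
  proof (rule clinearI)
    fix x y a
    obtain u u' where u: "u \<in> T_minus" "T_act \<rho> u v = x" "u' \<in> T_minus" "T_act \<rho> u' v = y"
      using T_act_v_surj by metis
    show "f (x + y) = f x + f y"
      using u f[of "u + u'"] f[of u] f[of u'] by (simp add: T_minus_closed clinear_add[OF lin_T_act_left] lin_ext_add)
    show "f (a *\<^sub>C x) = a *\<^sub>C f x"
      using u f[of "a *\<^sub>C u"] f[of u] by (simp add: T_minus_closed clinear_scale[OF lin_T_act_left] lin_ext_scale)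
  qed
  then show ?thesis using f by blast
qed

end

section \<open>Applying \<open>L(n)\<close> to the singular vector\<close>

text \<open>The value of the Schur polynomial S_r when every variable is -t. The generating series
  is then exp(-t (y + y^2/2 + ...)) = (1 - y)^t. The value 0 for negative r lets sums run past
  r.\<close>

definition schur_coeff :: "complex \<Rightarrow> int \<Rightarrow> complex" where
  "schur_coeff t r = (if r < 0 then 0 else (- 1) ^ nat r * (t gchoose nat r))"

lemma schur_coeff_simps [simp]:
  "r < 0 \<Longrightarrow> schur_coeff t r = 0" "schur_coeff t 0 = 1" "schur_coeff t (int n) = (- 1) ^ n * (t gchoose n)"
  by (simp_all add: schur_coeff_def)

text \<open>Coefficients in y d/dy (1 - y)^t = -t (y / (1 - y)) (1 - y)^t. Terms with k > r are 0,
  so any upper limit from r on will do.\<close>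

lemma schur_coeff_rec:
  assumes "int N \<ge> r"
  shows "of_int r * schur_coeff t r = - t * (\<Sum>k = 1..N. schur_coeff t (r - int k))"
proof (cases "r \<le> 0")
  case True
  then show ?thesis by (cases "r = 0") (auto intro!: sum.neutral)
next
  case False
  then obtain n where n: "r = int (Suc n)" by (metis not_le zero_less_imp_eq_int gr0_conv_Suc of_nat_0_less_iff)
  have "(\<Sum>k = 1..N. schur_coeff t (r - int k)) = (\<Sum>k = 1..Suc n. schur_coeff t (r - int k))"
    by (rule sum.mono_neutral_right) (use assms n in auto)
  also have "\<dots> = (\<Sum>j\<le>n. (t gchoose j) * (- 1) ^ j)"
    by (rule sum.reindex_bij_witness[of _ "\<lambda>j. Suc n - j" "\<lambda>k. Suc n - k"])
      (auto simp: n of_nat_diff[symmetric] mult.commute simp del: of_nat_Suc of_nat_diff)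
  also have "\<dots> = (- 1) ^ n * (t - 1 gchoose n)" by (rule gbinomial_sum_lower_neg)
  finally have "- t * (\<Sum>k = 1..N. schur_coeff t (r - int k)) = (- 1) ^ Suc n * (t * (t - 1 gchoose n))"
    by (simp add: algebra_simps)
  also have "t * (t - 1 gchoose n) = of_nat (Suc n) * (t gchoose Suc n)"
    using gbinomial_absorption[of n t] by simp
  finally show ?thesis by (simp add: n del: of_nat_Suc)
qed

lemma sum_split_at:
  fixes g :: "nat \<Rightarrow> complex"
  assumes "n > 0"
  shows "(\<Sum>k = 1..m + n. g k) = (\<Sum>k = 1..<n. g k) + g n + (\<Sum>k = 1..m. g (k + n))"
proof (induction m)
  case 0
  have "{1..n} = insert n {1..<n}" using assms by auto
  then show ?case by simp
next
  case (Suc m)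
  then show ?case by (simp add: add.assoc)
qed

lemma lin_ext_of_nat_mult: "lin_ext g (of_nat n * q) = of_nat n *\<^sub>C lin_ext g (q :: ipoly)"
proof -
  have "of_nat n * q = of_nat n *\<^sub>C q"
    unfolding of_nat_ipoly scaleC_poly_mapping_def scaleC_complex_def[abs_def]
    by (simp add: mult_map_scale_conv_mult)
  then show ?thesis by (simp add: lin_ext_scale)
qed

section \<open>Schur polynomials as operators and their commutators with L(n)\<close>

context level_hw_mod
begin

lemma T_act_I_subst_mult:
  "T_act \<rho> (I_subst c (single (single k 1) 1 * q)) x
    = (1 / c) *\<^sub>C \<rho> (I (- int k)) (T_act \<rho> (I_subst c q) x)"
proof -
  let ?g = "\<lambda>m. (1 / c ^ mono_degree m) *\<^sub>C foldr \<rho> (I_word m) x"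
  have sc: "a *\<^sub>C q = single 0 a * q" for a and q :: ipoly
    by (simp add: scaleC_poly_mapping_def scaleC_complex_def[abs_def] mult_map_scale_conv_mult)
  have l1: "clinear (\<lambda>q :: ipoly. lin_ext ?g (single (single k 1) 1 * q))"
  proof (rule clinearI)
    fix a and q :: ipoly
    have "single (single k 1) 1 * (a *\<^sub>C q) = a *\<^sub>C (single (single k 1) 1 * q)"
      by (simp only: sc mult.left_commute)
    then show "lin_ext ?g (single (single k 1) 1 * (a *\<^sub>C q))
        = a *\<^sub>C lin_ext ?g (single (single k 1) 1 * q)"
      by (simp only: lin_ext_scale)
  qed (simp only: distrib_left lin_ext_add)
  have l2: "clinear (\<lambda>q. (1 / c) *\<^sub>C \<rho> (I (- int k)) (lin_ext ?g q))"
    by (rule clinearI) (simp_all add: lin_ext_add lin_ext_scale add scale scaleC_add_right mult.commute)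
  have perm: "foldr \<rho> (I_word (single k 1 + m)) x = \<rho> (I (- int k)) (foldr \<rho> (I_word m) x)" for m
  proof -
    have "fold \<rho> (rev (I_word (single k 1 + m))) = fold \<rho> (rev (I (- int k) # I_word m))"
    proof (rule fold_multiset_equiv)
      fix a b assume "a \<in> set (rev (I_word (single k 1 + m)))" "b \<in> set (rev (I_word (single k 1 + m)))"
      then obtain i j where "a = I i" "b = I j" by (auto simp: set_I_word)
      then show "\<rho> a \<circ> \<rho> b = \<rho> b \<circ> \<rho> a" by (simp add: fun_eq_iff comm_I[of i j])
    next
      show "mset (rev (I_word (single k 1 + m))) = mset (rev (I (- int k) # I_word m))"
        unfolding mset_rev mset_I_word_add mset_I_word_single by simp
    qed
    then show ?thesis by (simp add: foldr_conv_fold)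
  qed
  show ?thesis
    unfolding T_act_I_subst
    by (subst clinear_eq_lin_ext[OF l1], subst clinear_eq_lin_ext[OF l2])
      (simp add: mult_single perm[simplified] mono_degree_add_single[simplified] scale scaleC_one)
qed

definition S :: "int \<Rightarrow> 'v \<Rightarrow> 'v" where
  "S r x = (if r < 0 then 0 else T_act \<rho> (I_subst c (schur (nat r))) x)"

lemma S_neg [simp]: "r < 0 \<Longrightarrow> S r x = 0"
  by (simp add: S_def)

lemma S_0 [simp]: "S 0 x = x"
proof -
  have "mono_degree 0 = 0" "I_word 0 = []" by (simp_all add: mono_degree_def I_word_def)
  moreover have "schur 0 = single 0 1" by (simp add: schur_0)
  ultimately show ?thesis by (simp add: S_def T_act_I_subst scaleC_one del: single_one)
qed

lemma S_rec:
  assumes "int N \<ge> r"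
  shows "of_int r *\<^sub>C S r x = (\<Sum>k = 1..N. (1 / c) *\<^sub>C \<rho> (I (- int k)) (S (r - int k) x))"
proof (cases "r < 0")
  case True
  then show ?thesis by (auto intro!: sum.neutral[symmetric])
next
  case False
  then obtain n where n: "r = int n" by (metis nonneg_int_cases not_less)
  have "of_int r *\<^sub>C S r x = T_act \<rho> (I_subst c (of_nat n * schur n)) x"
    unfolding T_act_I_subst lin_ext_of_nat_mult by (simp add: n S_def T_act_I_subst)
  also have "\<dots> = (\<Sum>k = 1..n. T_act \<rho> (I_subst c (single (single k 1) 1 * schur (n - k))) x)"
    unfolding schur_rec T_act_I_subst clinear_sum[OF clinear_lin_ext] ..
  also have "\<dots> = (\<Sum>k = 1..n. (1 / c) *\<^sub>C \<rho> (I (- int k)) (S (r - int k) x))"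
    by (rule sum.cong[OF refl], subst T_act_I_subst_mult) (auto simp: S_def n nat_diff_distrib')
  also have "\<dots> = (\<Sum>k = 1..N. (1 / c) *\<^sub>C \<rho> (I (- int k)) (S (r - int k) x))"
    by (rule sum.mono_neutral_left) (use assms n in auto)
  finally show ?thesis .
qed

lemma I_S: "\<rho> (I m) (S r x) = S r (\<rho> (I m) x)"
proof (cases "r < 0")
  case False
  have "foldr \<rho> (I_word w) (\<rho> (I m) x) = \<rho> (I m) (foldr \<rho> (I_word w) x)" for w
  proof -
    have "set u \<subseteq> range I \<Longrightarrow> foldr \<rho> u (\<rho> (I m) x) = \<rho> (I m) (foldr \<rho> u x)" for u
      by (induction u) (auto simp: comm_I[of m])
    moreover have "set (I_word w) \<subseteq> range I" by (auto simp: set_I_word)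
    ultimately show ?thesis .
  qed
  then show ?thesis using False
    by (simp add: S_def T_act_I_subst clinear_lin_ext_compose[OF lin] scale)
qed simp

lemma S_in_words:
  assumes U: "cvec.subspace U" and "r \<ge> 0"
    and w: "\<And>a. list_all neg a \<Longrightarrow> L_num a = 0 \<Longrightarrow> set a \<subseteq> range I \<Longrightarrow> foldr \<rho> (a @ w) v \<in> U"
  shows "S r (foldr \<rho> w v) \<in> U"
proof -
  have "S r (foldr \<rho> w v) = lin_ext (\<lambda>m. (1 / c ^ mono_degree m) *\<^sub>C foldr \<rho> (I_word m @ w) v) (schur (nat r))"
    using assms(2) by (simp add: S_def T_act_I_subst)
  also have "\<dots> \<in> U"
  proof (intro lin_ext_in_subspace[OF U] cvec.subspace_scale[OF U] w)
    fix m assume "m \<in> keys (schur (nat r))"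
    then show "list_all neg (I_word m)"
      using weight_poly_schur[of "nat r"] by (auto simp: weight_poly_def neg_I_word)
  qed (auto simp: L_num_I_word set_I_word)
  finally show ?thesis .
qed

lemma T_act_Lambda_rep:
  "T_act \<rho> (Lambda_rep c p x) v = (\<Sum>i<p. S (int i) (\<rho> (L (int i - int p)) v)) + T_act \<rho> (I_subst 1 x) v"
  unfolding Lambda_rep_def clinear_add[OF lin_T_act_left] clinear_sum[OF lin_T_act_left] T_act_T_mult
  by (simp add: S_def)

text \<open>The term i = 0 of \<Lambda> is L(-p) v itself, since S_0 = 1. The other terms contain
  only L(i - p) with i > 0, or no L at all.\<close>

lemma L_p_reduced:
  assumes x: "weight_poly p x" and Y: "T_act \<rho> (Lambda_rep c p x) v \<in> Y"
  shows "\<rho> (L (- int p)) v \<in> reduced_span Y 1 (p - 1)"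
proof -
  let ?R = "reduced_span Y 1 (p - 1)"
  have "(\<Sum>i<p. S (int i) (\<rho> (L (int i - int p)) v)) = \<rho> (L (- int p)) v + (\<Sum>i\<in>{..<p} - {0}. S (int i) (\<rho> (L (int i - int p)) v))"
    using p by (subst sum.remove[of _ 0]) auto
  then have e: "\<rho> (L (- int p)) v = T_act \<rho> (Lambda_rep c p x) v - (\<Sum>i\<in>{..<p} - {0}. S (int i) (\<rho> (L (int i - int p)) v)) - T_act \<rho> (I_subst 1 x) v"
    by (simp add: T_act_Lambda_rep)
  have 1: "S (int i) (\<rho> (L (int i - int p)) v) \<in> ?R" if i: "i \<in> {..<p} - {0}" for i
  proof -
    have "S (int i) (foldr \<rho> [L (int i - int p)] v) \<in> ?R"
    proof (rule S_in_words[OF subspace_reduced_span])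
      fix a assume a: "list_all neg a" "L_num a = 0" "set a \<subseteq> range I"
      then have "L_parts_le (p - 1) (a @ [L (int i - int p)])" using i by (auto simp: L_parts_le_def)
      then show "foldr \<rho> (a @ [L (int i - int p)]) v \<in> ?R"
        using a i by (intro reduced_span_base(2)) (auto simp: low_word_def)
    qed simp
    then show ?thesis by simp
  qed
  have 2: "T_act \<rho> (I_subst 1 x) v \<in> ?R"
    unfolding T_act_I_subst
    by (intro lin_ext_in_subspace[OF subspace_reduced_span] cvec.subspace_scale[OF subspace_reduced_span] reduced_span_base(2))
      (use x in \<open>auto simp: weight_poly_def neg_I_word L_num_I_word low_word_def\<close>)
  show ?thesis
    unfolding e by (intro subspace_closed[OF subspace_reduced_span]
      reduced_span_base(1) Y 1 2)
qed

context
  fixes f :: "'v \<Rightarrow> complex" and F :: complex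
  assumes lf: "clinear f" and fI: "\<And>j x. j > 0 \<Longrightarrow> f (\<rho> (I (- int j)) x) = - F * f x"
begin

lemma functional_sc: "f (a *\<^sub>C x) = a * f x"
  by (simp add: clinear_scale[OF lf] scaleC_complex_def)

lemma functional_S: "f (S r x) = schur_coeff (F / c) r * f x"
proof (cases "r < 0")
  case False
  then obtain n where "r = int n" by (metis nonneg_int_cases not_less)
  moreover have "f (S (int n) x) = schur_coeff (F / c) (int n) * f x"
  proof (induction n rule: less_induct)
    case (less n)
    show ?case
    proof (cases "n = 0")
      case False
      have "of_nat n * f (S (int n) x) = f (of_int (int n) *\<^sub>C S (int n) x)" by (simp add: functional_sc)
      also have "\<dots> = (\<Sum>k = 1..n. (1 / c) * (- F * f (S (int n - int k) x)))"
        by (subst S_rec[of "int n" n]) (simp_all add: clinear_sum[OF lf] functional_sc fI)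
      also have "\<dots> = (\<Sum>k = 1..n. (1 / c) * (- F * (schur_coeff (F / c) (int n - int k) * f x)))"
      proof (rule sum.cong[OF refl])
        fix k assume "k \<in> {1..n}"
        then show "(1 / c) * (- F * f (S (int n - int k) x)) = (1 / c) * (- F * (schur_coeff (F / c) (int n - int k) * f x))"
          using less[of "n - k"] by (simp add: of_nat_diff del: schur_coeff_simps(3))
      qed
      also have "\<dots> = (- (F / c) * (\<Sum>k = 1..n. schur_coeff (F / c) (int n - int k))) * f x"
        by (simp add: sum_distrib_left sum_distrib_right mult_ac)
      also have "\<dots> = of_nat n * (schur_coeff (F / c) (int n) * f x)"
        by (subst schur_coeff_rec[symmetric]) (simp_all del: schur_coeff_simps)
      finally show ?thesis using False by simp
    qed simp
  qed
  ultimately show ?thesis by simp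
qed (simp add: clinear_zero[OF lf])

text \<open>The commutator of \<open>L(n)\<close> with \<open>S r\<close> is
  \<open>(r - 2 n - p) S (r - n) + c\<^sup>-\<^sup>1 (\<Sum>0<k<n. S (r - k) I(n - k))\<close>.\<close>

lemma functional_L_S:
  assumes n: "n > 0"
  shows "f (\<rho> (L (int n)) (S r y)) = schur_coeff (F / c) r * f (\<rho> (L (int n)) y)
    + (of_int r - 2 * of_nat n - of_nat p) * schur_coeff (F / c) (r - int n) * f y
    + (\<Sum>k = 1..<n. 1 / c * schur_coeff (F / c) (r - int k) * f (\<rho> (I (int n - int k)) y))"
    (is "?g r = ?R r")
proof -
  let ?s = "schur_coeff (F / c)"
  define t where "t = F / c"
  have neg: "?g r = ?R r" if "r < 0" for r
    using that n by (simp add: clinear_zero[OF lf])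
  have zero: "?g 0 = ?R 0" using n by simp
  have "?g (int i) = ?R (int i)" for i
  proof (induction i rule: less_induct)
    case (less i)
    show ?case
    proof (cases "i = 0")
      case True
      then show ?thesis using zero by simp
    next
      case False
      let ?r = "int i"
      let ?A = "f (\<rho> (L (int n)) y)" and ?B = "f y" and ?C = "\<lambda>k. f (\<rho> (I (int n - int k)) y)"
      \<comment> \<open>The contribution of [L(n), I(-k)]: a scalar for k = n, a positive I(n - k)
        that commutes with S for k < n, and a negative one, hence the factor -F, for k > n.\<close>
      define z where "z k = (if k = n then - (of_nat n * (of_nat n + of_nat p)) * ?s (?r - int n) * ?B
        else if k < n then of_nat k / c * ?s (?r - int k) * ?C k
        else - t * (of_nat k * ?s (?r - int k)) * ?B)" for k
      have step: "(1 / c) * f (\<rho> (L (int n)) (\<rho> (I (- int k)) (S (?r - int k) y))) = - t * ?g (?r - int k) + z k"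
        if "k \<ge> 1" for k
      proof -
        have 1: "f (\<rho> (I (- int k)) (\<rho> (L (int n)) (S (?r - int k) y))) = - F * ?g (?r - int k)"
          by (rule fI) (use that in simp)
        consider "k = n" | "k < n" | "k > n" by linarith
        then show ?thesis
        proof cases
          case k: 1
          have e: "f (\<rho> (L (int n)) (\<rho> (I (- int k)) (S (?r - int k) y)))
              = - F * ?g (?r - int k) + - (of_nat n * c * (of_nat n + of_nat p)) * (?s (?r - int n) * f y)"
            unfolding L_I clinear_add[OF lf] 1 by (simp add: k functional_sc functional_S del: cvec.scale_minus_left)
          show ?thesis unfolding e using c by (simp add: k z_def t_def field_simps)
        next
          case k: 2
          show ?thesis using 1 c k
            by (subst L_I) (simp add: clinear_add[OF lf] functional_sc functional_S z_def t_def I_S field_simps)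
        next
          case k: 3
          have "f (\<rho> (I (int n - int k)) (S (?r - int k) y)) = - F * (?s (?r - int k) * f y)"
            using fI[of "k - n" "S (?r - int k) y"] k by (simp add: functional_S of_nat_diff)
          then show ?thesis using 1 c k
            by (subst L_I) (simp add: clinear_add[OF lf] functional_sc z_def t_def field_simps)
        qed
      qed
      have IH: "?g (?r - int k) = ?R (?r - int k)" if "k \<ge> 1" for k
      proof (cases "k \<le> i")
        case True
        then show ?thesis using less[of "i - k"] that by (simp add: of_nat_diff del: schur_coeff_simps(3))
      next
        case False
        then show ?thesis by (intro neg) simp
      qed
      \<comment> \<open>This limit is beyond i, and after splitting at k = n the upper part still
        has i terms, as many as the recursion at i - n needs.\<close>
      let ?N = "i + n"
      have "of_nat i * ?g ?r = f (\<rho> (L (int n)) (of_int ?r *\<^sub>C S ?r y))" by (simp add: scale functional_sc)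
      also have "\<dots> = (\<Sum>k = 1..?N. (1 / c) * f (\<rho> (L (int n)) (\<rho> (I (- int k)) (S (?r - int k) y))))"
        by (subst S_rec[of ?r ?N]) (simp_all add: sum clinear_sum[OF lf] scale functional_sc)
      also have "\<dots> = (\<Sum>k = 1..?N. - t * ?R (?r - int k) + z k)"
        by (rule sum.cong[OF refl], subst step) (auto simp: IH)
      also have "\<dots> = (\<Sum>k = 1..?N. - t * ?s (?r - int k)) * ?A
          + (\<Sum>k = 1..?N. - t * ((of_nat i - of_nat k - 2 * of_nat n - of_nat p) * ?s (?r - int n - int k))) * ?B
          + (\<Sum>l = 1..<n. (1 / c) * (\<Sum>k = 1..?N. - t * ?s (?r - int l - int k)) * ?C l)
          + (\<Sum>k = 1..?N. z k)"
      proof -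
        have "(\<Sum>k = 1..?N. \<Sum>l = 1..<n. - t * (1 / c * ?s (?r - int k - int l) * ?C l))
            = (\<Sum>l = 1..<n. \<Sum>k = 1..?N. - t * (1 / c * ?s (?r - int k - int l) * ?C l))"
          by (rule sum.swap)
        also have "\<dots> = (\<Sum>l = 1..<n. (1 / c) * (\<Sum>k = 1..?N. - t * ?s (?r - int l - int k)) * ?C l)"
        proof (rule sum.cong[OF refl])
          fix l
          have e: "?r - int k - int l = ?r - int l - int k" for k by simp
          show "(\<Sum>k = 1..?N. - t * (1 / c * ?s (?r - int k - int l) * ?C l)) = (1 / c) * (\<Sum>k = 1..?N. - t * ?s (?r - int l - int k)) * ?C l"
            unfolding e sum_distrib_left sum_distrib_right by (rule sum.cong[OF refl]) (simp add: mult_ac)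
        qed
        finally have sw: "(\<Sum>k = 1..?N. \<Sum>l = 1..<n. - t * (1 / c * ?s (?r - int k - int l) * ?C l))
          = (\<Sum>l = 1..<n. (1 / c) * (\<Sum>k = 1..?N. - t * ?s (?r - int l - int k)) * ?C l)" .
        have e: "?r - int k - int n = ?r - int n - int k" for k by simp
        show ?thesis
          unfolding sw[symmetric] sum_distrib_right sum.distrib[symmetric] sum_distrib_left[of "- t"] distrib_left e
          by (rule sum.cong[OF refl]) (simp add: algebra_simps)
      qed
      also have "(\<Sum>k = 1..?N. - t * ?s (?r - int k)) = of_nat i * ?s ?r"
        using schur_coeff_rec[of ?r ?N "F / c"] by (simp add: t_def sum_distrib_left del: schur_coeff_simps)
      also have "(\<Sum>l = 1..<n. (1 / c) * (\<Sum>k = 1..?N. - t * ?s (?r - int l - int k)) * ?C l)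
          = (\<Sum>l = 1..<n. (1 / c) * ((of_nat i - of_nat l) * ?s (?r - int l)) * ?C l)"
      proof (rule sum.cong[OF refl])
        fix l
        show "(1 / c) * (\<Sum>k = 1..?N. - t * ?s (?r - int l - int k)) * ?C l = (1 / c) * ((of_nat i - of_nat l) * ?s (?r - int l)) * ?C l"
          using schur_coeff_rec[of "?r - int l" ?N "F / c"] by (simp add: t_def sum_distrib_left del: schur_coeff_simps)
      qed
      also have "(\<Sum>k = 1..?N. - t * ((of_nat i - of_nat k - 2 * of_nat n - of_nat p) * ?s (?r - int n - int k)))
          = (\<Sum>k = 1..i. - t * ((of_nat i - of_nat k - 2 * of_nat n - of_nat p) * ?s (?r - int n - int k)))"
        by (rule sum.mono_neutral_right) auto
      also have "(\<Sum>k = 1..?N. z k) = (\<Sum>k = 1..<n. of_nat k / c * ?s (?r - int k) * ?C k)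
          - of_nat n * (of_nat n + of_nat p) * ?s (?r - int n) * ?B
          + (\<Sum>k = 1..i. - t * ((of_nat k + of_nat n) * ?s (?r - int n - int k))) * ?B"
      proof -
        have e: "?r - (int k + int n) = ?r - int n - int k" for k by simp
        show ?thesis
          unfolding sum_split_at[OF n, of z i] sum_distrib_right
          by (intro arg_cong2[of _ _ _ _ "(+)"] sum.cong refl) (auto simp: z_def e)
      qed
      also have "of_nat i * ?s ?r * ?A
          + (\<Sum>k = 1..i. - t * ((of_nat i - of_nat k - 2 * of_nat n - of_nat p) * ?s (?r - int n - int k))) * ?B
          + (\<Sum>l = 1..<n. (1 / c) * ((of_nat i - of_nat l) * ?s (?r - int l)) * ?C l)
          + ((\<Sum>k = 1..<n. of_nat k / c * ?s (?r - int k) * ?C k)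
          - of_nat n * (of_nat n + of_nat p) * ?s (?r - int n) * ?B
          + (\<Sum>k = 1..i. - t * ((of_nat k + of_nat n) * ?s (?r - int n - int k))) * ?B)
        = of_nat i * ?s ?r * ?A
          + ((of_nat i - of_nat n - of_nat p) * (- t * (\<Sum>k = 1..i. ?s (?r - int n - int k))) - of_nat n * (of_nat n + of_nat p) * ?s (?r - int n)) * ?B
          + of_nat i * (\<Sum>l = 1..<n. 1 / c * ?s (?r - int l) * ?C l)"
      \<comment> \<open>The weights i - k - 2n - p and k + n add up to i - n - p, independent of k,
        so the recursion for the coefficients sums the series. Similarly (i - l) + l = i in the sum
        over the I(n - l).\<close>
      proof -
        have 1: "(\<Sum>k = 1..i. - t * ((of_nat i - of_nat k - 2 * of_nat n - of_nat p) * ?s (?r - int n - int k)))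
            + (\<Sum>k = 1..i. - t * ((of_nat k + of_nat n) * ?s (?r - int n - int k)))
            = (of_nat i - of_nat n - of_nat p) * (- t * (\<Sum>k = 1..i. ?s (?r - int n - int k)))"
          unfolding sum.distrib[symmetric] sum_distrib_left by (rule sum.cong[OF refl]) (simp add: algebra_simps)
        have 2: "(\<Sum>l = 1..<n. (1 / c) * ((of_nat i - of_nat l) * ?s (?r - int l)) * ?C l)
          + (\<Sum>k = 1..<n. of_nat k / c * ?s (?r - int k) * ?C k) = of_nat i * (\<Sum>l = 1..<n. 1 / c * ?s (?r - int l) * ?C l)"
          unfolding sum.distrib[symmetric] sum_distrib_left by (rule sum.cong[OF refl]) (simp add: algebra_simps diff_divide_distrib)
        show ?thesis unfolding 1[symmetric] 2[symmetric] by (simp only: algebra_simps)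
      qed
      also have "- t * (\<Sum>k = 1..i. ?s (?r - int n - int k)) = (of_nat i - of_nat n) * ?s (?r - int n)"
        using schur_coeff_rec[of "?r - int n" i "F / c"] by (simp add: t_def del: schur_coeff_simps)
      also have "of_nat i * ?s ?r * ?A
          + ((of_nat i - of_nat n - of_nat p) * ((of_nat i - of_nat n) * ?s (?r - int n)) - of_nat n * (of_nat n + of_nat p) * ?s (?r - int n)) * ?B
          + of_nat i * (\<Sum>l = 1..<n. 1 / c * ?s (?r - int l) * ?C l) = of_nat i * ?R ?r"
        by (simp add: algebra_simps del: schur_coeff_simps)
      finally show ?thesis using False by (simp only: mult_cancel_left of_nat_eq_0_iff) simp
    qed
  qed
  then show ?thesis using neg[of r] by (cases "r < 0") (auto elim: nonneg_int_cases simp: not_less)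
qed

end

end

section \<open>The recursion for \<open>g\<^sub>p\<close>\<close>

lemma half_eqI: "2 * a = b \<Longrightarrow> a = b / (2 :: complex)"
  by auto

lemma sum_k_times_n_minus_k: "(\<Sum>k = 1..<n. of_nat k * (of_nat n - of_nat k)) = (of_nat n ^ 3 - of_nat n) / (6 :: complex)"
proof (induction n)
  case (Suc n)
  have g: "(\<Sum>k = 1..<Suc n. of_nat k) = of_nat n * (of_nat n + 1) / (2 :: complex)"
    by (induction n) (auto simp: field_simps)
  have "(\<Sum>k = 1..<Suc n. of_nat k * (of_nat (Suc n) - of_nat k)) =
      (\<Sum>k = 1..<Suc n. of_nat k * (of_nat n - of_nat k)) + (\<Sum>k = 1..<Suc n. of_nat k :: complex)"
    unfolding sum.distrib[symmetric] by (rule sum.cong) (auto simp: algebra_simps)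
  also have "(\<Sum>k = 1..<Suc n. of_nat k * (of_nat n - of_nat k)) = (\<Sum>k = 1..<n. of_nat k * (of_nat n - of_nat k) :: complex)"
    by (cases "n = 0") auto
  also have "\<dots> = (of_nat n ^ 3 - of_nat n) / 6" by (rule Suc.IH)
  finally show ?case by (simp only: g) (simp add: field_simps power3_eq_cube)
qed simp

text \<open>With \<open>n = p - r\<close>, the ansatz \<open>H (n - 1) = (-1)\<^sup>r (T - 1 choose r) A r\<close> turns the recursion into an
  equation for \<open>A\<close> with a quadratic polynomial as solution. It breaks down for \<open>T = 1\<close>.\<close>

lemma recursion_vanishes:
  fixes H :: "nat \<Rightarrow> complex" and q \<kappa> :: complex
  assumes T: "2 \<le> T" "T < p" and Hp: "H p = 0"
    and rec: "\<And>n. 1 \<le> n \<Longrightarrow> n \<le> p \<Longrightarrow>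
      of_nat T * (schur_coeff (of_nat T) (int p - int n) * (of_nat n * (q + \<kappa> * of_nat n ^ 2))) + of_nat T * H n
        + (of_nat n + of_nat p) * (H (n - 1) - H n) = 0"
  shows "H 0 = 0"
proof -
  define t :: complex where "t = of_nat T"
  define P :: complex where "P = of_nat p"
  \<comment> \<open>Forced by the cubic terms of \<open>poly\<close>, which give M (t - 1) = t^2
    \<kappa>.\<close>
  define M where "M = t ^ 2 * \<kappa> / (t - 1)"
  have t1: "t - 1 \<noteq> 0" using T by (simp add: t_def)
  then have M: "M * (t - 1) = t ^ 2 * \<kappa>" by (simp add: M_def)
  define A where "A x = (- t * (q + \<kappa> * P ^ 2) + M * x * (2 * P - 1 - x)) / 2" for x
  have A2: "2 * A y = - t * (q + \<kappa> * P ^ 2) + M * y * (2 * P - 1 - y)" for y by (simp add: A_def)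
  have poly: "(2 * P - x) * (t - x) * A x + (2 * P - x - t) * x * A (x - 1) = - (t ^ 2) * (P - x) * (q + \<kappa> * (P - x) ^ 2)" for x
  proof -
    have "2 * ((2 * P - x) * (t - x) * A x + (2 * P - x - t) * x * A (x - 1)) =
       (2 * P - x) * (t - x) * (2 * A x) + (2 * P - x - t) * x * (2 * A (x - 1))" by algebra
    also have "\<dots> =
       (2 * P - x) * (t - x) * (- t * (q + \<kappa> * P ^ 2) + M * x * (2 * P - 1 - x))
       + (2 * P - x - t) * x * (- t * (q + \<kappa> * P ^ 2) + M * (x - 1) * (2 * P - 1 - (x - 1)))"
      by (simp only: A2)
    also have "\<dots> = 2 * (- (t ^ 2) * (P - x) * (q + \<kappa> * (P - x) ^ 2))"
      using M by algebra
    finally show ?thesis unfolding mult_cancel_left by simp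
  qed
  have claim: "r < p \<Longrightarrow> H (p - r - 1) = (- 1) ^ r * (t - 1 gchoose r) * A (of_nat r)" for r
  proof (induction r)
    case 0
    have "t * (P * (q + \<kappa> * P ^ 2)) + 2 * P * H (p - 1) = 0"
      using rec[of p] 0 by (simp add: Hp t_def P_def algebra_simps)
    then have "P * (t * (q + \<kappa> * P ^ 2) + 2 * H (p - 1)) = 0" by (simp add: algebra_simps)
    moreover have "P \<noteq> 0" using 0 by (simp add: P_def)
    ultimately have "t * (q + \<kappa> * P ^ 2) + 2 * H (p - 1) = 0" by simp
    then have "2 * H (p - 1) = - (t * (q + \<kappa> * P ^ 2))" by (simp add: eq_neg_iff_add_eq_0 add.commute)
    from half_eqI[OF this] show ?case by (simp add: A_def)
  next
    case (Suc r)
    define n where "n = p - Suc r"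
    define x :: complex where "x = of_nat (Suc r)"
    have n: "1 \<le> n" "n \<le> p" "p - Suc r - 1 = n - 1" "H n = (- 1) ^ r * (t - 1 gchoose r) * A (x - 1)"
      "int p - int n = int (Suc r)" "(of_nat n :: complex) = P - x"
      using Suc by (auto simp: n_def x_def P_def of_nat_diff)
    have a1: "x * (t gchoose Suc r) = t * (t - 1 gchoose r)"
      using gbinomial_absorption[of r t] by (simp add: x_def)
    have a2: "(t - x) * (t gchoose Suc r) = t * (t - 1 gchoose Suc r)"
      using gbinomial_absorb_comp[of t "Suc r"] by (simp add: x_def)
    have "t * ((- 1) ^ Suc r * (t gchoose Suc r) * ((P - x) * (q + \<kappa> * (P - x) ^ 2))) + t * H n
        + (2 * P - x) * (H (n - 1) - H n) = 0"
      using rec[OF n(1,2)] unfolding n(5) schur_coeff_simps n(6) by (simp add: t_def P_def algebra_simps)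
    moreover have "t * (g * ((P - x) * Q)) + t * y + (2 * P - x) * (z - y) = 0 \<Longrightarrow>
        t * ((2 * P - x) * z) = (2 * P - x - t) * (t * y) + (- (t ^ 2) * (P - x) * Q) * g" for g Q y z
      by algebra
    ultimately have "t * ((2 * P - x) * H (n - 1)) = (2 * P - x - t) * (t * H n) + (- (t ^ 2) * (P - x) * (q + \<kappa> * (P - x) ^ 2)) * ((- 1) ^ Suc r * (t gchoose Suc r))"
      by blast
    also have "t * H n = - ((- 1) ^ Suc r * (x * (t gchoose Suc r))) * A (x - 1)"
      unfolding n(4) a1 by (simp add: mult_ac)
    also have "(2 * P - x - t) * (- ((- 1) ^ Suc r * (x * (t gchoose Suc r))) * A (x - 1)) + (- (t ^ 2) * (P - x) * (q + \<kappa> * (P - x) ^ 2)) * ((- 1) ^ Suc r * (t gchoose Suc r))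
        = (2 * P - x) * ((- 1) ^ Suc r * ((t - x) * (t gchoose Suc r)) * A x)"
      unfolding poly[symmetric] by (simp add: algebra_simps)
    finally have "t * (2 * P - x) * H (n - 1) = t * (2 * P - x) * ((- 1) ^ Suc r * (t - 1 gchoose Suc r) * A x)"
      unfolding a2 by (simp add: mult_ac)
    \<comment> \<open>This is n + p, the coefficient of \<open>H (n - 1)\<close> in the
      recursion.\<close>
    moreover have "2 * P - x \<noteq> 0"
    proof -
      have "2 * P - x = of_nat (2 * p - Suc r)" using Suc.prems by (simp add: P_def x_def of_nat_diff)
      then show ?thesis using Suc.prems by (simp only: of_nat_eq_0_iff)
    qed
    moreover have "t \<noteq> 0" using T by (simp add: t_def)
    ultimately have "H (n - 1) = (- 1) ^ Suc r * (t - 1 gchoose Suc r) * A x"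
      unfolding mult_cancel_left mult_eq_0_iff by blast
    then show ?case unfolding n(3) x_def .
  qed
  \<comment> \<open>The bound T < p enters: \<open>H 0\<close> is a multiple of this binomial, which
    would be 1 for T = p.\<close>
  have "(t - 1 gchoose (p - 1)) = of_nat ((T - 1) choose (p - 1))"
    using T by (simp add: t_def of_nat_diff binomial_gbinomial)
  also have "(T - 1) choose (p - 1) = 0" using T by (intro binomial_eq_0) auto
  finally show ?thesis using claim[of "p - 1"] T by simp
qed

text \<open>For t = 1 the series (1 - y)^t is 1 - y, so the inhomogeneous term is present only for n
  = p and n = p - 1. After these two steps \<open>q\<close> has cancelled, H(m) = -\<kappa> (m + p)
  / 2, and the homogeneous recursion keeps this form down to m = 0.\<close>

lemma recursion_at_1:
  fixes H :: "nat \<Rightarrow> complex" and q \<kappa> :: complex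
  assumes p: "1 < p" and Hp: "H p = 0"
    and rec: "\<And>n. 1 \<le> n \<Longrightarrow> n \<le> p \<Longrightarrow>
      1 * (schur_coeff 1 (int p - int n) * (of_nat n * (q + \<kappa> * of_nat n ^ 2))) + 1 * H n
        + (of_nat n + of_nat p) * (H (n - 1) - H n) = 0"
  shows "H 0 = - \<kappa> * of_nat p / 2"
proof -
  define P :: complex where "P = of_nat p"
  have P: "P \<noteq> 0" using p by (simp add: P_def)
  have "P * (q + \<kappa> * P ^ 2) + 2 * P * H (p - 1) = 0"
    using rec[of p] p by (simp add: Hp P_def algebra_simps)
  then have "P * (q + \<kappa> * P ^ 2 + 2 * H (p - 1)) = 0" by (simp add: algebra_simps)
  then have "q + \<kappa> * P ^ 2 + 2 * H (p - 1) = 0" using P by (simp only: mult_eq_0_iff simp_thms)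
  then have "2 * H (p - 1) = - (q + \<kappa> * P ^ 2)" by algebra
  then have H1: "H (p - 1) = - (q + \<kappa> * P ^ 2) / 2" by (simp add: eq_divide_eq mult.commute)
  have claim: "Suc r < p \<Longrightarrow> H (p - Suc r - 1) = - \<kappa> * (2 * P - of_nat r - 2) / 2" for r
  proof (induction r)
    case 0
    have nz: "2 * P - 1 \<noteq> 0"
    proof -
      have "2 * P - 1 = of_nat (2 * p - 1)" using p by (simp add: P_def of_nat_diff)
      then show ?thesis using p by (simp only: of_nat_eq_0_iff)
    qed
    have "int p - int (p - 1) = int 1" using p by simp
    then have s: "schur_coeff 1 (int p - int (p - 1)) = - 1" by (simp only: schur_coeff_simps) simp
    have "- ((P - 1) * (q + \<kappa> * (P - 1) ^ 2)) + H (p - 1) + (2 * P - 1) * (H (p - 1 - 1) - H (p - 1)) = 0"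
      using rec[of "p - 1"] p unfolding s by (simp add: P_def of_nat_diff algebra_simps)
    then have "(2 * P - 1) * (2 * H (p - 1 - 1) + \<kappa> * (2 * P - 2)) = 0"
      unfolding H1 by (simp add: field_simps) algebra
    then have "2 * H (p - 1 - 1) + \<kappa> * (2 * P - 2) = 0" using nz by simp
    then have "2 * H (p - 1 - 1) = - \<kappa> * (2 * P - 2)" by (simp add: eq_neg_iff_add_eq_0)
    from half_eqI[OF this] show ?case by simp
  next
    case (Suc r)
    define n where "n = p - Suc (Suc r)"
    define x :: complex where "x = of_nat r + 2"
    have n: "1 \<le> n" "n \<le> p" "p - Suc (Suc r) - 1 = n - 1" "H n = - \<kappa> * (2 * P - x) / 2"
      "int p - int n = int (Suc (Suc r))" "(of_nat n :: complex) = P - x"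
      using Suc by (auto simp: n_def x_def P_def of_nat_diff algebra_simps)
    have "(1 :: complex) gchoose Suc (Suc r) = of_nat (1 choose Suc (Suc r))" by (simp only: binomial_gbinomial of_nat_1)
    then have s: "schur_coeff 1 (int p - int n) = 0" unfolding n(5) schur_coeff_simps by simp
    have "H n + (2 * P - x) * (H (n - 1) - H n) = 0"
      using rec[OF n(1,2)] unfolding s n(6) by (simp add: P_def algebra_simps)
    moreover have "2 * H n = - \<kappa> * (2 * P - x)" unfolding n(4) by simp
    ultimately have e: "2 * ((2 * P - x) * H (n - 1)) = (2 * P - x) * (- \<kappa> * (2 * P - x - 1))"
      by algebra
    have "2 * P - x \<noteq> 0"
    proof -
      have "2 * P - x = of_nat (2 * p - (r + 2))" using Suc.prems by (simp add: P_def x_def of_nat_diff)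
      then show ?thesis using Suc.prems by (simp only: of_nat_eq_0_iff)
    qed
    then have "2 * H (n - 1) = - \<kappa> * (2 * P - x - 1)" using e unfolding mult.left_commute[of 2] mult_cancel_left by blast
    then have "H (n - 1) = - \<kappa> * (2 * P - x - 1) / 2" by (rule half_eqI)
    then show ?case unfolding n(3) by (simp add: x_def algebra_simps)
  qed
  have "p - Suc (p - 2) - 1 = 0" "Suc (p - 2) < p" "2 * P - of_nat (p - 2) - 2 = of_nat p"
    using p by (auto simp: P_def of_nat_diff)
  then show ?thesis using claim[of "p - 2"] by (simp only:)
qed

section \<open>The equations L(n) \<Lambda> = 0 under a functional\<close>

context level_hw_mod
begin

text \<open>The sum of the parts of an I-word that exceed n. For n > 0 the step from n to n - 1 adds
  n for each part equal to n.\<close>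

definition tail_weight :: "nat \<Rightarrow> hv list \<Rightarrow> complex" where
  "tail_weight n w = (\<Sum>x\<leftarrow>w. if hv_weight x < - int n then - of_int (hv_weight x) else 0)"

context
  fixes f :: "'v \<Rightarrow> complex" and F :: complex
  assumes lf: "clinear f" and fI: "\<And>j x. j > 0 \<Longrightarrow> f (\<rho> (I (- int j)) x) = - F * f x"
    and fv: "f v = 1" and fL: "\<And>q. q > 0 \<Longrightarrow> f (\<rho> (L (- int q)) v) = 0"
begin

lemma functional_scaleC: "f (a *\<^sub>C x) = a * f x"
  by (simp add: clinear_scale[OF lf] scaleC_complex_def)

lemma functional_L_L:
  assumes "n > 0" "q > 0"
  shows "f (\<rho> (L (int n)) (\<rho> (L (- int q)) v)) = (if n = q then 2 * of_nat n * h + (of_nat n ^ 3 - of_nat n) / 12 * cL else 0)"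
proof -
  have "f (\<rho> (L (int n - int q)) v) = 0" if "n \<noteq> q"
  proof (cases "n < q")
    case True
    then show ?thesis using fL[of "q - n"] by (simp add: of_nat_diff)
  qed (use that in \<open>simp add: clinear_zero[OF lf]\<close>)
  then show ?thesis
    using assms by (simp add: comm_LL[of "int n"] clinear_add[OF lf] clinear_zero[OF lf] functional_scaleC fv)
qed

lemma functional_I_L:
  assumes "m > 0" "q > 0"
  shows "f (\<rho> (I (int m)) (\<rho> (L (- int q)) v)) = (if m = q then of_nat m * c * (of_nat m - of_nat p) else if m < q then - of_nat m * F else 0)"
proof -
  have "f (\<rho> (I (int m - int q)) v) = (if m < q then - F else 0)" if "m \<noteq> q"
  proof (cases "m < q")
    case True
    then show ?thesis using fI[of "q - m" v] by (simp add: of_nat_diff fv)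
  qed (use that in \<open>simp add: clinear_zero[OF lf]\<close>)
  then show ?thesis
    using assms by (simp add: I_L clinear_add[OF lf] clinear_zero[OF lf] functional_scaleC fv)
qed

lemma sum_lessThan_reverse: "(\<Sum>i<p. g (p - i)) = (\<Sum>q = 1..p. g q :: complex)"
  by (rule sum.reindex_bij_witness[of _ "\<lambda>q. p - q" "\<lambda>i. p - i"]) auto

text \<open>L(n) meets L(-n) v in a scalar involving c_L. The terms I(n - k) from commuting with S,
  summed over all L(-q) v by the recursion for the coefficients, leave -k (n - k). As these sum to
  -(n^3 - n) / 6, the central charge is shifted from c_L to c_L - 2.\<close>

lemma functional_L_Schur_part:
  assumes n: "1 \<le> n" "n \<le> p"
  shows "f (\<rho> (L (int n)) (\<Sum>i<p. S (int i) (\<rho> (L (int i - int p)) v)))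
    = schur_coeff (F / c) (int p - int n) * (2 * of_nat n * h + (of_nat n ^ 3 - of_nat n) * ((cL - 2) / 12))"
proof -
  let ?s = "schur_coeff (F / c)"
  define a :: complex where "a = 2 * of_nat n * h + (of_nat n ^ 3 - of_nat n) / 12 * cL"
  define C where "C m q = (if m = q then of_nat m * c * (of_nat m - of_nat p) else if m < q then - of_nat m * F else 0)" for m q :: nat
  have "f (\<rho> (L (int n)) (\<Sum>i<p. S (int i) (\<rho> (L (int i - int p)) v)))
      = (\<Sum>i<p. f (\<rho> (L (int n)) (S (int i) (\<rho> (L (int i - int p)) v))))"
    by (simp add: sum clinear_sum[OF lf])
  also have "\<dots> = (\<Sum>i<p. ?s (int p - int (p - i)) * (if p - i = n then a else 0)
      + (\<Sum>k = 1..<n. 1 / c * ?s (int p - int (p - i) - int k) * C (n - k) (p - i)))"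
  proof (rule sum.cong[OF refl])
    fix i assume i: "i \<in> {..<p}"
    have q: "int i - int p = - int (p - i)" "int i = int p - int (p - i)" "p - i > 0" using i by auto
    have "(\<Sum>k = 1..<n. 1 / c * ?s (int i - int k) * f (\<rho> (I (int n - int k)) (\<rho> (L (- int (p - i))) v)))
       = (\<Sum>k = 1..<n. 1 / c * ?s (int i - int k) * C (n - k) (p - i))"
    proof (rule sum.cong[OF refl])
      fix k assume k: "k \<in> {1..<n}"
      then have "int n - int k = int (n - k)" "n - k > 0" by auto
      then show "1 / c * ?s (int i - int k) * f (\<rho> (I (int n - int k)) (\<rho> (L (- int (p - i))) v)) = 1 / c * ?s (int i - int k) * C (n - k) (p - i)"
        using functional_I_L[of "n - k" "p - i"] q by (simp only: C_def)
    qed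
    then show "f (\<rho> (L (int n)) (S (int i) (\<rho> (L (int i - int p)) v))) = ?s (int p - int (p - i)) * (if p - i = n then a else 0)
      + (\<Sum>k = 1..<n. 1 / c * ?s (int p - int (p - i) - int k) * C (n - k) (p - i))"
      using n functional_L_L[of n "p - i"] fL[OF q(3)] q(3)
      unfolding q(2)[symmetric] q(1) by (subst functional_L_S[OF lf fI]) (auto simp: a_def)
  qed
  also have "\<dots> = (\<Sum>q = 1..p. ?s (int p - int q) * (if q = n then a else 0)
      + (\<Sum>k = 1..<n. 1 / c * ?s (int p - int q - int k) * C (n - k) q))"
    by (rule sum_lessThan_reverse)
  also have "\<dots> = ?s (int p - int n) * a + (\<Sum>k = 1..<n. \<Sum>q = 1..p. 1 / c * ?s (int p - int q - int k) * C (n - k) q)"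
    using n by (subst sum.distrib, subst sum.swap) (simp add: if_distrib sum.delta cong: if_cong)
  also have "(\<Sum>k = 1..<n. \<Sum>q = 1..p. 1 / c * ?s (int p - int q - int k) * C (n - k) q)
      = (\<Sum>k = 1..<n. - (of_nat k * (of_nat n - of_nat k)) * ?s (int p - int n))"
  proof (rule sum.cong[OF refl])
    fix k assume k: "k \<in> {1..<n}"
    define m where "m = n - k"
    have m: "m > 0" "m \<le> p" "int p - int m - int k = int p - int n" "(of_nat m :: complex) = of_nat n - of_nat k"
      using k n by (auto simp: m_def of_nat_diff)
    have pm: "{1..p} = {1..(p - m) + m}" using m by simp
    have e: "int p - int (q + m) - int k = int p - int n - int q" for q using m(3) by simp
    have "(\<Sum>q = 1..p. 1 / c * ?s (int p - int q - int k) * C m q)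
       = 1 / c * ?s (int p - int n) * (of_nat m * c * (of_nat m - of_nat p)) + (\<Sum>q = 1..p - m. 1 / c * ?s (int p - int n - int q) * (- of_nat m * F))"
      unfolding pm sum_split_at[OF m(1)] e m(3) by (auto simp: C_def intro!: sum.neutral sum.cong)
    also have "(\<Sum>q = 1..p - m. 1 / c * ?s (int p - int n - int q) * (- of_nat m * F))
      = of_nat m * (- (F / c) * (\<Sum>q = 1..p - m. ?s (int p - int n - int q)))"
      unfolding sum_distrib_left by (rule sum.cong[OF refl]) (simp add: field_simps)
    also have "- (F / c) * (\<Sum>q = 1..p - m. ?s (int p - int n - int q)) = of_int (int p - int n) * ?s (int p - int n)"
      by (rule schur_coeff_rec[symmetric]) (use m k in \<open>auto simp: m_def\<close>)
    finally have "(\<Sum>q = 1..p. 1 / c * ?s (int p - int q - int k) * C m q) = of_nat m * (of_nat m - of_nat n) * ?s (int p - int n)"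
      using c by (simp add: algebra_simps)
    then show "(\<Sum>q = 1..p. 1 / c * ?s (int p - int q - int k) * C (n - k) q) = - (of_nat k * (of_nat n - of_nat k)) * ?s (int p - int n)"
      unfolding m_def[symmetric] by (simp add: m(4) algebra_simps)
  qed
  also have "\<dots> = - ((of_nat n ^ 3 - of_nat n) / 6) * ?s (int p - int n)"
    unfolding sum_distrib_right[symmetric] sum_negf sum_k_times_n_minus_k ..
  also have "?s (int p - int n) * a + - ((of_nat n ^ 3 - of_nat n) / 6) * ?s (int p - int n)
      = ?s (int p - int n) * (2 * of_nat n * h + (of_nat n ^ 3 - of_nat n) * ((cL - 2) / 12))"
  proof -
    have "s * (u + N / 12 * cL) + - (N / 6) * s = s * (u + N * ((cL - 2) / 12))" for s u N :: complex
      by (simp add: field_simps)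
    then show ?thesis unfolding a_def .
  qed
  finally show ?thesis .
qed

lemma functional_I_words: "(\<And>x. x \<in> set w \<Longrightarrow> \<exists>j>0. x = I (- int j)) \<Longrightarrow> f (foldr \<rho> w v) = (- F) ^ length w"
proof (induction w)
  case (Cons x w)
  then obtain j where "j > 0" "x = I (- int j)" by auto
  then show ?case using Cons fI[of j "foldr \<rho> w v"] by simp
qed (simp add: fv)

text \<open>L(n) acts on one factor I(-j) at a time. For j > n it yields j I(n - j), of value -jF;
  for j = n a scalar, so that one factor -F is missing; for j < n nothing. The prefactor F / c
  restores the missing factor and allows F = 0.\<close>

lemma functional_L_I_words:
  assumes n: "n > 0"
  shows "(\<And>x. x \<in> set w \<Longrightarrow> \<exists>j>0. x = I (- int j)) \<Longrightarrow>
    F / c * f (\<rho> (L (int n)) (foldr \<rho> w v))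
      = (- F) ^ length w * (F / c * tail_weight n w + (of_nat n + of_nat p) * (tail_weight (n - 1) w - tail_weight n w))"
proof (induction w)
  case Nil
  then show ?case using n by (simp add: tail_weight_def clinear_zero[OF lf])
next
  case (Cons x w)
  let ?y = "foldr \<rho> w v"
  obtain j where j: "j > 0" "x = I (- int j)" using Cons.prems by auto
  have fy: "f ?y = (- F) ^ length w" using Cons.prems by (intro functional_I_words) auto
  have IH: "F / c * f (\<rho> (L (int n)) ?y) = (- F) ^ length w * (F / c * tail_weight n w + (of_nat n + of_nat p) * (tail_weight (n - 1) w - tail_weight n w))"
    using Cons by auto
  have tw: "tail_weight k (x # w) = (if k < j then of_nat j else 0) + tail_weight k w" for k
    by (simp add: tail_weight_def j)
  have step: "f (\<rho> (L (int n)) (\<rho> x ?y)) = - F * f (\<rho> (L (int n)) ?y)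
      + (if n = j then - (of_nat n * c * (of_nat n + of_nat p)) * f ?y else of_nat j * f (\<rho> (I (int n - int j)) ?y))"
    using fI[OF j(1), of "\<rho> (L (int n)) ?y"] unfolding j(2) L_I clinear_add[OF lf]
    by (simp add: functional_scaleC del: cvec.scale_minus_left)
  consider "n = j" | "n < j" | "n > j" by linarith
  then show ?case
  proof cases
    case 1
    then have t: "tail_weight n (x # w) = tail_weight n w" "tail_weight (n - 1) (x # w) = of_nat n + tail_weight (n - 1) w"
      using n by (simp_all add: tw)
    have "F / c * f (\<rho> (L (int n)) (\<rho> x ?y)) = - F * (F / c * f (\<rho> (L (int n)) ?y)) + - F * (of_nat n * (of_nat n + of_nat p)) * f ?y"
      using c 1 unfolding step by (simp add: field_simps)
    then show ?thesis unfolding IH fy foldr.simps comp_def t by (simp add: algebra_simps)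
  next
    case 2
    then have t: "tail_weight n (x # w) = of_nat j + tail_weight n w" "tail_weight (n - 1) (x # w) = of_nat j + tail_weight (n - 1) w"
      using n by (simp_all add: tw)
    have "f (\<rho> (I (int n - int j)) ?y) = - F * f ?y" using fI[of "j - n" ?y] 2 by (simp add: of_nat_diff)
    then have "F / c * f (\<rho> (L (int n)) (\<rho> x ?y)) = - F * (F / c * f (\<rho> (L (int n)) ?y)) + - F * (F / c * of_nat j) * f ?y"
      using c 2 unfolding step by (simp add: field_simps)
    then show ?thesis unfolding IH fy foldr.simps comp_def t by (simp add: algebra_simps)
  next
    case 3
    then have t: "tail_weight n (x # w) = tail_weight n w" "tail_weight (n - 1) (x # w) = tail_weight (n - 1) w"
      using n by (simp_all add: tw)
    have "\<rho> (I (int n - int j)) ?y = 0" by (rule I_pos_I_word) (use Cons.prems 3 in auto)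
    then have "F / c * f (\<rho> (L (int n)) (\<rho> x ?y)) = - F * (F / c * f (\<rho> (L (int n)) ?y))"
      using c 3 unfolding step by (simp add: clinear_zero[OF lf])
    then show ?thesis unfolding IH foldr.simps comp_def t by (simp add: algebra_simps)
  qed
qed

context
  fixes x :: ipoly
  assumes x: "weight_poly p x"
    and sing: "\<And>n. n > 0 \<Longrightarrow> \<rho> (L n) (T_act \<rho> (Lambda_rep c p x) v) = 0"
begin

text \<open>The unknowns of the recursion. At n = 0 every monomial has the weight p, and at n = p no
  part is large enough to count.\<close>

definition tail :: "nat \<Rightarrow> complex" where
  "tail n = lin_ext (\<lambda>m. (- F) ^ length (I_word m) * tail_weight n (I_word m)) x"

lemma I_word_set: "m \<in> keys x \<Longrightarrow> a \<in> set (I_word m) \<Longrightarrow> \<exists>j>0. a = I (- int j)"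
proof -
  assume m: "m \<in> keys x" and "a \<in> set (I_word m)"
  then obtain j where j: "j \<in> keys m" "a = I (- int j)" by (auto simp: set_I_word)
  moreover have "0 \<notin> keys m" using x m by (auto simp: weight_poly_def)
  ultimately have "j > 0" by (cases j) auto
  then show ?thesis using j by blast
qed

lemma lin_ext_cong_keys: "(\<And>m. m \<in> keys u \<Longrightarrow> g m = g' m) \<Longrightarrow> lin_ext g u = lin_ext g' u"
  unfolding lin_ext_def by (rule sum.cong) auto

lemma functional_x: "f (T_act \<rho> (I_subst 1 x) v) = lin_ext (\<lambda>m. (- F) ^ length (I_word m)) x"
  unfolding T_act_I_subst clinear_lin_ext_compose[OF lf]
  by (rule lin_ext_cong_keys) (simp add: scaleC_one functional_I_words I_word_set)

lemma tail_0: "tail 0 = of_nat p * f (T_act \<rho> (I_subst 1 x) v)"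
proof -
  have "tail_weight 0 w = - of_int (word_weight w)" if "\<And>a. a \<in> set w \<Longrightarrow> \<exists>j>0. a = I (- int j)" for w
    using that
  proof (induction w)
    case (Cons a w)
    then obtain j where "j > 0" "a = I (- int j)" by auto
    then show ?case using Cons by (simp add: tail_weight_def)
  qed (simp add: tail_weight_def)
  then have "tail_weight 0 (I_word m) = of_nat p" if "m \<in> keys x" for m
    using that x I_word_set[OF that] by (simp add: word_weight_I_word weight_poly_def)
  then have "tail 0 = lin_ext (\<lambda>m. of_nat p *\<^sub>C (- F) ^ length (I_word m)) x"
    unfolding tail_def by (intro lin_ext_cong_keys) (simp add: scaleC_complex_def)
  then show ?thesis unfolding functional_x lin_ext_def by (simp add: scaleC_complex_def sum_distrib_left mult_ac)
qed

lemma tail_p: "tail p = 0"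
proof -
  have "tail_weight p (I_word m) = 0" if m: "m \<in> keys x" for m
  proof -
    have "\<not> hv_weight a < - int p" if "a \<in> set (I_word m)" for a
    proof -
      obtain j where j: "j \<in> keys m" "a = I (- int j)" using \<open>a \<in> set (I_word m)\<close> by (auto simp: set_I_word)
      have "j \<le> j * lookup m j" using j(1) by (simp add: in_keys_iff)
      also have "\<dots> \<le> mono_weight m" unfolding mono_weight_def by (rule member_le_sum) (use j in auto)
      finally show ?thesis using x m j by (simp add: weight_poly_def)
    qed
    moreover have "tail_weight p w = 0" if "\<And>a. a \<in> set w \<Longrightarrow> \<not> hv_weight a < - int p" for w
      using that by (induction w) (auto simp: tail_weight_def)
    ultimately show ?thesis by blast
  qed
  then show ?thesis unfolding tail_def by (subst lin_ext_cong_keys[of _ _ "\<lambda>_. 0"]) (auto simp: lin_ext_def)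
qed

text \<open>The recursion solved above, with \<kappa> = (c_L - 2) / 12 and q = 2h -
  \<kappa>.\<close>

lemma tail_rec:
  assumes n: "1 \<le> n" "n \<le> p"
  shows "F / c * (schur_coeff (F / c) (int p - int n) * (of_nat n * (2 * h - (cL - 2) / 12 + (cL - 2) / 12 * of_nat n ^ 2)))
    + F / c * tail n + (of_nat n + of_nat p) * (tail (n - 1) - tail n) = 0"
proof -
  have "F / c * f (\<rho> (L (int n)) (T_act \<rho> (I_subst 1 x) v))
      = lin_ext (\<lambda>m. F / c * f (\<rho> (L (int n)) (foldr \<rho> (I_word m) v))) x"
    unfolding T_act_I_subst clinear_lin_ext_compose[OF lin] clinear_lin_ext_compose[OF lf]
    by (simp add: lin_ext_def sum_distrib_left scaleC_complex_def scaleC_one mult_ac)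
  also have "\<dots> = lin_ext (\<lambda>m. (- F) ^ length (I_word m) * (F / c * tail_weight n (I_word m) + (of_nat n + of_nat p) * (tail_weight (n - 1) (I_word m) - tail_weight n (I_word m)))) x"
    by (rule lin_ext_cong_keys, rule functional_L_I_words) (use n I_word_set in auto)
  also have "\<dots> = F / c * tail n + (of_nat n + of_nat p) * (tail (n - 1) - tail n)"
    unfolding tail_def lin_ext_def sum_distrib_left sum_subtractf[symmetric] sum.distrib[symmetric]
    by (rule sum.cong) (auto simp: scaleC_complex_def algebra_simps)
  finally have 1: "F / c * f (\<rho> (L (int n)) (T_act \<rho> (I_subst 1 x) v)) = F / c * tail n + (of_nat n + of_nat p) * (tail (n - 1) - tail n)" .
  have "0 = F / c * f (\<rho> (L (int n)) (T_act \<rho> (Lambda_rep c p x) v))"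
    using sing[of "int n"] n by (simp add: clinear_zero[OF lf])
  also have "\<dots> = F / c * (schur_coeff (F / c) (int p - int n) * (2 * of_nat n * h + (of_nat n ^ 3 - of_nat n) * ((cL - 2) / 12)))
      + (F / c * tail n + (of_nat n + of_nat p) * (tail (n - 1) - tail n))"
    unfolding T_act_Lambda_rep add clinear_add[OF lf] functional_L_Schur_part[OF n] distrib_left 1 ..
  also have "2 * of_nat n * h + (of_nat n ^ 3 - of_nat n) * ((cL - 2) / 12) = of_nat n * (2 * h - (cL - 2) / 12 + (cL - 2) / 12 * of_nat n ^ 2)"
    by (simp add: field_simps power2_eq_square power3_eq_cube)
  finally show ?thesis by (simp only: add.assoc)
qed

lemma functional_x_vanishes:
  assumes "F / c = of_nat t" "2 \<le> t" "t < p"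
  shows "f (T_act \<rho> (I_subst 1 x) v) = 0"
  using recursion_vanishes[OF assms(2,3) tail_p tail_rec[unfolded assms(1)]] tail_0 p by simp

lemma functional_x_at_1:
  assumes "F / c = 1" "1 < p"
  shows "f (T_act \<rho> (I_subst 1 x) v) = - ((cL - 2) / 24)"
proof -
  have "of_nat p * f (T_act \<rho> (I_subst 1 x) v) = of_nat p * (- ((cL - 2) / 24))"
    using recursion_at_1[OF assms(2) tail_p tail_rec[unfolded assms(1)]] tail_0 by simp
  then show ?thesis using p by (simp only: mult_cancel_left of_nat_eq_0_iff) simp
qed

end

end

end

section \<open>Functionals on the irreducible quotient\<close>

lemma sum_schur_coeff: "p > 0 \<Longrightarrow> (\<Sum>i<p. schur_coeff t (int i)) = (- 1) ^ (p - 1) * (t - 1 gchoose (p - 1))"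
proof -
  assume "p > 0"
  then have "{..<p} = {..p - 1}" by auto
  then show ?thesis using gbinomial_sum_lower_neg[of t "p - 1"] by (simp add: mult.commute)
qed

text \<open>Partial sums divide the generating series by 1 - y. The weights p - i arise from summing
  twice, which turns (1 - y)^t into (1 - y)^(t - 2).\<close>

lemma sum_weighted_schur_coeff:
  "p > 0 \<Longrightarrow> (\<Sum>i<p. (of_nat p - of_nat i) * schur_coeff t (int i)) = (- 1) ^ (p - 1) * (t - 2 gchoose (p - 1))"
proof -
  assume p: "p > 0"
  have "(\<Sum>i<p. (of_nat p - of_nat i) * schur_coeff t (int i)) = (\<Sum>m<p. \<Sum>i<Suc m. schur_coeff t (int i))" for p
  proof (induction p)
    case (Suc p)
    have "(\<Sum>i<Suc p. (of_nat (Suc p) - of_nat i) * schur_coeff t (int i))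
        = (\<Sum>i<Suc p. (of_nat p - of_nat i) * schur_coeff t (int i)) + (\<Sum>i<Suc p. schur_coeff t (int i))"
      unfolding sum.distrib[symmetric] by (rule sum.cong) (auto simp: algebra_simps simp del: schur_coeff_simps)
    then show ?case using Suc by simp
  qed simp
  also have "(\<Sum>m<p. \<Sum>i<Suc m. schur_coeff t (int i)) = (\<Sum>m<p. schur_coeff (t - 1) (int m))"
    by (rule sum.cong[OF refl], subst sum_schur_coeff) auto
  also have "\<dots> = (- 1) ^ (p - 1) * (t - 2 gchoose (p - 1))"
    using sum_schur_coeff[OF p, of "t - 1"] by simp
  finally show ?thesis .
qed

lemma gbinomial_nonzero:
  assumes "t \<notin> of_nat ` {1..k}"
  shows "(t - 1 gchoose k) \<noteq> (0 :: complex)"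
proof
  assume "(t - 1 gchoose k) = 0"
  then have "(\<Prod>i = 0..<k. t - 1 - of_nat i) = 0" by (simp add: gbinomial_prod_rev)
  then obtain i where "i < k" "t - 1 - of_nat i = 0" by (auto simp: prod_zero_iff)
  then have "t = of_nat (Suc i)" "Suc i \<in> {1..k}" by (auto simp: algebra_simps)
  then show False using assms by blast
qed

lemma (in level_hw_mod) L0_Lambda:
  assumes x: "weight_poly p x"
  shows "\<rho> (L 0) (T_act \<rho> (Lambda_rep c p x) v) = (h + of_nat p) *\<^sub>C T_act \<rho> (Lambda_rep c p x) v"
  by (rule L0_graded[of _ "int p", simplified])
    (auto simp: T_act_def dest: keys_Lambda_rep[OF x] intro!: lin_ext_in_subspace[OF subspace_graded] graded_base)

section \<open>The functionals \<phi>_n on the Verma module and on its quotient\<close>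

context verma_mod
begin

lemma phi_functional:
  obtains f where "clinear f" "\<And>u. u \<in> T_minus \<Longrightarrow> f (T_act \<rho> u v) = lin_ext (phi_word \<alpha> \<beta> F n) u"
    "\<And>w. list_all neg w \<Longrightarrow> f (foldr \<rho> w v) = phi_word \<alpha> \<beta> F n w"
    "\<And>j x. j > 0 \<Longrightarrow> f (\<rho> (I (- int j)) x) = - F * f x"
proof -
  obtain f where f: "clinear f" "\<And>u. u \<in> T_minus \<Longrightarrow> f (T_act \<rho> u v) = lin_ext (phi_word \<alpha> \<beta> F n) u"
    using functional_exists[OF phi_ideal] by blast
  have fw: "f (foldr \<rho> w v) = phi_word \<alpha> \<beta> F n w" if "list_all neg w" for w
    using f(2)[of "single w 1"] that by (simp add: T_minus_def scaleC_one)
  have "f (\<rho> (I (- int j)) x) = - F * f x" if j: "j > 0" for j x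
  proof (rule word_span_eq[OF in_word_span clinear_compose[OF f(1) lin], of "\<lambda>x. - F * f x"])
    show "clinear (\<lambda>x. - F * f x)"
      by (rule clinearI) (simp_all add: clinear_add[OF f(1)] clinear_scale[OF f(1)] scaleC_complex_def algebra_simps)
    fix w assume "list_all neg w"
    then show "f (\<rho> (I (- int j)) (foldr \<rho> w v)) = - F * f (foldr \<rho> w v)"
      using fw[of "I (- int j) # w"] fw[of w] j by simp
  qed
  then show ?thesis using that f fw by blast
qed

text \<open>\<phi>_n(L(i - p)) equals (\<alpha> + \<beta> + n) + (1 - \<beta>) (p - i). The two
  summands lead to the plain and to the weighted sum of the Schur coefficients.\<close>

lemma phi_Lambda:
  assumes x: "weight_poly p x"
  shows "lin_ext (phi_word \<alpha> \<beta> F n) (Lambda_rep c p x) =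
    (- 1) ^ (p - 1) * ((F / c - 1 gchoose (p - 1)) * (\<alpha> + \<beta> + of_int n) + (1 - \<beta>) * (F / c - 2 gchoose (p - 1)))
    + lin_ext (phi_word \<alpha> \<beta> F n) (I_subst 1 x)"
proof -
  obtain f where f: "clinear f" "\<And>u. u \<in> T_minus \<Longrightarrow> f (T_act \<rho> u v) = lin_ext (phi_word \<alpha> \<beta> F n) u"
    "\<And>w. list_all neg w \<Longrightarrow> f (foldr \<rho> w v) = phi_word \<alpha> \<beta> F n w"
    "\<And>j x. j > 0 \<Longrightarrow> f (\<rho> (I (- int j)) x) = - F * f x"
    using phi_functional by blast
  have "lin_ext (phi_word \<alpha> \<beta> F n) (Lambda_rep c p x) = f (T_act \<rho> (Lambda_rep c p x) v)"
    using f(2) Lambda_rep_T_minus[OF x] by simp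
  also have "\<dots> = (\<Sum>i<p. f (S (int i) (\<rho> (L (int i - int p)) v))) + lin_ext (phi_word \<alpha> \<beta> F n) (I_subst 1 x)"
    unfolding T_act_Lambda_rep clinear_add[OF f(1)] clinear_sum[OF f(1)] f(2)[OF I_subst_T_minus[OF x]] ..
  also have "(\<Sum>i<p. f (S (int i) (\<rho> (L (int i - int p)) v)))
      = (\<Sum>i<p. schur_coeff (F / c) (int i) * (\<alpha> + \<beta> + of_int n) + (1 - \<beta>) * ((of_nat p - of_nat i) * schur_coeff (F / c) (int i)))"
  proof (rule sum.cong[OF refl])
    fix i assume "i \<in> {..<p}"
    then have e: "f (\<rho> (L (int i - int p)) v) = \<alpha> + \<beta> + of_int n + (1 - \<beta>) * (of_nat p - of_nat i)"
      using f(3)[of "[L (int i - int p)]"] by (simp add: algebra_simps)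
    show "f (S (int i) (\<rho> (L (int i - int p)) v)) = schur_coeff (F / c) (int i) * (\<alpha> + \<beta> + of_int n) + (1 - \<beta>) * ((of_nat p - of_nat i) * schur_coeff (F / c) (int i))"
      by (subst functional_S[OF f(1,4)], assumption, unfold e) (simp only: algebra_simps)
  qed
  also have "\<dots> = (- 1) ^ (p - 1) * ((F / c - 1 gchoose (p - 1)) * (\<alpha> + \<beta> + of_int n) + (1 - \<beta>) * (F / c - 2 gchoose (p - 1)))"
    unfolding sum.distrib sum_distrib_right[symmetric] sum_distrib_left[symmetric] sum_schur_coeff[OF p] sum_weighted_schur_coeff[OF p]
    by (simp add: algebra_simps)
  finally show ?thesis .
qed

text \<open>Since \<open>g\<^sub>p\<close> depends neither on \<open>\<alpha>\<close> and \<open>\<beta>\<close> nor on \<open>n\<close>, they can be chosen such that the functional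
  kills all vectors \<open>L(-q) v\<close>.\<close>

lemma phi_x:
  assumes x: "weight_poly p x"
    and sing: "\<And>n. n > 0 \<Longrightarrow> \<rho> (L n) (T_act \<rho> (Lambda_rep c p x) v) = 0"
  shows "F / c = of_nat t \<Longrightarrow> 2 \<le> t \<Longrightarrow> t < p \<Longrightarrow> lin_ext (phi_word (- 1) 1 F 0) (I_subst 1 x) = 0"
    and "F / c = 1 \<Longrightarrow> 1 < p \<Longrightarrow> lin_ext (phi_word (- 1) 1 F 0) (I_subst 1 x) = - ((cL - 2) / 24)"
proof -
  obtain f where f: "clinear f" "\<And>u. u \<in> T_minus \<Longrightarrow> f (T_act \<rho> u v) = lin_ext (phi_word (- 1) 1 F 0) u"
    "\<And>w. list_all neg w \<Longrightarrow> f (foldr \<rho> w v) = phi_word (- 1) 1 F 0 w"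
    "\<And>j x. j > 0 \<Longrightarrow> f (\<rho> (I (- int j)) x) = - F * f x"
    using phi_functional by blast
  have fv: "f v = 1" using f(3)[of "[]"] by simp
  \<comment> \<open>For \<alpha> = -1, \<beta> = 1, n = 0 the value is \<alpha> + \<beta> + q + n -
    q \<beta> = 0.\<close>
  have fL: "f (\<rho> (L (- int q)) v) = 0" if "q > 0" for q using f(3)[of "[L (- int q)]"] that by simp
  note fx = f(2)[OF I_subst_T_minus[OF x]]
  show "lin_ext (phi_word (- 1) 1 F 0) (I_subst 1 x) = 0" if "F / c = of_nat t" "2 \<le> t" "t < p"
    using functional_x_vanishes[OF f(1,4) fv fL x sing that] fx by simp
  show "lin_ext (phi_word (- 1) 1 F 0) (I_subst 1 x) = - ((cL - 2) / 24)" if "F / c = 1" "1 < p"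
    using functional_x_at_1[OF f(1,4) fv fL x sing that] fx by simp
qed

text \<open>The generators of the ideal are homogeneous, so the truncation of \<phi>_n to a single
  weight still vanishes on them.\<close>

lemma graded_phi_functional:
  "\<exists>f. clinear f \<and> (\<forall>w. list_all neg w \<longrightarrow>
     f (foldr \<rho> w v) = (if word_weight w = - d then phi_word \<alpha> \<beta> F n w else 0))"
proof -
  let ?g = "\<lambda>w. if word_weight w = - d then phi_word \<alpha> \<beta> F n w else 0"
  have "lin_ext ?g u = 0" if u: "u \<in> U_minus_ideal" for u
  proof (rule clinear_vanishes_on_span[OF clinear_lin_ext _ u[unfolded U_minus_ideal_def]])
    let ?G = "{single (a @ [x, y] @ b) 1 - single (a @ [y, x] @ b) 1
       - lin_ext (\<lambda>z. single (a @ [z] @ b) 1) (bracket x y) | a b x y.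
      list_all neg a \<and> list_all neg b \<and> neg x \<and> neg y}"
    fix g :: hv_tensor_alg assume g: "g \<in> ?G"
    then obtain a b x y where e: "g = single (a @ [x, y] @ b) 1 - single (a @ [y, x] @ b) 1
       - lin_ext (\<lambda>z. single (a @ [z] @ b) 1) (bracket x y)" by blast
    have "g \<in> U_minus_ideal" unfolding U_minus_ideal_def by (rule cvec.span_base[OF g])
    then have 0: "lin_ext (phi_word \<alpha> \<beta> F n) g = 0" by (rule phi_ideal)
    let ?k = "word_weight (a @ [x, y] @ b)"
    let ?e = "if ?k = - d then 1 else 0 :: complex"
    let ?s = "\<lambda>z. single (a @ [z] @ b) (1 :: complex)"
    have "lin_ext ?g (?s z) = ?e * lin_ext (phi_word \<alpha> \<beta> F n) (?s z)" if "z \<in> keys (bracket x y)" for z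
      using keys_bracket[OF that] by (simp add: scaleC_one)
    then have "(\<Sum>z\<in>keys (bracket x y). lookup (bracket x y) z *\<^sub>C lin_ext ?g (?s z))
        = ?e * (\<Sum>z\<in>keys (bracket x y). lookup (bracket x y) z *\<^sub>C lin_ext (phi_word \<alpha> \<beta> F n) (?s z))"
      unfolding sum_distrib_left by (intro sum.cong refl) (simp only: scaleC_complex_def mult.left_commute)
    moreover have "lin_ext k (lin_ext ?s u) = (\<Sum>z\<in>keys u. lookup u z *\<^sub>C lin_ext k (?s z))" for k :: "hv list \<Rightarrow> complex" and u
      by (subst clinear_lin_ext_compose[OF clinear_lin_ext]) (rule lin_ext_def)
    ultimately have "lin_ext ?g (lin_ext ?s (bracket x y)) = ?e * lin_ext (phi_word \<alpha> \<beta> F n) (lin_ext ?s (bracket x y))"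
      by (simp only:)
    then have "lin_ext ?g g = ?e * lin_ext (phi_word \<alpha> \<beta> F n) g"
      unfolding e lin_ext_diff by (simp add: scaleC_one algebra_simps)
    then show "lin_ext ?g g = 0" using 0 by simp
  qed
  from functional_exists[OF this] obtain f where f: "clinear f" "\<And>u. u \<in> T_minus \<Longrightarrow> f (T_act \<rho> u v) = lin_ext ?g u" by blast
  have "f (foldr \<rho> w v) = ?g w" if "list_all neg w" for w
    using f(2)[of "single w 1"] that by (simp add: T_minus_def scaleC_one)
  then show ?thesis using f(1) by blast
qed

text \<open>By \<open>phi_word_prefix\<close>, \<phi>_n(w \<Lambda>) is a multiple of
  \<phi>_n(\<Lambda>) = 0 for each word w, because \<Lambda> is homogeneous. So the truncated
  functional kills U(H^-) \<Lambda>, which contains the kernel of \<open>q\<close> by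
  \<open>kernel_subset\<close>.\<close>

lemma quotient_functional:
  assumes x: "weight_poly p x"
    and sing: "\<And>n. n > 0 \<Longrightarrow> \<rho> (L n) (T_act \<rho> (Lambda_rep c p x) v) = 0"
      "\<And>n. n > 0 \<Longrightarrow> \<rho> (I n) (T_act \<rho> (Lambda_rep c p x) v) = 0"
    and q: "hv_hom \<rho> \<sigma> q" "surj q" "q v \<noteq> 0" "q (T_act \<rho> (Lambda_rep c p x) v) = 0"
    and phi0: "lin_ext (phi_word \<alpha> \<beta> F n) (Lambda_rep c p x) = 0"
  shows "\<exists>f. clinear f \<and> (\<forall>w. list_all neg w \<longrightarrow>
     f (foldr \<sigma> w (q v)) = (if word_weight w = - d then phi_word \<alpha> \<beta> F n w else 0))"
proof -
  let ?u = "Lambda_rep c p x"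
  let ?y = "T_act \<rho> ?u v"
  note lq = hv_homD(1)[OF q(1)]
  define J where "J = {z. q z = 0}"
  have J: "submodule \<rho> J" unfolding J_def by (rule submodule_kernel[OF q(1)])
  define Y where "Y = neg_span \<rho> {?y}"
  have Y: "submodule \<rho> Y"
    unfolding Y_def by (rule submodule_neg_span_singular)
      (use sing L0_Lambda[OF x] in \<open>auto intro: exI[of _ 0]\<close>)
  have "Y \<subseteq> J" unfolding Y_def by (rule neg_span_least[OF J]) (use q(4) in \<open>simp add: J_def\<close>)
  moreover have "?y \<in> Y" unfolding Y_def using neg_span_base[of "[]" ?y "{?y}" \<rho>] by simp
  ultimately have JY: "J \<subseteq> Y"
    using kernel_subset[OF J _ Y] L_p_reduced[OF x] q(3) by (simp add: J_def)
  obtain f where f: "clinear f" "\<And>w. list_all neg w \<Longrightarrow> f (foldr \<rho> w v) = (if word_weight w = - d then phi_word \<alpha> \<beta> F n w else 0)"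
    using graded_phi_functional[of d] by blast
  have fJ: "f z = 0" if "z \<in> J" for z
  proof (rule clinear_vanishes_on_span[OF f(1)])
    show "z \<in> cvec.span {foldr \<rho> w a | w a. list_all neg w \<and> a \<in> {?y}}"
      using that JY by (auto simp: Y_def neg_span_def)
    fix b assume "b \<in> {foldr \<rho> w a | w a. list_all neg w \<and> a \<in> {?y}}"
    then obtain w where w: "b = foldr \<rho> w ?y" "list_all neg w" by blast
    obtain C where C: "\<And>k. word_weight k = - int p \<Longrightarrow> phi_word \<alpha> \<beta> F n (w @ k) = C * phi_word \<alpha> \<beta> F n k"
      using phi_word_prefix by blast
    have "f b = (\<Sum>k\<in>keys ?u. lookup ?u k * f (foldr \<rho> (w @ k) v))"
      unfolding w(1) T_act_def clinear_lin_ext_compose[OF lin_foldr] clinear_lin_ext_compose[OF f(1)]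
      by (simp add: lin_ext_def scaleC_complex_def)
    also have "\<dots> = (\<Sum>k\<in>keys ?u. (if word_weight w - int p = - d then C else 0) * (lookup ?u k * phi_word \<alpha> \<beta> F n k))"
    proof (rule sum.cong[OF refl])
      fix k assume "k \<in> keys ?u"
      then have "list_all neg k" "word_weight k = - int p" using keys_Lambda_rep[OF x] by auto
      then show "lookup ?u k * f (foldr \<rho> (w @ k) v) = (if word_weight w - int p = - d then C else 0) * (lookup ?u k * phi_word \<alpha> \<beta> F n k)"
        using f(2)[of "w @ k"] w(2) C by (simp del: foldr_append)
    qed
    also have "\<dots> = (if word_weight w - int p = - d then C else 0) * lin_ext (phi_word \<alpha> \<beta> F n) ?u"
      by (simp add: lin_ext_def sum_distrib_left scaleC_complex_def)
    finally show "f b = 0" using phi0 by simp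
  qed
  \<comment> \<open>An arbitrary section of \<open>q\<close> will do, since \<open>f\<close> is
    constant on the fibres.\<close>
  define g where "g z = f (inv q z)" for z
  have g: "g (q z) = f z" for z
  proof -
    have "q (inv q (q z)) = q z" using q(2) by (simp add: surj_f_inv_f)
    then have "inv q (q z) - z \<in> J" by (simp add: J_def clinear_diff[OF lq])
    then show ?thesis using fJ clinear_diff[OF f(1)] unfolding g_def by fastforce
  qed
  have "clinear g"
  proof (rule clinearI)
    fix z z' a
    obtain y y' where "z = q y" "z' = q y'" using q(2) by (metis surjD)
    then show "g (z + z') = g z + g z'" "g (a *\<^sub>C z) = a *\<^sub>C g z"
      by (simp_all add: g clinear_add[OF lq, symmetric] clinear_scale[OF lq, symmetric] clinear_add[OF f(1)] clinear_scale[OF f(1)])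
  qed
  then show ?thesis using f(2) by (intro exI[of _ g]) (simp add: g hv_hom_foldr[OF q(1), symmetric])
qed

end

text \<open>In (1), \<alpha>_0 is normalised at index -1: the submodule generated by v_0 \<otimes> v
  contains all later v_m \<otimes> v, and v_(-1) \<otimes> v is the vector it must miss. Passing
  from \<alpha>_0 to \<alpha>_0 + k renumbers v_0 as v_(-k). The quotient is generated by the image
  of v_(-k-1) \<otimes> v, and this index shift puts 1 - \<beta> into its weight. In (3),
  \<open>g\<^sub>p\<close> has the value -(c_L - 2) / 24 whatever \<beta> is; it is \<beta> - 1 when
  the product is reducible.\<close>

theorem theorem5p5:
  fixes cL h cLI hI \<alpha> \<beta> F :: complex and p :: nat
    and V :: "hv \<Rightarrow> 'm \<Rightarrow> 'm::complex_vector" and vh :: 'm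
    and Lirr :: "hv \<Rightarrow> 'l \<Rightarrow> 'l::complex_vector" and \<pi> :: "'m \<Rightarrow> 'l" and v :: 'l
    and x\<^sub>p :: ipoly and \<Lambda> :: U_minus and g\<^sub>p :: "complex poly"
    and T :: "hv \<Rightarrow> (int \<Rightarrow>\<^sub>0 complex, 'l) tensor \<Rightarrow> (int \<Rightarrow>\<^sub>0 complex, 'l) tensor"
    and W :: "int \<Rightarrow> (int \<Rightarrow>\<^sub>0 complex, 'l) tensor set"
  assumes "cLI \<noteq> 0" and "p > 0" and "hI / cLI - 1 = - of_nat p"
    and "irreducible_module (interm_series \<alpha> \<beta> F)"
    and "verma_module V cL 0 cLI h hI vh"
    and "irreducible_module Lirr" and "hv_hom V Lirr \<pi>" and "surj \<pi>" and "v = \<pi> vh"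
    and "weight_poly p x\<^sub>p" and "\<Lambda> = Lambda cLI p x\<^sub>p"
    and "singular_vector V (U_minus_act V \<Lambda> vh)"
    and "\<And>\<alpha>' \<beta>' F' n. poly g\<^sub>p F' = phi \<alpha>' \<beta>' F' n (I_poly x\<^sub>p)"
    and "T = tensor_module (interm_series \<alpha> \<beta> F) Lirr"
    and "\<And>n. W n = U_orbit T (ivec n \<otimes> v)"
  shows
    "(F / cLI \<notin> of_nat ` {1..p - 1} \<longrightarrow>
       (\<forall>\<alpha>\<^sub>0. phi \<alpha>\<^sub>0 \<beta> F (- 1) \<Lambda> = 0 \<longrightarrow>
          (reducible_module T \<longleftrightarrow> (\<exists>k::int. \<alpha> = \<alpha>\<^sub>0 + of_int k)) \<and>
          (\<forall>k::int. \<alpha> = \<alpha>\<^sub>0 + of_int k \<longrightarrow>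
             simple_submodule T (W (- k)) \<and>
             (\<forall>S. simple_submodule T S \<longrightarrow> S = W (- k)) \<and>
             (\<forall>(Q :: hv \<Rightarrow> 'q \<Rightarrow> 'q::complex_vector) q. quotient_module T (W (- k)) Q q \<longrightarrow>
                (\<exists>w. highest_weight_module Q cL 0 cLI (- \<alpha>\<^sub>0 + h + (1 - \<beta>)) (F + hI) w))))) \<and>
     (F / cLI \<in> of_nat ` {2..p - 1} \<longrightarrow>
       reducible_module T \<and> (\<forall>i\<in>{2..p - 1}. poly g\<^sub>p (of_nat i * cLI) = 0)) \<and>
     (p > 1 \<and> F / cLI = 1 \<longrightarrow>
       (reducible_module T \<longleftrightarrow> 1 - \<beta> = (cL - 2) / 24) \<and>
       (reducible_module T \<longrightarrow> poly g\<^sub>p cLI = \<beta> - 1))"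
proof -
  have "hI = cLI * (1 - of_nat p)" using assms(1,3) by (simp add: field_simps)
  then interpret Vm: verma_mod V cL cLI h hI vh p
    by unfold_locales (use assms in \<open>auto simp: verma_module_def\<close>)
  note l\<pi> = hv_homD(1)[OF assms(7)] and hom = hv_homD(2)[OF assms(7)]
  have modL: "hv_module Lirr" using assms(6) by (simp add: irreducible_module_def)
  have v0: "v \<noteq> 0"
  proof
    assume v: "v = 0"
    have "U_orbit V vh \<subseteq> {z. \<pi> z = 0}"
      by (rule Vm.U_orbit_least[OF Vm.submodule_kernel[OF assms(7)]]) (use v assms(9) in simp)
    then have "\<pi> z = 0" for z by (auto simp: Vm.orbit_v)
    then have "y = 0" for y :: 'l using surjD[OF assms(8), of y] by auto
    then show False using assms(6) by (auto simp: irreducible_module_def)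
  qed
  have hwL: "highest_weight_module Lirr cL 0 cLI h hI v"
    using hw_quotient[OF Vm.hw assms(7,8) modL] v0 assms(9) by simp
  interpret Lm: tensor_hw Lirr cL cLI h hI v \<alpha> \<beta> F
    by unfold_locales (fact hwL assms(6) assms(4))+
  have T: "T = Lm.T" using assms(14) by (simp add: Lm.T_def)
  note x = assms(10)
  let ?u = "Lambda_rep cLI p x\<^sub>p"
  define y where "y = T_act V ?u vh"
  have \<Lambda>: "\<Lambda> = abs_U_minus ?u" using assms(11) by (simp add: Lambda_eq)
  have "U_minus_act V \<Lambda> vh = y"
    unfolding \<Lambda> y_def by (rule Vm.U_minus_act_abs[OF Lambda_rep_T_minus[OF x]])
  then have sing: "\<And>n. n > 0 \<Longrightarrow> V (L n) y = 0" "\<And>n. n > 0 \<Longrightarrow> V (I n) y = 0"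
    using assms(12) by (auto simp: singular_vector_def)
  have keys: "\<And>w. w \<in> keys ?u \<Longrightarrow> list_all neg w \<and> word_weight w = - int p"
    by (rule keys_Lambda_rep[OF x])
  have L0y: "V (L 0) y = (h + of_nat p) *\<^sub>C y"
    unfolding y_def by (rule Vm.L0_Lambda[OF x])
  \<comment> \<open>Otherwise the image would be a singular vector of positive depth in an
    irreducible module.\<close>
  have "\<pi> y = 0"
    by (rule Lm.no_singular_vector[OF assms(2)])
      (simp_all add: hom[symmetric] sing L0y clinear_zero[OF l\<pi>] clinear_scale[OF l\<pi>])
  then have Ly: "T_act Lirr ?u v = 0"
    by (simp add: y_def T_act_def clinear_lin_ext_compose[OF l\<pi>] hv_hom_foldr[OF assms(7)] assms(9))
  define b where "b m = lin_ext (phi_word \<alpha> \<beta> F m) ?u" for m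
  have in_P_iff: "ivec m \<otimes> v \<in> Lm.P (m + 1) \<longleftrightarrow> b m \<noteq> 0" for m
  proof
    assume bm: "b m \<noteq> 0"
    show "ivec m \<otimes> v \<in> Lm.P (m + 1)"
      by (rule Lm.in_next_P[of ?u "int p"]) (use keys Ly bm in \<open>auto simp: b_def\<close>)
  next
    assume P: "ivec m \<otimes> v \<in> Lm.P (m + 1)"
    show "b m \<noteq> 0"
    proof
      assume "b m = 0"
      then have "\<exists>f. clinear f \<and> (\<forall>w. list_all neg w \<longrightarrow>
          f (foldr Lirr w v) = (if word_weight w = - d then phi_word \<alpha> \<beta> F m w else 0))" for d
        unfolding assms(9) b_def
        by (intro Vm.quotient_functional[OF x]) (use sing assms(7,8,9) v0 \<open>\<pi> y = 0\<close> in \<open>auto simp: y_def\<close>)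
      then obtain f where "\<And>d. clinear (f d)" "\<And>d w. list_all neg w \<Longrightarrow>
          f d (foldr Lirr w v) = (if word_weight w = - d then phi_word \<alpha> \<beta> F m w else 0)"
        by metis
      then show False using Lm.not_in_next_P P by blast
    qed
  qed
  have red_iff: "reducible_module T \<longleftrightarrow> (\<exists>m. b m = 0)"
    unfolding T Lm.reducible_iff in_P_iff by simp
  have g: "poly g\<^sub>p F' = lin_ext (phi_word \<alpha>' \<beta>' F' m) (I_subst 1 x\<^sub>p)" for \<alpha>' \<beta>' F' m
    using assms(13)[of F' \<alpha>' \<beta>' m] unfolding I_poly_def by (simp add: phi_abs[OF I_subst_T_minus[OF x]])
  \<comment> \<open>Slope and constant term of \<phi>_m(\<Lambda>) as an affine function of \<alpha>
    + \<beta> + m.\<close>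
  define A where "A = (- 1) ^ (p - 1) * (F / cLI - 1 gchoose (p - 1))"
  define D where "D = (- 1) ^ (p - 1) * ((1 - \<beta>) * (F / cLI - 2 gchoose (p - 1))) + poly g\<^sub>p F"
  have val: "lin_ext (phi_word \<alpha>' \<beta> F m) ?u = A * (\<alpha>' + \<beta> + of_int m) + D" for \<alpha>' m
    unfolding Vm.phi_Lambda[OF x] g[of F \<alpha>' \<beta> m, symmetric] A_def D_def by (simp add: algebra_simps)
  have b: "b m = A * (\<alpha> + \<beta> + of_int m) + D" for m
    unfolding b_def by (rule val)
  have g_int: "poly g\<^sub>p (of_nat i * cLI) = 0" if "i \<in> {2..p - 1}" for i
  proof -
    have "2 \<le> i" "i < p" using that by auto
    then show ?thesis
      using Vm.phi_x(1)[OF x sing(1)[unfolded y_def], of "of_nat i * cLI" i] assms(1) g[of "of_nat i * cLI" "- 1" 1 0] by simp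
  qed
  have g_1: "poly g\<^sub>p cLI = - ((cL - 2) / 24)" if "p > 1"
    using Vm.phi_x(2)[OF x sing(1)[unfolded y_def], of cLI] assms(1) that g[of cLI "- 1" 1 0] by simp
  have A0: "A = 0" if "F / cLI = of_nat t" "t \<in> {1..p - 1}" for t
  proof -
    have "(F / cLI - 1 gchoose (p - 1)) = of_nat ((t - 1) choose (p - 1))"
      using that by (simp add: of_nat_diff binomial_gbinomial)
    also have "(t - 1) choose (p - 1) = 0" using that by (intro binomial_eq_0) auto
    finally show ?thesis by (simp add: A_def)
  qed
  show ?thesis
  proof (intro conjI impI allI)
    fix \<alpha>\<^sub>0
    assume "F / cLI \<notin> of_nat ` {1..p - 1}" and phi0: "phi \<alpha>\<^sub>0 \<beta> F (- 1) \<Lambda> = 0"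
    then have A: "A \<noteq> 0" unfolding A_def using gbinomial_nonzero by simp
    have "A * (\<alpha>\<^sub>0 + \<beta> - 1) + D = 0"
      using phi0 val[of \<alpha>\<^sub>0 "- 1"] unfolding \<Lambda> phi_abs[OF Lambda_rep_T_minus[OF x]] by (simp add: algebra_simps)
    then have "b m = A * (\<alpha> - (\<alpha>\<^sub>0 + of_int (- m - 1)))" for m
      unfolding b by (simp add: algebra_simps)
    then have b0: "b m = 0 \<longleftrightarrow> \<alpha> = \<alpha>\<^sub>0 + of_int (- m - 1)" for m
      using A by (simp only: mult_eq_0_iff right_minus_eq simp_thms)
    show "reducible_module T \<longleftrightarrow> (\<exists>k::int. \<alpha> = \<alpha>\<^sub>0 + of_int k)"
      unfolding red_iff b0
    proof
      assume "\<exists>k::int. \<alpha> = \<alpha>\<^sub>0 + of_int k"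
      then obtain k :: int where "\<alpha> = \<alpha>\<^sub>0 + of_int k" ..
      then show "\<exists>m. \<alpha> = \<alpha>\<^sub>0 + of_int (- m - 1)" by (intro exI[of _ "- k - 1"]) simp
    qed blast
    fix k :: int
    assume k: "\<alpha> = \<alpha>\<^sub>0 + of_int k"
    have b0': "b m = 0 \<longleftrightarrow> m = - k - 1" for m
      unfolding b0 k by (simp only: add_left_cancel of_int_eq_iff) auto
    have step: "ivec m \<otimes> v \<in> Lm.P (m + 1)" if "m \<ge> - k" for m
      unfolding in_P_iff b0' using that by simp
    have W: "W (- k) = Lm.P (- k)"
      unfolding assms(15) T by (rule Lm.U_orbit_eq_P[OF step])
    show "simple_submodule T (W (- k))" unfolding W T by (rule Lm.simple_submodule_P(1)[OF step])
    show "S = W (- k)" if "simple_submodule T S" for S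
      unfolding W by (rule Lm.simple_submodule_P(2)) (use that step in \<open>simp_all add: T\<close>)
    fix Q :: "hv \<Rightarrow> 'q \<Rightarrow> 'q" and q
    assume "quotient_module T (W (- k)) Q q"
    \<comment> \<open>The index is rewritten as n + 1 for n = -k - 1, the only zero of
      \<open>b\<close>.\<close>
    then have Q: "quotient_module Lm.T (Lm.P (- k - 1 + 1)) Q q" by (simp add: W T)
    have "highest_weight_module Q cL 0 cLI (- (of_int (- k - 1) + \<alpha> + \<beta>) + h) (F + hI) (q (ivec (- k - 1) \<otimes> v))"
      by (rule Lm.highest_weight_quotient[OF _ _ Q]) (simp_all only: in_P_iff b0' simp_thms)
    moreover have "- (of_int (- k - 1) + \<alpha> + \<beta>) + h = - \<alpha>\<^sub>0 + h + (1 - \<beta>)" by (simp add: k)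
    ultimately show "\<exists>w. highest_weight_module Q cL 0 cLI (- \<alpha>\<^sub>0 + h + (1 - \<beta>)) (F + hI) w" by metis
  next
    assume "F / cLI \<in> of_nat ` {2..p - 1}"
    then obtain t where t: "F / cLI = of_nat t" "t \<in> {2..p - 1}" by blast
    have "(F / cLI - 2 gchoose (p - 1)) = of_nat ((t - 2) choose (p - 1))"
      using t by (simp add: of_nat_diff binomial_gbinomial)
    also have "(t - 2) choose (p - 1) = 0" using t by (intro binomial_eq_0) auto
    finally have "(F / cLI - 2 gchoose (p - 1)) = 0" by simp
    moreover have "F = of_nat t * cLI" using t assms(1) by (simp add: field_simps)
    ultimately have "D = 0" unfolding D_def using g_int[OF t(2)] by simp
    then have "b 0 = 0" unfolding b using A0[OF t(1)] t(2) by simp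
    then show "reducible_module T" unfolding red_iff by blast
  next
    show "\<forall>i\<in>{2..p - 1}. poly g\<^sub>p (of_nat i * cLI) = 0" using g_int by blast
  next
    assume p: "p > 1 \<and> F / cLI = 1"
    then have F: "F = cLI" using assms(1) by (simp add: field_simps)
    \<comment> \<open>At F / c = 1 the coefficient of 1 - \<beta> comes from (1 - y)^(-1), all of
      whose coefficients are 1.\<close>
    have "(- 1) ^ (p - 1) * ((- 1 :: complex) gchoose (p - 1)) = (\<Sum>k\<le>p - 1. (0 gchoose k) * (- 1) ^ k)"
      using gbinomial_sum_lower_neg[of "0 :: complex" "p - 1"] by simp
    also have "\<dots> = 1" by (simp add: sum.atMost_shift)
    finally have "(- 1) ^ (p - 1) * (F / cLI - 2 gchoose (p - 1)) = 1" using p by simp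
    then have "D = 1 - \<beta> - (cL - 2) / 24"
      unfolding D_def mult.left_commute[of "(- 1) ^ (p - 1)"] using g_1 p by (simp add: F)
    moreover have "A = 0" using p by (intro A0[of 1]) auto
    ultimately have "b m = 1 - \<beta> - (cL - 2) / 24" for m by (simp add: b)
    then show *: "reducible_module T \<longleftrightarrow> 1 - \<beta> = (cL - 2) / 24" unfolding red_iff by simp
    show "poly g\<^sub>p cLI = \<beta> - 1" if "reducible_module T"
      using that * g_1 p by (metis minus_diff_eq)
  qed
qed

end
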